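(* Let $G$ be a finite simple planar graph of order $n$ whose adjacency matrix $A(G)$ is non-singular, and suppose $G$ is isomorphic neither to the path $P_4$ nor to the paw $H$. Then $\mathcal{E}(G)\geq n-1+\bar{d}$.
   Context: For a finite simple graph $G$ with $n$ vertices and $m$ edges, $A(G)$ is its adjacency matrix with eigenvalues $\lambda_1\ge\cdots\ge\lambda_n$, and the energy is $\mathcal{E}(G)=\sum_{i=1}^n|\lambda_i|$. $G$ is non-singular if $A(G)$ is non-singular. $\bar d=2m/n$ is the average degree. $P_4$ is the path on 4 vertices, and the paw $H$ is the graph on 4 vertices consisting of a triangle together with one extra vertex adjacent to exactly one vertex of the triangle. *)

theory Defs
  imports "HOL-Analysis.Analysis" "HOL-Computational_Algebra.Polynomial"
begin

definition simple_graph :: "('n::finite \<Rightarrow> 'n \<Rightarrow> bool) \<Rightarrow> bool" where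
  "simple_graph E \<longleftrightarrow> (\<forall>u v. E u v \<longrightarrow> E v u) \<and> (\<forall>u. \<not> E u u)"

definition adj_matrix :: "('n::finite \<Rightarrow> 'n \<Rightarrow> bool) \<Rightarrow> real^'n^'n" where
  "adj_matrix E = (\<chi> i j. if E i j then 1 else 0)"

definition edges :: "('n::finite \<Rightarrow> 'n \<Rightarrow> bool) \<Rightarrow> 'n set set" where
  "edges E = {{u, v} | u v. E u v}"

definition avg_degree :: "('n::finite \<Rightarrow> 'n \<Rightarrow> bool) \<Rightarrow> real" where
  "avg_degree E = 2 * real (card (edges E)) / real CARD('n)"

definition charpoly :: "real^'n^'n \<Rightarrow> real poly" where
  "charpoly A = det (\<chi> i j. [:- (A $ i $ j), (if i = j then 1 else 0):])"

definition eigenvalues :: "real^'n^'n \<Rightarrow> complex multiset" where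
  "eigenvalues A = proots (map_poly complex_of_real (charpoly A))"

definition graph_energy :: "('n::finite \<Rightarrow> 'n \<Rightarrow> bool) \<Rightarrow> real" where
  "graph_energy E = sum_mset (image_mset cmod (eigenvalues (adj_matrix E)))"

definition graph_iso :: "('a \<Rightarrow> 'a \<Rightarrow> bool) \<Rightarrow> 'b set \<Rightarrow> ('b \<Rightarrow> 'b \<Rightarrow> bool) \<Rightarrow> bool" where
  "graph_iso E W F \<longleftrightarrow> (\<exists>f. bij_betw f UNIV W \<and> (\<forall>u v. E u v \<longleftrightarrow> F (f u) (f v)))"

definition P4_adj :: "nat \<Rightarrow> nat \<Rightarrow> bool" where
  "P4_adj i j \<longleftrightarrow> {i, j} \<in> {{0,1}, {1,2}, {2,3}}"

definition paw_adj :: "nat \<Rightarrow> nat \<Rightarrow> bool" where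
  "paw_adj i j \<longleftrightarrow> {i, j} \<in> {{0,1}, {1,2}, {0,2}, {0,3}}"

definition planar :: "('n \<Rightarrow> 'n \<Rightarrow> bool) \<Rightarrow> bool" where
  "planar E \<longleftrightarrow> (\<exists>(p :: 'n \<Rightarrow> complex) (\<gamma> :: 'n \<Rightarrow> 'n \<Rightarrow> real \<Rightarrow> complex).
     inj p \<and>
     (\<forall>u v. E u v \<longrightarrow> arc (\<gamma> u v) \<and> pathstart (\<gamma> u v) = p u \<and> pathfinish (\<gamma> u v) = p v) \<and>
     (\<forall>u v w. E u v \<longrightarrow> p w \<in> path_image (\<gamma> u v) \<longrightarrow> w = u \<or> w = v) \<and>
     (\<forall>u v x y. E u v \<longrightarrow> E x y \<longrightarrow> {u, v} \<noteq> {x, y} \<longrightarrow>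
        path_image (\<gamma> u v) \<inter> path_image (\<gamma> x y) \<subseteq> {p u, p v} \<inter> {p x, p y}))"

end

theory Submission
  imports Defs
begin

text \<open>Let \<open>\<lambda>\<close> be the largest eigenvalue and \<open>D = |det A| \<ge> 1\<close>. An inequality
  \<open>t \<ge> \<alpha> + \<gamma> t\<^sup>2 + \<delta> ln t\<close>, valid up to the size of the remaining eigenvalues, bounds the energy below
  through \<open>\<Sum> \<lambda>\<^sub>i\<^sup>2 = 2m\<close> and \<open>\<Prod> |\<lambda>\<^sub>i| = D\<close>. The outcome suffices unless the graph is dense, and
  planarity enters only by excluding \<open>K\<^bsub>3,3\<^esub>\<close> subgraphs, which bounds \<open>m\<close> and, together with the
  minimum degree, \<open>\<lambda>\<close>. For order at least 14 the choice \<open>\<gamma> = 1/n\<close> works; below that a short list of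
  rational certificates covers all pairs \<open>(m, \<lambda>)\<close>, using that \<open>D\<close> is even for odd order and that
  \<open>det A\<close> is \<open>0\<close> or \<open>-1\<close> modulo 4 for order 6. There \<open>det A = -1\<close> leaves a complete graph or three
  eigenvalues of each sign; both are treated directly, as is order 4.\<close>

section \<open>Planar graphs contain no \<open>K\<^bsub>3,3\<^esub>\<close>\<close>

text \<open>The two exceptions are genuine: the energy of the path is \<open>2 * sqrt 5\<close>,
  below 4.5, and that of the paw is about 4.96, below 5. With so little room at small orders, one
  uniform estimate cannot be expected. The inequality without a quadratic term yields only the order
  of the graph, so the average degree has to come from the sum of squares; the price is that the
  quadratic term overtakes \<open>t\<close> for large \<open>t\<close>, and this is why upper bounds
  on eigenvalues, hence edge counts and minimum degrees, are needed at all. The arithmetic of the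
  determinant comes from comparing the symmetric matrix, split into an upper triangular part and its
  transpose, with the skew matrix formed from the same parts, whose determinant is a square.
  Drawings consist of arbitrary arcs, so planarity is exploited through the Jordan curve theorem
  instead of Euler's formula: no face of a theta curve touches the interiors of all three
  arcs.\<close>

lemma two_arcs_inside_outside:
  fixes c1 c2 :: "real \<Rightarrow> complex"
  defines "J \<equiv> path_image c1 \<union> path_image c2"
  assumes "path_image c1 \<inter> path_image c2 = {a, b}" "arc c1" "arc c2"
    and "pathstart c1 = a" "pathfinish c1 = b" "pathstart c2 = a" "pathfinish c2 = b"
  shows "open (inside J)" "open (outside J)" "inside J \<union> outside J = - J"
    and "inside J \<inter> outside J = {}" "inside J \<noteq> {}"
    and "connected (outside J)" "\<not> bounded (outside J)" "closure (inside J) = inside J \<union> J"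
proof -
  have s: "simple_path (c1 +++ reversepath c2)"
    "pathfinish (c1 +++ reversepath c2) = pathstart (c1 +++ reversepath c2)"
    "path_image (c1 +++ reversepath c2) = J"
    using assms by (auto simp: simple_path_join_loop_eq arc_reversepath path_image_join)
  note * = Jordan_inside_outside[OF s(1,2), unfolded s(3)]
  show "open (inside J)" "open (outside J)" "inside J \<union> outside J = - J"
    "inside J \<inter> outside J = {}" "inside J \<noteq> {}"
    "connected (outside J)" "\<not> bounded (outside J)" using * by simp_all
  have "frontier (inside J) = J" using * by simp
  then show "closure (inside J) = inside J \<union> J" using closure_Un_frontier by metis
qed

lemma connected_subset_left:
  assumes "connected U" "open A" "open B" "A \<inter> B = {}" "U \<subseteq> A \<union> B" "x \<in> U" "x \<in> A"
  shows "U \<subseteq> A"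
  using connectedD[OF assms(1-3)] assms(4-7) by blast

text \<open>The arc \<open>c3\<close> cuts the inside of the other two into two faces. The connected
  set \<open>U\<close> lies in one of them, and the closure of a face adds only its two boundary
  arcs, so \<open>U\<close> cannot accumulate at an inner point of the third.\<close>

lemma theta_inside:
  fixes c1 c2 c3 :: "real \<Rightarrow> complex"
  assumes arcs: "arc c1" "arc c2" "arc c3"
    and ends: "pathstart c1 = a" "pathfinish c1 = b" "pathstart c2 = a" "pathfinish c2 = b"
      "pathstart c3 = a" "pathfinish c3 = b"
    and c12: "path_image c1 \<inter> path_image c2 = {a, b}"
    and c13: "path_image c1 \<inter> path_image c3 = {a, b}"
    and c23: "path_image c2 \<inter> path_image c3 = {a, b}"
    and U: "connected U" "U \<inter> path_image c1 = {}" "U \<inter> path_image c2 = {}" "U \<inter> path_image c3 = {}"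
    and x1: "x1 \<in> path_image c1 - {a, b}" "x1 \<in> closure U"
    and x2: "x2 \<in> path_image c2 - {a, b}" "x2 \<in> closure U"
    and x3: "x3 \<in> path_image c3 - {a, b}" "x3 \<in> closure U"
    and ne: "path_image c3 \<inter> inside (path_image c1 \<union> path_image c2) \<noteq> {}"
  shows False
proof -
  define C1 C2 C3 where "C1 = path_image c1" and "C2 = path_image c2" and "C3 = path_image c3"
  have "a \<noteq> b" using arcs(1) ends arc_distinct_ends by metis
  note J12 = two_arcs_inside_outside[OF c12 arcs(1,2) ends(1-4), folded C1_def C2_def C3_def]
  note J13 = two_arcs_inside_outside[OF c13 arcs(1,3) ends(1,2,5,6), folded C1_def C2_def C3_def]
  note J23 = two_arcs_inside_outside[OF c23 arcs(2,3) ends(3-6), folded C1_def C2_def C3_def]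
  obtain disj: "inside (C1 \<union> C3) \<inter> inside (C2 \<union> C3) = {}"
    and un: "inside (C1 \<union> C3) \<union> inside (C2 \<union> C3) \<union> (C3 - {a, b}) = inside (C1 \<union> C2)"
    using split_inside_simple_closed_curve[of c1 a b c2 c3] arcs ends \<open>a \<noteq> b\<close> c12 c13 c23 ne
    unfolding C1_def C2_def C3_def by (auto simp: arc_imp_simple_path)
  have x3in: "x3 \<in> inside (C1 \<union> C2)" using un x3 C3_def by blast
  have "inside (C1 \<union> C2) \<inter> U \<noteq> {}"
    using x3in x3(2) J12(1) open_Int_closure_eq_empty by blast
  then obtain z where z: "z \<in> U" "z \<in> inside (C1 \<union> C2)" by blast
  have "U \<subseteq> inside (C1 \<union> C2) \<union> outside (C1 \<union> C2)"
    using J12(3) U(2,3) unfolding C1_def C2_def by blast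
  then have "U \<subseteq> inside (C1 \<union> C2)"
    using connected_subset_left[OF U(1) J12(1,2) J12(4)] z by blast
  then have sub: "U \<subseteq> inside (C1 \<union> C3) \<union> inside (C2 \<union> C3)"
    using un U(4) unfolding C3_def by blast
  have "U \<subseteq> inside (C1 \<union> C3) \<or> U \<subseteq> inside (C2 \<union> C3)"
  proof (cases "z \<in> inside (C1 \<union> C3)")
    case True
    then show ?thesis using connected_subset_left[OF U(1) J13(1) J23(1) disj sub z(1)] by blast
  next
    case False
    then have "z \<in> inside (C2 \<union> C3)" using sub z(1) by blast
    moreover have "U \<subseteq> inside (C2 \<union> C3) \<union> inside (C1 \<union> C3)"
      "inside (C2 \<union> C3) \<inter> inside (C1 \<union> C3) = {}" using sub disj by blast+
    ultimately show ?thesis using connected_subset_left[OF U(1) J23(1) J13(1)] z(1) by blast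
  qed
  then show False
  proof
    assume "U \<subseteq> inside (C1 \<union> C3)"
    then have "x2 \<in> closure (inside (C1 \<union> C3))" using x2(2) closure_mono by blast
    moreover have "x2 \<notin> C1 \<union> C3" using x2(1) c12 c23 unfolding C1_def C3_def by blast
    moreover have "x2 \<notin> inside (C1 \<union> C3)"
      using un x2(1) J12(3) unfolding C2_def by blast
    ultimately show False using J13(8) by blast
  next
    assume "U \<subseteq> inside (C2 \<union> C3)"
    then have "x1 \<in> closure (inside (C2 \<union> C3))" using x1(2) closure_mono by blast
    moreover have "x1 \<notin> C2 \<union> C3" using x1(1) c12 c13 unfolding C2_def C3_def by blast
    moreover have "x1 \<notin> inside (C2 \<union> C3)"
      using un x1(1) J12(3) unfolding C1_def by blast
    ultimately show False using J23(8) by blast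
  qed
qed

text \<open>If no arc lies inside the closed curve formed by the other two, an inversion centred inside
  one of these curves reduces to that situation.\<close>

lemma theta_no_common_face:
  fixes c1 c2 c3 :: "real \<Rightarrow> complex"
  assumes arcs: "arc c1" "arc c2" "arc c3"
    and ends: "pathstart c1 = a" "pathfinish c1 = b" "pathstart c2 = a" "pathfinish c2 = b"
      "pathstart c3 = a" "pathfinish c3 = b"
    and c12: "path_image c1 \<inter> path_image c2 = {a, b}"
    and c13: "path_image c1 \<inter> path_image c3 = {a, b}"
    and c23: "path_image c2 \<inter> path_image c3 = {a, b}"
    and U: "connected U" "U \<inter> path_image c1 = {}" "U \<inter> path_image c2 = {}" "U \<inter> path_image c3 = {}"
    and x1: "x1 \<in> path_image c1 - {a, b}" "x1 \<in> closure U"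
    and x2: "x2 \<in> path_image c2 - {a, b}" "x2 \<in> closure U"
    and x3: "x3 \<in> path_image c3 - {a, b}" "x3 \<in> closure U"
  shows False
proof (cases "path_image c3 \<inter> inside (path_image c1 \<union> path_image c2) = {}")
  case False
  then show ?thesis using theta_inside[OF assms] by blast
next
  case outer: True
  define C1 C2 C3 where "C1 = path_image c1" and "C2 = path_image c2" and "C3 = path_image c3"
  note J12 = two_arcs_inside_outside[OF c12 arcs(1,2) ends(1-4), folded C1_def C2_def C3_def]
  have x3out: "x3 \<in> outside (C1 \<union> C2)"
    using outer x3(1) c13 c23 J12(3) unfolding C1_def C2_def C3_def by blast
  have Uin: "U \<inter> inside (C1 \<union> C2) = {}"
  proof -
    have "outside (C1 \<union> C2) \<inter> U \<noteq> {}"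
      using x3out x3(2) J12(2) open_Int_closure_eq_empty by blast
    then obtain z where z: "z \<in> U" "z \<in> outside (C1 \<union> C2)" by blast
    have "U \<subseteq> outside (C1 \<union> C2) \<union> inside (C1 \<union> C2)"
      using J12(3) U(2,3) unfolding C1_def C2_def by blast
    moreover have "outside (C1 \<union> C2) \<inter> inside (C1 \<union> C2) = {}" using J12(4) by blast
    ultimately have "U \<subseteq> outside (C1 \<union> C2)"
      using connected_subset_left[OF U(1) J12(2,1)] z by blast
    then show ?thesis using J12(4) by blast
  qed
  \<comment> \<open>The centre of the inversion is inside \<open>C1 \<union> C2\<close>, hence off
    all three arcs and off \<open>U\<close>, so the inversion is continuous on everything
    involved.\<close>
  obtain w where w: "w \<in> inside (C1 \<union> C2)" using J12(5) by blast
  have wn: "w \<notin> C1" "w \<notin> C2" "w \<notin> C3" "w \<notin> U"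
    using w J12(3) outer Uin unfolding C3_def C1_def C2_def by blast+
  define f where "f z = inverse (z - w)" for z
  have cont: "continuous_on S f" if "w \<notin> S" for S
    unfolding f_def using that by (intro continuous_intros) auto
  have inj: "inj_on f S" for S unfolding f_def inj_on_def by auto
  have im: "path_image (f \<circ> c) = f ` path_image c" for c by (rule path_image_compose)
  have arc': "arc (f \<circ> c)" if "arc c" "w \<notin> path_image c" for c
    using that cont inj unfolding arc_def im
    by (auto intro!: path_continuous_image comp_inj_on simp: path_image_def)
  have fim: "f ` A \<inter> f ` B = f ` (A \<inter> B)" for A B
    using inj[of UNIV] by (simp add: image_Int)
  have notab: "f x \<in> f ` A \<longleftrightarrow> x \<in> A" for x A using inj[of UNIV] by (simp add: inj_image_mem_iff)
  have clos: "f x \<in> closure (f ` U)" if x: "x \<in> closure U" "x \<noteq> w" for x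
  proof -
    obtain g where g: "\<forall>n. g n \<in> U" "g \<longlonglongrightarrow> x" using x(1) unfolding closure_sequential by blast
    have "(\<lambda>n. f (g n)) \<longlonglongrightarrow> f x" unfolding f_def using g x by (intro tendsto_intros) auto
    then show ?thesis
      unfolding closure_sequential using g(1) by (intro exI[of _ "\<lambda>n. f (g n)"]) auto
  qed
  have xw: "x1 \<noteq> w" "x2 \<noteq> w" "x3 \<noteq> w" using wn x1 x2 x3 unfolding C1_def C2_def C3_def by auto
  note ends' = ends[THEN arg_cong[of _ _ f]]
  \<comment> \<open>The inversion turns the curve inside out. If \<open>f x3\<close> were outside
    the image \<open>J\<close>, it could be joined within that outside to points of arbitrarily
    large norm. These pull back to points near \<open>w\<close>, so a connected set missing
    \<open>C1 \<union> C2\<close> would join the outer point \<open>x3\<close> to the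
    inside.\<close>
  have "path_image (f \<circ> c3) \<inter> inside (path_image (f \<circ> c1) \<union> path_image (f \<circ> c2)) \<noteq> {}"
  proof
    assume emp: "path_image (f \<circ> c3) \<inter> inside (path_image (f \<circ> c1) \<union> path_image (f \<circ> c2)) = {}"
    define J where "J = f ` (C1 \<union> C2)"
    have Jeq: "J = path_image (f \<circ> c1) \<union> path_image (f \<circ> c2)"
      unfolding J_def im C1_def C2_def by blast
    have arcs': "arc (f \<circ> c1)" "arc (f \<circ> c2)" using arc' arcs wn C1_def C2_def by auto
    have i12: "path_image (f \<circ> c1) \<inter> path_image (f \<circ> c2) = {f a, f b}"
      unfolding im fim c12 by simp
    have e: "pathstart (f \<circ> c1) = f a" "pathfinish (f \<circ> c1) = f b"
       "pathstart (f \<circ> c2) = f a" "pathfinish (f \<circ> c2) = f b"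
      using ends by (simp_all add: pathstart_compose pathfinish_compose)
    note J = two_arcs_inside_outside[OF i12 arcs' e, folded Jeq]
    have "x3 \<notin> C1 \<union> C2" using x3 c13 c23 unfolding C1_def C2_def by blast
    then have "f x3 \<notin> J" unfolding J_def notab .
    moreover have "f x3 \<in> path_image (f \<circ> c3)" using x3(1) by (simp add: im)
    then have "f x3 \<notin> inside J" using emp unfolding Jeq by blast
    ultimately have fx3: "f x3 \<in> outside J" using J(3) by blast
    obtain e where e: "e > 0" "ball w e \<subseteq> inside (C1 \<union> C2)"
      using w J12(1) open_contains_ball by blast
    obtain y where y: "y \<in> outside J" "norm y > 1 / e"
      using J(7) unfolding bounded_iff by (meson not_le)
    define g where "g z = w + inverse z" for z :: complex
    have yb: "g y \<in> inside (C1 \<union> C2)"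
    proof -
      have "0 < norm y" using y(2) e(1) by (smt (verit) divide_pos_pos)
      then have "norm (inverse y) < e" using y(2) e(1) by (simp add: norm_inverse norm_divide field_simps)
      then show ?thesis using e(2) unfolding g_def by (auto simp: dist_norm subset_iff)
    qed
    have gf: "g (f z) = z" for z unfolding g_def f_def by simp
    have fg: "f (g z) = z" for z unfolding g_def f_def by simp
    \<comment> \<open>\<open>g\<close> is continuous only off 0; removing one point leaves an open
      connected planar set connected.\<close>
    define V where "V = outside J - {0}"
    have "connected V"
      unfolding V_def using J(2,6) connected_open_delete[of "outside J" 0] by simp
    moreover have "continuous_on V g" unfolding g_def V_def by (intro continuous_intros) auto
    ultimately have conV: "connected (g ` V)" by (rule connected_continuous_image[rotated])
    have avoid: "g ` V \<inter> (C1 \<union> C2) = {}"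
    proof -
      have "z \<in> J" if "g z \<in> C1 \<union> C2" for z using that fg[of z] unfolding J_def by (metis imageI)
      moreover have "outside J \<inter> J = {}" using J(3) by blast
      ultimately show ?thesis unfolding V_def by blast
    qed
    have "f x3 \<in> V" using fx3 xw unfolding V_def f_def by simp
    then have "x3 \<in> g ` V" using gf by (metis imageI)
    moreover have "y \<in> V" using y e(1) unfolding V_def by auto
    then have "g y \<in> g ` V" by blast
    moreover have "g ` V \<subseteq> inside (C1 \<union> C2) \<union> outside (C1 \<union> C2)" using avoid J12(3) by blast
    ultimately have "g ` V \<subseteq> inside (C1 \<union> C2)"
      using connected_subset_left[OF conV J12(1,2,4)] yb by blast
    then show False using \<open>x3 \<in> g ` V\<close> x3out J12(4) by blast
  qed
  moreover have "arc (f \<circ> c1)" "arc (f \<circ> c2)" "arc (f \<circ> c3)"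
    using arc' arcs wn unfolding C1_def C2_def C3_def by blast+
  ultimately show False
    using theta_inside[of "f \<circ> c1" "f \<circ> c2" "f \<circ> c3" "f a" "f b" "f ` U" "f x1" "f x2" "f x3"]
      wn ends U x1 x2 x3 c12 c13 c23 xw clos
    unfolding im fim C1_def[symmetric] C2_def[symmetric] C3_def[symmetric]
    by (simp add: pathstart_compose pathfinish_compose notab connected_continuous_image cont inj_eq[OF inj])
qed

text \<open>The three paths from \<open>a1\<close> to \<open>a2\<close> through the vertices of
  \<open>B\<close> form a theta curve. The edges leaving \<open>a3\<close> make up one connected set
  that avoids the theta curve but accumulates at the three vertices of \<open>B\<close>, one on each
  path.\<close>

lemma planar_K33_free:
  fixes E :: "'n::finite \<Rightarrow> 'n \<Rightarrow> bool"
  assumes "planar E" and AB: "card A = 3" "card B = 3" "A \<inter> B = {}"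
    and adj: "\<And>a b. a \<in> A \<Longrightarrow> b \<in> B \<Longrightarrow> E a b"
  shows False
proof -
  obtain p :: "'n \<Rightarrow> complex" and \<gamma> where inj: "inj p"
    and \<gamma>: "\<And>u v. E u v \<Longrightarrow> arc (\<gamma> u v) \<and> pathstart (\<gamma> u v) = p u \<and> pathfinish (\<gamma> u v) = p v"
    and vert: "\<And>u v w. E u v \<Longrightarrow> p w \<in> path_image (\<gamma> u v) \<Longrightarrow> w = u \<or> w = v"
    and cross: "\<And>u v x y. E u v \<Longrightarrow> E x y \<Longrightarrow> {u, v} \<noteq> {x, y} \<Longrightarrow>
        path_image (\<gamma> u v) \<inter> path_image (\<gamma> x y) \<subseteq> {p u, p v} \<inter> {p x, p y}"
    using \<open>planar E\<close> unfolding planar_def by metis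
  obtain a1 a2 a3 where A: "A = {a1, a2, a3}" "a1 \<noteq> a2" "a1 \<noteq> a3" "a2 \<noteq> a3"
    using AB(1) unfolding card_3_iff by blast
  obtain b1 b2 b3 where B: "B = {b1, b2, b3}" "b1 \<noteq> b2" "b1 \<noteq> b3" "b2 \<noteq> b3"
    using AB(2) unfolding card_3_iff by blast
  define c where "c b = \<gamma> a1 b +++ reversepath (\<gamma> a2 b)" for b
  \<comment> \<open>Half-open, because the endpoint \<open>p b\<close> lies on the theta curve and
    may enter only as a limit point.\<close>
  define V where "V b = \<gamma> a3 b ` {0..<1}" for b
  have ab: "a \<noteq> b" if "a \<in> A" "b \<in> B" for a b using that AB(3) by blast
  have \<gamma>': "arc (\<gamma> a b)" "pathstart (\<gamma> a b) = p a" "pathfinish (\<gamma> a b) = p b"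
    if "a \<in> A" "b \<in> B" for a b using \<gamma>[OF adj[OF that]] by auto
  have ends: "p a \<in> path_image (\<gamma> a b)" "p b \<in> path_image (\<gamma> a b)" if "a \<in> A" "b \<in> B" for a b
    using \<gamma>'[OF that] pathstart_in_path_image pathfinish_in_path_image by metis+
  have same_b: "path_image (\<gamma> a b) \<inter> path_image (\<gamma> a' b) = {p b}"
    if "a \<in> A" "a' \<in> A" "b \<in> B" "a \<noteq> a'" for a a' b
  proof -
    have "{a, b} \<noteq> {a', b}" using that ab by (metis doubleton_eq_iff)
    then have "path_image (\<gamma> a b) \<inter> path_image (\<gamma> a' b) \<subseteq> {p a, p b} \<inter> {p a', p b}"
      using cross adj that by metis
    moreover have "p a \<noteq> p a'" "p a \<noteq> p b" "p a' \<noteq> p b" using that ab inj by (metis injD)+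
    ultimately show ?thesis using ends that by blast
  qed
  have diff_b: "path_image (\<gamma> a b) \<inter> path_image (\<gamma> a' b') = (if a = a' then {p a} else {})"
    if "a \<in> A" "a' \<in> A" "b \<in> B" "b' \<in> B" "b \<noteq> b'" for a a' b b'
  proof -
    have "{a, b} \<noteq> {a', b'}" using that ab by (metis doubleton_eq_iff)
    then have "path_image (\<gamma> a b) \<inter> path_image (\<gamma> a' b') \<subseteq> {p a, p b} \<inter> {p a', p b'}"
      using cross adj that by metis
    moreover have "p a \<noteq> p b'" "p a' \<noteq> p b" "p b \<noteq> p b'" using that ab inj by (metis injD)+
    ultimately have sub: "path_image (\<gamma> a b) \<inter> path_image (\<gamma> a' b') \<subseteq> {p a} \<inter> {p a'}" by auto
    show ?thesis
    proof (cases "a = a'")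
      case True
      then show ?thesis using sub ends(1)[OF that(1,3)] ends(1)[OF that(2,4)] by auto
    next
      case False
      then have "p a \<noteq> p a'" using inj by (metis injD)
      then show ?thesis using False sub by auto
    qed
  qed
  have aA: "a1 \<in> A" "a2 \<in> A" "a3 \<in> A" using A by auto
  have im: "path_image (c b) = path_image (\<gamma> a1 b) \<union> path_image (\<gamma> a2 b)" if "b \<in> B" for b
    unfolding c_def using \<gamma>' aA that by (simp add: path_image_join)
  have arcs: "arc (c b)" "pathstart (c b) = p a1" "pathfinish (c b) = p a2" if "b \<in> B" for b
    unfolding c_def using \<gamma>'[OF aA(1) that] \<gamma>'[OF aA(2) that] same_b[OF aA(1,2) that A(2)]
    by (simp_all add: arc_join_eq arc_reversepath)
  have cc: "path_image (c b) \<inter> path_image (c b') = {p a1, p a2}"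
    if "b \<in> B" "b' \<in> B" "b \<noteq> b'" for b b'
    unfolding im[OF that(1)] im[OF that(2)] Int_Un_distrib Int_Un_distrib2
    using A(2) diff_b[OF aA(1,1) that] diff_b[OF aA(1,2) that] diff_b[OF aA(2,1) that]
      diff_b[OF aA(2,2) that] by auto
  have Vsub: "V b \<subseteq> path_image (\<gamma> a3 b)" for b unfolding V_def path_image_def by auto
  have pb: "p b \<notin> V b" if b: "b \<in> B" for b
  proof
    assume "p b \<in> V b"
    then obtain t where t: "t \<in> {0..<1}" "\<gamma> a3 b t = \<gamma> a3 b 1"
      unfolding V_def using \<gamma>'(3)[OF aA(3) b] by (auto simp: pathfinish_def)
    moreover have "inj_on (\<gamma> a3 b) {0..1}" using \<gamma>'(1)[OF aA(3) b] unfolding arc_def by simp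
    ultimately have "t = 1" using t by (elim inj_onD) auto
    then show False using t(1) by simp
  qed
  have Vc: "V b \<inter> path_image (c b') = {}" if "b \<in> B" "b' \<in> B" for b b'
  proof -
    have "V b \<inter> path_image (\<gamma> a b') = {}" if a: "a \<in> A" "a3 \<noteq> a" for a
    proof (cases "b = b'")
      case True
      have "V b' \<inter> path_image (\<gamma> a b') \<subseteq> {p b'}"
        using same_b[OF aA(3) a(1) \<open>b' \<in> B\<close> a(2)] Vsub[of b'] by auto
      then show ?thesis unfolding True using pb[OF \<open>b' \<in> B\<close>] by auto
    next
      case False
      then have "path_image (\<gamma> a3 b) \<inter> path_image (\<gamma> a b') = {}"
        using diff_b[OF aA(3) a(1) \<open>b \<in> B\<close> \<open>b' \<in> B\<close>] a(2) by simp
      then show ?thesis using Vsub[of b] by fast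
    qed
    then show ?thesis unfolding im[OF that(2)] using aA A by (simp add: Int_Un_distrib)
  qed
  have conV: "connected (V b)" and p3V: "p a3 \<in> V b" and clV: "p b \<in> closure (V b)" if "b \<in> B" for b
  proof -
    have cont: "continuous_on {0..1} (\<gamma> a3 b)" using \<gamma>'(1)[OF aA(3) that] unfolding arc_def path_def by simp
    then have "continuous_on {0..<1} (\<gamma> a3 b)" by (rule continuous_on_subset) auto
    then show "connected (V b)" unfolding V_def by (intro connected_continuous_image) auto
    show "p a3 \<in> V b" using \<gamma>'(2)[OF aA(3) that] unfolding V_def pathstart_def by force
    have "closure {0..<1::real} = {0..1}" by simp
    then have "\<gamma> a3 b ` {0..1} \<subseteq> closure (V b)"
      unfolding V_def using image_closure_subset[of "{0..<1::real}" "\<gamma> a3 b" "closure (\<gamma> a3 b ` {0..<1})"] cont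
      by (simp add: closure_subset)
    moreover have "p b = \<gamma> a3 b 1" using \<gamma>'(3)[OF aA(3) that] unfolding pathfinish_def by simp
    ultimately show "p b \<in> closure (V b)" by auto
  qed
  define U where "U = V b1 \<union> V b2 \<union> V b3"
  have bB: "b1 \<in> B" "b2 \<in> B" "b3 \<in> B" using B by auto
  have "connected U" unfolding U_def
    using conV[OF bB(1)] conV[OF bB(2)] conV[OF bB(3)] p3V[OF bB(1)] p3V[OF bB(2)] p3V[OF bB(3)]
    by (intro connected_Un) blast+
  moreover have UC: "U \<inter> path_image (c b) = {}" if "b \<in> B" for b
    unfolding U_def using Vc[OF bB(1) that] Vc[OF bB(2) that] Vc[OF bB(3) that]
    by (simp add: Int_Un_distrib2)
  moreover have bc: "p b \<in> path_image (c b) - {p a1, p a2}" if "b \<in> B" for b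
    using im[OF that] ends(2)[OF aA(1) that] ab[OF aA(1) that] ab[OF aA(2) that] inj
    by (auto dest: injD)
  moreover have bU: "p b \<in> closure U" if "b \<in> B" for b
  proof -
    have "V b \<subseteq> U" unfolding U_def using that B(1) by auto
    then show ?thesis using clV[OF that] closure_mono by blast
  qed
  ultimately show False
    using theta_no_common_face[OF arcs(1)[OF bB(1)] arcs(1)[OF bB(2)] arcs(1)[OF bB(3)]
      arcs(2,3)[OF bB(1)] arcs(2,3)[OF bB(2)] arcs(2,3)[OF bB(3)]
      cc[OF bB(1,2) B(2)] cc[OF bB(1,3) B(3)] cc[OF bB(2,3) B(4)] _
      UC[OF bB(1)] UC[OF bB(2)] UC[OF bB(3)] bc[OF bB(1)] bU[OF bB(1)]
      bc[OF bB(2)] bU[OF bB(2)] bc[OF bB(3)] bU[OF bB(3)]] by simp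
qed

section \<open>Symmetric matrices\<close>

lemma symmetric_matrix_inner:
  fixes A :: "real^'n^'n"
  assumes "transpose A = A"
  shows "x \<bullet> (A *v y) = (A *v x) \<bullet> y"
  by (metis assms dot_lmul_matrix transpose_matrix_vector)

text \<open>First variation: moving \<open>x\<close> by \<open>t\<close> times the residual
  \<open>r\<close> changes the Rayleigh excess by \<open>2 * t * (r \<bullet> r)\<close> up to order
  \<open>t\<^sup>2\<close>, which a maximum forbids for small positive \<open>t\<close> unless
  \<open>r = 0\<close>. Invariance of \<open>S\<close> keeps \<open>r\<close> in
  \<open>S\<close>.\<close>

lemma Rayleigh_maximizer_eigenvector:
  fixes A :: "real^'n^'n"
  assumes sym: "transpose A = A" and S: "subspace S" "\<And>x. x \<in> S \<Longrightarrow> A *v x \<in> S"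
    and x: "x \<in> S" "x \<bullet> (A *v x) = l * (x \<bullet> x)"
    and max: "\<And>y. y \<in> S \<Longrightarrow> y \<bullet> (A *v y) \<le> l * (y \<bullet> y)"
  shows "A *v x = l *\<^sub>R x"
proof -
  define r where "r = A *v x - l *\<^sub>R x"
  have rS: "r \<in> S" unfolding r_def using S x(1) by (auto intro: subspace_diff subspace_scale)
  define c where "c = r \<bullet> (A *v r) - l * (r \<bullet> r)"
  have *: "2 * t * (r \<bullet> r) + t\<^sup>2 * c \<le> 0" for t
  proof -
    have Ar: "A *v (x + t *\<^sub>R r) = A *v x + t *\<^sub>R (A *v r)"
      by (simp add: matrix_vector_right_distrib matrix_vector_mult_scaleR)
    have rx: "r \<bullet> (A *v x) = r \<bullet> r + l * (r \<bullet> x)"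
      by (simp add: r_def inner_diff_right)
    have xr: "x \<bullet> (A *v r) = r \<bullet> (A *v x)"
      using symmetric_matrix_inner[OF sym] by (metis inner_commute)
    have "x + t *\<^sub>R r \<in> S" using S rS x by (auto intro: subspace_add subspace_scale)
    then have "(x + t *\<^sub>R r) \<bullet> (A *v (x + t *\<^sub>R r)) \<le> l * ((x + t *\<^sub>R r) \<bullet> (x + t *\<^sub>R r))" by (rule max)
    moreover have "(x + t *\<^sub>R r) \<bullet> (A *v (x + t *\<^sub>R r)) - l * ((x + t *\<^sub>R r) \<bullet> (x + t *\<^sub>R r))
        = 2 * t * (r \<bullet> r) + t\<^sup>2 * c"
      unfolding Ar c_def inner_add_left inner_add_right inner_scaleR_left inner_scaleR_right x(2) xr rx
      by (simp add: inner_commute[of x r] algebra_simps power2_eq_square)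
    ultimately show ?thesis by linarith
  qed
  have "r \<bullet> r = 0"
  proof (rule ccontr)
    assume "r \<bullet> r \<noteq> 0"
    then have pos: "r \<bullet> r > 0" using inner_ge_zero[of r] by linarith
    \<comment> \<open>Small enough for the linear term to beat the quadratic one; the
      \<open>+ 1\<close> covers \<open>c = 0\<close>.\<close>
    define t where "t = (r \<bullet> r) / (\<bar>c\<bar> + 1)"
    have t: "t > 0" "t * \<bar>c\<bar> < r \<bullet> r" unfolding t_def using pos by (auto simp: field_simps)
    have "t * (t * \<bar>c\<bar>) < t * (r \<bullet> r)" using t by (intro mult_strict_left_mono)
    moreover have "t\<^sup>2 * c \<ge> - (t * (t * \<bar>c\<bar>))"
      using abs_ge_minus_self[of "t\<^sup>2 * c"] by (simp add: abs_mult power2_eq_square)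
    moreover have "t * (r \<bullet> r) > 0" using t(1) pos by (rule mult_pos_pos)
    ultimately show False using *[of t] by linarith
  qed
  then show ?thesis unfolding r_def by simp
qed

lemma symmetric_Rayleigh_maximum:
  fixes A :: "real^'n^'n"
  assumes sym: "transpose A = A" and S: "subspace S" "\<And>x. x \<in> S \<Longrightarrow> A *v x \<in> S" "S \<noteq> {0}"
  obtains x l where "x \<in> S" "norm x = 1" "A *v x = l *\<^sub>R x"
    "\<And>y. y \<in> S \<Longrightarrow> y \<bullet> (A *v y) \<le> l * (y \<bullet> y)"
proof -
  have "0 \<in> S" using S(1) by (rule subspace_0)
  then obtain z where z: "z \<in> S" "z \<noteq> 0" using S(3) by blast
  have "compact (sphere 0 1 \<inter> S)" by (intro compact_Int_closed closed_subspace S) auto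
  moreover have "z /\<^sub>R norm z \<in> sphere 0 1 \<inter> S" using z S(1) by (auto intro: subspace_scale)
  moreover have "continuous_on (sphere 0 1 \<inter> S) (\<lambda>x. x \<bullet> (A *v x))"
    by (intro continuous_intros matrix_vector_mult_linear_continuous_on)
  ultimately obtain x where x: "x \<in> sphere 0 1 \<inter> S"
    and max: "\<And>y. y \<in> sphere 0 1 \<inter> S \<Longrightarrow> y \<bullet> (A *v y) \<le> x \<bullet> (A *v x)"
    using continuous_attains_sup[of "sphere 0 1 \<inter> S" "\<lambda>x. x \<bullet> (A *v x)"] by blast
  define l where "l = x \<bullet> (A *v x)"
  have R: "y \<bullet> (A *v y) \<le> l * (y \<bullet> y)" if "y \<in> S" for y
  proof (cases "y = 0")
    case False
    have "y /\<^sub>R norm y \<in> sphere 0 1 \<inter> S" using that False S(1) by (auto intro: subspace_scale)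
    from max[OF this] have "(y \<bullet> (A *v y)) / (norm y)\<^sup>2 \<le> l"
      by (simp add: l_def matrix_vector_mult_scaleR power2_eq_square divide_simps)
    then show ?thesis using False by (simp add: divide_le_eq power2_norm_eq_inner)
  qed simp
  have "x \<bullet> x = 1" using x by (simp add: dot_square_norm)
  then have "A *v x = l *\<^sub>R x"
    using x by (intro Rayleigh_maximizer_eigenvector[OF sym S(1,2)]) (auto simp: l_def R[unfolded l_def])
  with x R show thesis by (intro that[of x l]) auto
qed

text \<open>Induction on the dimension: by symmetry, the orthogonal complement of an eigenvector
  within an invariant subspace is again invariant.\<close>

lemma symmetric_orthonormal_eigenbasis_subspace:
  fixes A :: "real^'n^'n"
  assumes sym: "transpose A = A" and "subspace S" "\<And>x. x \<in> S \<Longrightarrow> A *v x \<in> S"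
  shows "\<exists>B. pairwise orthogonal B \<and> (\<forall>b\<in>B. norm b = 1 \<and> (\<exists>l. A *v b = l *\<^sub>R b)) \<and> span B = S"
  using assms(2,3)
proof (induction "dim S" arbitrary: S rule: less_induct)
  case less
  show ?case
  proof (cases "S = {0}")
    case True
    then show ?thesis by (intro exI[of _ "{}"]) (auto simp: pairwise_def)
  next
    case False
    obtain x l where x: "x \<in> S" "norm x = 1" "A *v x = l *\<^sub>R x"
      using symmetric_Rayleigh_maximum[OF sym less.prems False] by metis
    define T where "T = {y \<in> S. x \<bullet> y = 0}"
    have T: "subspace T" unfolding T_def using less.prems(1)
      by (auto simp: subspace_def inner_add_right)
    have AT: "A *v y \<in> T" if "y \<in> T" for y
      using that less.prems(2) x(3) symmetric_matrix_inner[OF sym, of x y] unfolding T_def by simp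
    have "x \<notin> T" using x(2) unfolding T_def by auto
    moreover have "T \<subseteq> S" unfolding T_def by blast
    ultimately have "T \<subset> S" using x(1) by blast
    then have "dim T < dim S"
      using T less.prems(1) by (metis dim_psubset span_eq_iff)
    then obtain B where B: "pairwise orthogonal B" "\<forall>b\<in>B. norm b = 1 \<and> (\<exists>l. A *v b = l *\<^sub>R b)" "span B = T"
      using less.hyps T AT by blast
    have BT: "B \<subseteq> T" using B(3) span_superset by blast
    have "span (insert x B) = S"
    proof (intro equalityI subsetI)
      fix y assume "y \<in> span (insert x B)"
      moreover have "insert x B \<subseteq> S" using BT x(1) unfolding T_def by blast
      ultimately show "y \<in> S" using less.prems(1) span_minimal by blast
    next
      fix y assume y: "y \<in> S"
      have "y - (x \<bullet> y) *\<^sub>R x \<in> T" unfolding T_def using y x less.prems(1)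
        by (auto intro: subspace_diff subspace_scale simp: inner_diff_right dot_square_norm)
      then show "y \<in> span (insert x B)" using B(3) unfolding span_insert by blast
    qed
    moreover have "pairwise orthogonal (insert x B)"
      using B(1) BT unfolding pairwise_insert T_def by (auto simp: orthogonal_def inner_commute)
    ultimately show ?thesis using B(2) x(2,3) by (intro exI[of _ "insert x B"]) auto
  qed
qed

text \<open>Indexing the eigenbasis by \<open>'n\<close> itself turns trace, determinant and energy
  into sums and products over \<open>UNIV\<close>, with multiplicities counted
  automatically.\<close>

lemma symmetric_orthonormal_eigenbasis:
  fixes A :: "real^'n^'n"
  assumes sym: "transpose A = A"
  obtains v e where "\<And>i. A *v v i = e i *\<^sub>R v i" "\<And>i j. v i \<bullet> v j = (if i = (j :: 'n) then 1 else 0)"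
proof -
  obtain B where B: "pairwise orthogonal B" "\<And>b. b \<in> B \<Longrightarrow> norm b = 1"
    "\<And>b. b \<in> B \<Longrightarrow> \<exists>l. A *v b = l *\<^sub>R b" "span B = (UNIV :: (real^'n) set)"
    using symmetric_orthonormal_eigenbasis_subspace[OF sym, of UNIV] by auto
  have "0 \<notin> B" using B(2) by force
  then have ind: "independent B" using B(1) by (intro pairwise_orthogonal_independent)
  have "card B = CARD('n)" using ind B(4) dim_span[of B] dim_eq_card_independent[OF ind] by simp
  moreover have "finite B" using ind by (rule independent_imp_finite)
  ultimately obtain v where v: "bij_betw v (UNIV :: 'n set) B"
    using finite_same_card_bij[of "UNIV :: 'n set" B] by auto
  have vB: "v i \<in> B" for i using v by (auto simp: bij_betw_def)
  define e where "e i = (SOME l. A *v v i = l *\<^sub>R v i)" for i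
  have "A *v v i = e i *\<^sub>R v i" for i
    unfolding e_def using someI_ex[OF B(3)[OF vB[of i]]] .
  moreover have "v i \<bullet> v j = (if i = j then 1 else 0)" for i j
  proof (cases "i = j")
    case True
    then show ?thesis using B(2)[OF vB[of j]] by (simp add: dot_square_norm)
  next
    case False
    then have "v i \<noteq> v j" using v by (auto simp: bij_betw_def inj_on_def)
    then show ?thesis using False B(1) vB unfolding pairwise_def orthogonal_def by auto
  qed
  ultimately show thesis by (rule that)
qed

lemma eigenbasis_det_trace:
  fixes M :: "real^'n^'n"
  assumes "\<And>i. M *v v i = e i *\<^sub>R v i" and "\<And>i j. v i \<bullet> v j = (if i = (j :: 'n) then 1 else 0)"
  shows "det M = (\<Prod>i\<in>UNIV. e i)" "trace M = (\<Sum>i\<in>UNIV. e i)"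
proof -
  define V :: "real^'n^'n" where "V = (\<chi> i j. v j $ i)"
  define D :: "real^'n^'n" where "D = (\<chi> i j. if i = j then e i else 0)"
  have "(M ** V) $ i $ j = (M *v v j) $ i" for i j
    by (simp add: matrix_matrix_mult_def matrix_vector_mult_def V_def)
  moreover have "(V ** D) $ i $ j = (e j *\<^sub>R v j) $ i" for i j
  proof -
    have "(\<Sum>k\<in>UNIV. v k $ i * (if k = j then e k else 0)) = (\<Sum>k\<in>UNIV. if k = j then v k $ i * e k else 0)"
      by (intro sum.cong) auto
    then show ?thesis by (simp add: matrix_matrix_mult_def V_def D_def)
  qed
  ultimately have MV: "M ** V = V ** D" by (simp add: vec_eq_iff assms(1))
  have VV: "transpose V ** V = mat 1"
    using assms(2) by (simp add: vec_eq_iff matrix_matrix_mult_def transpose_def V_def mat_def inner_vec_def)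
  then have VV': "V ** transpose V = mat 1" by (simp add: matrix_left_right_inverse)
  have "det V \<noteq> 0" using VV by (metis det_I det_mul mult_zero_right zero_neq_one)
  moreover have "det M * det V = det V * det D" using MV by (metis det_mul)
  ultimately have "det M = det D" by simp
  then show "det M = (\<Prod>i\<in>UNIV. e i)" by (simp add: det_diagonal D_def)
  have "trace M = trace (M ** (V ** transpose V))" using VV' by simp
  also have "\<dots> = trace ((V ** D) ** transpose V)" using MV by (simp add: matrix_mul_assoc)
  also have "\<dots> = trace ((transpose V ** V) ** D)" by (metis matrix_mul_assoc trace_mul_sym)
  also have "\<dots> = (\<Sum>i\<in>UNIV. e i)" using VV by (simp add: trace_def D_def)
  finally show "trace M = (\<Sum>i\<in>UNIV. e i)" .
qed

section \<open>Characteristic polynomial and eigenvalue multiset from an eigenbasis\<close>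

lemma poly_charpoly: "poly (charpoly A) x = det (mat x - A)"
proof -
  have "poly (\<Prod>i\<in>UNIV. [:- (A $ i $ p i), (if i = p i then 1 else 0):]) x = (\<Prod>i\<in>UNIV. (mat x - A) $ i $ p i)" for p
    by (simp add: poly_prod mat_def) (intro prod.cong, auto)
  then show ?thesis unfolding charpoly_def det_def by (simp add: poly_sum)
qed

lemma charpoly_eigenbasis:
  fixes A :: "real^'n^'n"
  assumes "\<And>i. A *v v i = e i *\<^sub>R v i" and "\<And>i j. v i \<bullet> v j = (if i = (j :: 'n) then 1 else 0)"
  shows "charpoly A = (\<Prod>i\<in>UNIV. [:- e i, 1:])"
proof -
  have "poly (charpoly A) x = poly (\<Prod>i\<in>UNIV. [:- e i, 1:]) x" for x
  proof -
    have "mat x *v v i = x *\<^sub>R v i" for i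
      by (simp add: mat_def matrix_vector_mult_def vec_eq_iff if_distrib[of "\<lambda>y. y * _"] cong: if_cong)
    then have "(mat x - A) *v v i = (x - e i) *\<^sub>R v i" for i
      using assms(1) by (simp add: matrix_vector_mult_diff_rdistrib scaleR_diff_left)
    from eigenbasis_det_trace(1)[of "mat x - A" v "\<lambda>i. x - e i", OF this assms(2)]
    show ?thesis by (simp add: poly_charpoly poly_prod)
  qed
  then show ?thesis by (simp add: poly_eq_poly_eq_iff[symmetric] fun_eq_iff)
qed

text \<open>Links the complex roots by which the energy is defined to the real eigenvalues of an
  eigenbasis.\<close>

lemma eigenvalues_eigenbasis:
  fixes A :: "real^'n^'n"
  assumes "\<And>i. A *v v i = e i *\<^sub>R v i" and "\<And>i j. v i \<bullet> v j = (if i = (j :: 'n) then 1 else 0)"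
  shows "eigenvalues A = image_mset (\<lambda>i. complex_of_real (e i)) (mset_set UNIV)"
proof -
  have mult: "map_poly complex_of_real (p * q) = map_poly complex_of_real p * map_poly complex_of_real q" for p q
    by (simp add: poly_eq_iff coeff_map_poly coeff_mult)
  have hom: "map_poly complex_of_real (\<Prod>i\<in>I. [:- e i, 1:]) = (\<Prod>i\<in>I. [:- complex_of_real (e i), 1:])"
    if "finite I" for I
    using that by (induction I) (simp_all add: map_poly_pCons mult del: mult_pCons_left)
  have nz: "(\<Prod>i\<in>(UNIV :: 'n set). [:- complex_of_real (e i), 1:]) \<noteq> 0" by simp
  have lin: "proots [:- complex_of_real (e i), 1:] = {#complex_of_real (e i)#}" for i
    using proots_linear_factor[of "- complex_of_real (e i)"] by simp
  have "proots (\<Prod>i\<in>(UNIV :: 'n set). [:- complex_of_real (e i), 1:])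
      = (\<Sum>i\<in>(UNIV :: 'n set). {#complex_of_real (e i)#})"
    by (subst proots_prod) (simp_all add: lin)
  also have "\<dots> = image_mset (\<lambda>i. complex_of_real (e i)) (mset_set UNIV)"
    by (simp add: sum_unfold_sum_mset)
  finally show ?thesis unfolding eigenvalues_def charpoly_eigenbasis[OF assms] using hom by simp
qed

section \<open>Spectra of graphs\<close>

definition deg :: "('n::finite \<Rightarrow> 'n \<Rightarrow> bool) \<Rightarrow> 'n \<Rightarrow> nat" where
  "deg E v = card {u. E v u}"

lemma sum_adjacent: "(\<Sum>u\<in>UNIV. if P u then f u else 0) = (\<Sum>u | P u. f u)"
  for f :: "'n::finite \<Rightarrow> real"
  by (simp add: sum.If_cases)

lemma handshake:
  assumes "simple_graph E"
  shows "(\<Sum>v\<in>UNIV. deg E v) = 2 * card (edges E)"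
proof -
  have sym: "E u v \<Longrightarrow> E v u" and irr: "\<not> E u u" for u v
    using assms by (auto simp: simple_graph_def)
  have "(\<Sum>v\<in>UNIV. deg E v) = card (SIGMA v:UNIV. {u. E v u})"
    unfolding deg_def by (simp add: card_SigmaI)
  also have "\<dots> = (\<Sum>e\<in>edges E. card {p \<in> SIGMA v:UNIV. {u. E v u}. {fst p, snd p} = e})"
  proof -
    have "(\<lambda>p. {fst p, snd p}) ` (SIGMA v:UNIV. {u. E v u}) \<subseteq> edges E"
      unfolding edges_def by auto blast
    from sum.group[OF _ _ this, of "\<lambda>_. 1 :: nat"] show ?thesis by simp
  qed
  also have "\<dots> = (\<Sum>e\<in>edges E. 2)"
  proof (rule sum.cong[OF refl])
    fix e assume "e \<in> edges E"
    then obtain u v where e: "e = {u, v}" "E u v" unfolding edges_def by blast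
    then have "{p \<in> SIGMA v:UNIV. {u. E v u}. {fst p, snd p} = e} = {(u, v), (v, u)}"
      using sym by (auto simp: doubleton_eq_iff)
    moreover have "u \<noteq> v" using e(2) irr by blast
    ultimately show "card {p \<in> SIGMA v:UNIV. {u. E v u}. {fst p, snd p} = e} = 2" by simp
  qed
  finally show ?thesis by simp
qed

lemma handshake_real:
  assumes "simple_graph E"
  shows "(\<Sum>v\<in>UNIV. real (deg E v)) = 2 * real (card (edges E))"
  using handshake[OF assms] by (metis of_nat_sum of_nat_mult of_nat_numeral)

lemma adj_matrix_mult: "(adj_matrix E *v x) $ i = (\<Sum>j | E i j. x $ j)"
  by (simp add: adj_matrix_def matrix_vector_mult_def if_distrib[of "\<lambda>y. y * _"] sum_adjacent cong: if_cong)

text \<open>Fixes one eigenbasis, so that all estimates speak of the same numbers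
  \<open>ev i\<close>. Since \<open>top\<close> is an index and not a value, the largest eigenvalue
  can be removed exactly once from sums and products. \<open>ev_top\<close> is the Perron-Frobenius
  fact that it is also the spectral radius.\<close>

locale graph_spectrum =
  fixes E :: "'n::finite \<Rightarrow> 'n \<Rightarrow> bool" and ev :: "'n \<Rightarrow> real" and top :: 'n
  assumes simple: "simple_graph E"
    and energy: "graph_energy E = (\<Sum>i\<in>UNIV. \<bar>ev i\<bar>)"
    and sum_ev: "(\<Sum>i\<in>UNIV. ev i) = 0"
    and sum_ev_squares: "(\<Sum>i\<in>UNIV. (ev i)\<^sup>2) = 2 * real (card (edges E))"
    and prod_ev: "(\<Prod>i\<in>UNIV. ev i) = det (adj_matrix E)"
    and ev_top: "\<bar>ev i\<bar> \<le> ev top"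
    and eigenvector: "\<exists>x. x \<noteq> 0 \<and> (\<forall>i. 0 \<le> x $ i) \<and> adj_matrix E *v x = ev top *\<^sub>R x"
    and eigenbasis: "\<exists>v. (\<forall>i. adj_matrix E *v v i = ev i *\<^sub>R v i) \<and>
      (\<forall>i j. v i \<bullet> v j = (if i = j then 1 else 0))"
    and Rayleigh: "x \<bullet> (adj_matrix E *v x) \<le> ev top * (x \<bullet> x)"

text \<open>Perron-Frobenius is obtained variationally: replacing the entries of a vector by their
  absolute values preserves its norm and never lowers the modulus of the quadratic form of a
  nonnegative matrix.\<close>

lemma graph_spectrum_exists:
  fixes E :: "'n::finite \<Rightarrow> 'n \<Rightarrow> bool"
  assumes simple: "simple_graph E"
  obtains ev top where "graph_spectrum E ev top"
proof -
  define A where "A = adj_matrix E"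
  have sym: "transpose A = A"
    using simple by (auto simp: A_def adj_matrix_def transpose_def simple_graph_def vec_eq_iff)
  obtain v ev where v: "\<And>i. A *v v i = ev i *\<^sub>R v i"
    "\<And>i j. v i \<bullet> v j = (if i = (j :: 'n) then 1 else 0)"
    using symmetric_orthonormal_eigenbasis[OF sym] by blast
  have "axis undefined 1 \<noteq> (0 :: real^'n)" by (simp add: axis_eq_0_iff)
  then have "(UNIV :: (real^'n) set) \<noteq> {0}" by blast
  from symmetric_Rayleigh_maximum[OF sym subspace_UNIV _ this]
  obtain x0 l where x0: "norm x0 = 1" "A *v x0 = l *\<^sub>R x0"
    and R: "\<And>y. y \<bullet> (A *v y) \<le> l * (y \<bullet> y)" by auto
  \<comment> \<open>If the eigenvalue of the maximizer were not among the \<open>ev i\<close>, the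
    maximizer would be orthogonal to the whole eigenbasis.\<close>
  have "\<exists>top. ev top = l"
  proof (rule ccontr)
    assume "\<nexists>top. ev top = l"
    moreover have "ev i * (x0 \<bullet> v i) = l * (x0 \<bullet> v i)" for i
      using symmetric_matrix_inner[OF sym, of x0 "v i"] v(1)[of i] x0(2) by simp
    ultimately have orth: "x0 \<bullet> v i = 0" for i by (metis mult_cancel_right)
    define V :: "real^'n^'n" where "V = (\<chi> i j. v i $ j)"
    have "V ** transpose V = mat 1"
      using v(2) by (simp add: vec_eq_iff matrix_matrix_mult_def transpose_def V_def mat_def inner_vec_def)
    then have "transpose V ** V = mat 1" by (simp add: matrix_left_right_inverse)
    moreover have "V *v x0 = 0"
      using orth by (simp add: vec_eq_iff matrix_vector_mult_def V_def inner_vec_def mult.commute)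
    ultimately have "x0 = 0"
      by (metis matrix_vector_mul_assoc matrix_vector_mul_lid matrix_vector_mult_0_right)
    then show False using x0(1) by simp
  qed
  then obtain top where top: "ev top = l" by blast
  have absx: "\<bar>y \<bullet> (A *v y)\<bar> \<le> (\<chi> i. \<bar>y $ i\<bar>) \<bullet> (A *v (\<chi> i. \<bar>y $ i\<bar>))" for y
  proof -
    have "\<bar>y \<bullet> (A *v y)\<bar> \<le> (\<Sum>i\<in>UNIV. \<bar>y $ i * (\<Sum>j | E i j. y $ j)\<bar>)"
      unfolding inner_vec_def A_def by (simp add: adj_matrix_mult sum_abs)
    also have "\<dots> \<le> (\<Sum>i\<in>UNIV. \<bar>y $ i\<bar> * (\<Sum>j | E i j. \<bar>y $ j\<bar>))"
      by (intro sum_mono) (simp add: abs_mult mult_left_mono sum_abs)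
    finally show ?thesis unfolding inner_vec_def A_def by (simp add: adj_matrix_mult)
  qed
  have normabs: "(\<chi> i. \<bar>y $ i\<bar>) \<bullet> (\<chi> i. \<bar>y $ i\<bar>) = y \<bullet> y" for y :: "real^'n"
    by (simp add: inner_vec_def)
  define x where "x = (\<chi> i. \<bar>x0 $ i\<bar>)"
  have x1: "x \<bullet> x = 1" using normabs[of x0] x0(1) by (simp add: x_def dot_square_norm)
  have "l = x0 \<bullet> (A *v x0)" using x0 by (simp add: dot_square_norm)
  also have "\<dots> \<le> x \<bullet> (A *v x)" using absx[of x0] by (simp add: x_def)
  finally have "x \<bullet> (A *v x) = l * (x \<bullet> x)" using R[of x] by (simp add: x1)
  then have Ax: "A *v x = l *\<^sub>R x"
    using Rayleigh_maximizer_eigenvector[OF sym subspace_UNIV, of x l] R by simp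
  have A2: "(A ** A) *v v i = ((ev i)\<^sup>2) *\<^sub>R v i" for i
    using v(1)[of i] by (simp add: matrix_vector_mul_assoc[symmetric] matrix_vector_mult_scaleR power2_eq_square)
  have "graph_spectrum E ev top"
  proof
    show "simple_graph E" by fact
    show "graph_energy E = (\<Sum>i\<in>UNIV. \<bar>ev i\<bar>)"
      using eigenvalues_eigenbasis[OF v] unfolding graph_energy_def A_def
      by (simp add: multiset.map_comp o_def sum_unfold_sum_mset)
    have "trace A = 0" using simple by (simp add: trace_def A_def adj_matrix_def simple_graph_def)
    then show "(\<Sum>i\<in>UNIV. ev i) = 0" using eigenbasis_det_trace(2)[OF v] by simp
    have "trace (A ** A) = (\<Sum>i\<in>UNIV. \<Sum>j\<in>UNIV. if E i j then 1 else 0)"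
      unfolding trace_def matrix_matrix_mult_def using simple
      by (auto simp: A_def adj_matrix_def simple_graph_def intro!: sum.cong)
    also have "\<dots> = (\<Sum>i\<in>UNIV. real (deg E i))" unfolding sum_adjacent deg_def by simp
    finally show "(\<Sum>i\<in>UNIV. (ev i)\<^sup>2) = 2 * real (card (edges E))"
      using eigenbasis_det_trace(2)[OF A2 v(2)] handshake_real[OF simple] by simp
    show "(\<Prod>i\<in>UNIV. ev i) = det (adj_matrix E)"
      using eigenbasis_det_trace(1)[OF v] by (simp add: A_def)
    show "\<exists>x. x \<noteq> 0 \<and> (\<forall>i. 0 \<le> x $ i) \<and> adj_matrix E *v x = ev top *\<^sub>R x"
      using x1 Ax top by (intro exI[of _ x]) (auto simp: x_def A_def)
    show "\<bar>ev i\<bar> \<le> ev top" for i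
      using absx[of "v i"] R[of "\<chi> k. \<bar>v i $ k\<bar>"] normabs[of "v i"] v(1)[of i] v(2)[of i i] top by simp
    show "\<exists>v. (\<forall>i. adj_matrix E *v v i = ev i *\<^sub>R v i) \<and> (\<forall>i j. v i \<bullet> v j = (if i = j then 1 else 0))"
      using v unfolding A_def by blast
    show "x \<bullet> (adj_matrix E *v x) \<le> ev top * (x \<bullet> x)" for x
      using R[of x] top by (simp add: A_def)
  qed
  then show thesis by (rule that)
qed

context graph_spectrum
begin

text \<open>Rayleigh quotient of the all-ones vector.\<close>

lemma avg_degree_le: "avg_degree E \<le> ev top"
proof -
  define x :: "real^'n" where "x = (\<chi> i. 1)"
  have "x \<bullet> (adj_matrix E *v x) = (\<Sum>i\<in>UNIV. real (deg E i))"
    by (simp add: inner_vec_def adj_matrix_mult x_def deg_def)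
  moreover have "x \<bullet> x = real CARD('n)" by (simp add: inner_vec_def x_def)
  ultimately show ?thesis
    using Rayleigh[of x] handshake_real[OF simple] by (simp add: avg_degree_def divide_le_eq)
qed

text \<open>The polynomial \<open>t\<^sup>2 - (\<delta> - 1) t\<close> in the largest eigenvalue is an average of the row sums
  of the same polynomial in the adjacency matrix, weighted by a nonnegative eigenvector.\<close>

lemma ev_top_quadratic:
  assumes deg: "\<And>v. \<delta> \<le> real (deg E v)"
  shows "(ev top)\<^sup>2 - (\<delta> - 1) * ev top \<le> 2 * real (card (edges E)) - \<delta> * (real CARD('n) - 1)"
proof -
  have sym: "E u v \<longleftrightarrow> E v u" and irr: "\<not> E u u" for u v
    using simple by (auto simp: simple_graph_def)
  obtain x where x: "x \<noteq> 0" "\<And>i. 0 \<le> x $ i" and "adj_matrix E *v x = ev top *\<^sub>R x"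
    using eigenvector by blast
  then have Ax: "(\<Sum>j\<in>UNIV. if E i j then x $ j else 0) = ev top * x $ i" for i
    using adj_matrix_mult[of E x i] unfolding sum_adjacent by simp
  define X where "X = (\<Sum>i\<in>UNIV. x $ i)"
  obtain i where "x $ i \<noteq> 0" using x(1) by (auto simp: vec_eq_iff)
  then have X: "X > 0" unfolding X_def using x(2) by (intro sum_pos2[of _ i]) (auto simp: order_less_le)
  \<comment> \<open>Symmetry moves the matrix from the eigenvector \<open>x\<close> to the weight
    \<open>f\<close>; the weights 1 and degree give the first and second power of the largest
    eigenvalue.\<close>
  have swap: "(\<Sum>i\<in>UNIV. f i * (ev top * x $ i)) = (\<Sum>j\<in>UNIV. x $ j * (\<Sum>i | E j i. f i))"
    for f :: "'n \<Rightarrow> real"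
  proof -
    have "(\<Sum>i\<in>UNIV. f i * (ev top * x $ i)) = (\<Sum>i\<in>UNIV. \<Sum>j\<in>UNIV. if E i j then f i * x $ j else 0)"
      unfolding Ax[symmetric] sum_distrib_left by (intro sum.cong) auto
    also have "\<dots> = (\<Sum>j\<in>UNIV. \<Sum>i\<in>UNIV. if E j i then x $ j * f i else 0)"
      by (subst sum.swap, intro sum.cong) (auto simp: sym)
    finally show ?thesis by (simp add: sum_adjacent sum_distrib_left)
  qed
  have 1: "ev top * X = (\<Sum>j\<in>UNIV. x $ j * real (deg E j))"
    using swap[of "\<lambda>_. 1"] by (simp add: X_def sum_distrib_left deg_def)
  have 2: "(ev top)\<^sup>2 * X = (\<Sum>j\<in>UNIV. x $ j * (\<Sum>i | E j i. real (deg E i)))"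
    using swap[of "\<lambda>i. real (deg E i)"] arg_cong[OF 1, of "\<lambda>t. ev top * t"]
    by (simp add: sum_distrib_left power2_eq_square mult.assoc mult.left_commute mult.commute)
  \<comment> \<open>The degrees sum to twice the number of edges. Taking out \<open>j\<close> and
    its neighbours leaves \<open>n - 1 - deg E j\<close> vertices of degree at least
    \<open>\<delta>\<close>, and \<open>\<delta> - 1\<close> is the coefficient for which
    \<open>deg E j\<close> cancels.\<close>
  have row: "(\<Sum>i | E j i. real (deg E i)) - (\<delta> - 1) * real (deg E j)
      \<le> 2 * real (card (edges E)) - \<delta> * (real CARD('n) - 1)" for j
  proof -
    define W where "W = UNIV - insert j {i. E j i}"
    have U: "UNIV = insert j {i. E j i} \<union> W" unfolding W_def by blast
    have "2 * real (card (edges E)) = (\<Sum>i\<in>insert j {i. E j i} \<union> W. real (deg E i))"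
      using handshake_real[OF simple] U by simp
    also have "\<dots> = real (deg E j) + (\<Sum>i | E j i. real (deg E i)) + (\<Sum>i\<in>W. real (deg E i))"
      by (subst sum.union_disjoint) (use irr in \<open>auto simp: W_def\<close>)
    finally have s: "2 * real (card (edges E)) = real (deg E j) + (\<Sum>i | E j i. real (deg E i)) + (\<Sum>i\<in>W. real (deg E i))" .
    have "card (insert j {i. E j i} \<union> W) = (deg E j + 1) + card W"
      by (subst card_Un_disjoint) (use irr in \<open>auto simp: W_def deg_def\<close>)
    then have "real (card W) = real CARD('n) - 1 - real (deg E j)" using U by simp
    moreover have "(\<Sum>i\<in>W. real (deg E i)) \<ge> (\<Sum>i\<in>W. \<delta>)" by (intro sum_mono deg)
    ultimately have "(\<Sum>i\<in>W. real (deg E i)) \<ge> \<delta> * (real CARD('n) - 1 - real (deg E j))"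
      by (simp add: mult.commute)
    then show ?thesis using s by (simp add: algebra_simps)
  qed
  have "((ev top)\<^sup>2 - (\<delta> - 1) * ev top) * X
      = (\<Sum>j\<in>UNIV. x $ j * ((\<Sum>i | E j i. real (deg E i)) - (\<delta> - 1) * real (deg E j)))"
  proof -
    have "((ev top)\<^sup>2 - (\<delta> - 1) * ev top) * X = (ev top)\<^sup>2 * X - (\<delta> - 1) * (ev top * X)"
      by (simp add: algebra_simps)
    also have "\<dots> = (\<Sum>j\<in>UNIV. x $ j * (\<Sum>i | E j i. real (deg E i)) - (\<delta> - 1) * (x $ j * real (deg E j)))"
      unfolding 1 2 by (simp add: sum_subtractf sum_distrib_left[of "\<delta> - 1"])
    finally show ?thesis by (simp add: algebra_simps)
  qed
  also have "\<dots> \<le> (\<Sum>j\<in>UNIV. x $ j * (2 * real (card (edges E)) - \<delta> * (real CARD('n) - 1)))"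
    by (intro sum_mono mult_left_mono row x)
  also have "\<dots> = (2 * real (card (edges E)) - \<delta> * (real CARD('n) - 1)) * X"
    unfolding X_def sum_distrib_right[symmetric] by (simp add: mult.commute)
  finally show ?thesis using X by simp
qed

end

section \<open>Determinants of even symmetric integer matrices\<close>

lemma det_of_int:
  fixes B :: "int^'n^'n"
  shows "det (\<chi> i j. of_int (B $ i $ j)) = (of_int (det B) :: 'a :: comm_ring_1)"
  by (simp add: det_def)

lemma rat_square_int:
  assumes "(of_int d :: rat) = q\<^sup>2"
  shows "\<exists>z. d = z\<^sup>2"
proof -
  obtain a b where ab: "q = of_int a / of_int b" "b > 0" "coprime a b"
    by (metis quotient_of_coprime quotient_of_denom_pos quotient_of_div surj_pair)
  then have "(of_int (d * b\<^sup>2) :: rat) = of_int (a\<^sup>2)"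
    using assms by (simp add: power_divide)
  then have eq: "d * b\<^sup>2 = a\<^sup>2" by (simp only: of_int_eq_iff)
  then have "b\<^sup>2 dvd a\<^sup>2" by (metis dvd_triv_right)
  then have "b dvd a" by simp
  then have "is_unit b" using ab(3) by (simp add: coprime_absorb_right)
  then have "b = 1" using ab(2) by simp
  then show ?thesis using eq by auto
qed

lemma det_congruence:
  fixes K :: "'a::comm_ring_1^'n^'n"
  shows "det (P ** K ** transpose P) = (det P)\<^sup>2 * det K"
  by (simp add: det_mul det_transpose power2_eq_square)

text \<open>Left multiplication adds multiples of rows \<open>u\<close> and \<open>v\<close> to the
  rows, so congruence by a shear eliminates rows and columns simultaneously.\<close>

definition shear :: "'n \<Rightarrow> 'n \<Rightarrow> ('n \<Rightarrow> 'a) \<Rightarrow> ('n \<Rightarrow> 'a) \<Rightarrow> 'a::comm_ring_1^'n^'n" where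
  "shear u v \<alpha> \<beta> = (\<chi> i j. (if i = j then 1 else 0) + (if j = u then \<alpha> i else 0) + (if j = v then \<beta> i else 0))"

lemma shear_mult:
  fixes M :: "'a::comm_ring_1^'n^'n"
  shows "(shear u v \<alpha> \<beta> ** M) $ i $ j = M $ i $ j + \<alpha> i * M $ u $ j + \<beta> i * M $ v $ j"
proof -
  have "(shear u v \<alpha> \<beta> ** M) $ i $ j = (\<Sum>l\<in>UNIV. (if l = i then M $ i $ j else 0)
      + (if l = u then \<alpha> i * M $ u $ j else 0) + (if l = v then \<beta> i * M $ v $ j else 0))"
    unfolding matrix_matrix_mult_def shear_def by (auto intro!: sum.cong simp: distrib_right)
  then show ?thesis by (simp add: sum.distrib)
qed

lemma mult_transpose_shear:
  fixes M :: "'a::comm_ring_1^'n^'n"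
  shows "(M ** transpose (shear u v \<alpha> \<beta>)) $ i $ j = M $ i $ j + \<alpha> j * M $ i $ u + \<beta> j * M $ i $ v"
proof -
  have "M ** transpose (shear u v \<alpha> \<beta>) = transpose (shear u v \<alpha> \<beta> ** transpose M)"
    by (simp add: matrix_transpose_mul)
  then show ?thesis by (simp only: transpose_def vec_lambda_beta shear_mult)
qed

lemma det_shear_nonzero:
  fixes \<alpha> \<beta> :: "'n::finite \<Rightarrow> 'a::field"
  assumes "\<alpha> u = 0" "\<beta> u = 0" "\<alpha> v = 0" "\<beta> v = 0"
  shows "det (shear u v \<alpha> \<beta> :: 'a^'n^'n) \<noteq> 0"
proof -
  have "shear u v (\<lambda>i. - \<alpha> i) (\<lambda>i. - \<beta> i) ** shear u v \<alpha> \<beta> = mat 1"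
    using assms by (simp add: vec_eq_iff shear_mult) (auto simp: shear_def mat_def)
  then show ?thesis by (metis det_I det_mul mult_zero_right zero_neq_one)
qed

text \<open>The induction removes one hyperbolic pair \<open>u, v\<close> at a time; outside \<open>S\<close> the matrix is the
  identity, so that all matrices have the same size.\<close>

lemma det_skew_block_square:
  fixes K :: "'a::field_char_0^'n^'n"
  assumes "\<And>i j. i \<in> S \<Longrightarrow> j \<in> S \<Longrightarrow> K $ i $ j = - K $ j $ i"
    and "\<And>i j. i \<notin> S \<or> j \<notin> S \<Longrightarrow> K $ i $ j = (if i = j then 1 else 0)"
  shows "\<exists>q. det K = q\<^sup>2"
  using assms
proof (induction "card S" arbitrary: S K rule: less_induct)
  case less
  note skew = less.prems(1) and outside = less.prems(2)
  show ?case
  proof (cases "S = {}")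
    case True
    then have "K = mat 1" using outside by (simp add: vec_eq_iff mat_def)
    then show ?thesis by (intro exI[of _ 1]) simp
  next
    case False
    then obtain u where u: "u \<in> S" by blast
    show ?thesis
    proof (cases "\<exists>v\<in>S. K $ u $ v \<noteq> 0")
      case False
      then have "row u K = 0" using outside[of u] u by (auto simp: row_def vec_eq_iff)
      then show ?thesis by (intro exI[of _ 0]) (simp add: det_zero_row)
    next
      case True
      then obtain v where v: "v \<in> S" "K $ u $ v \<noteq> 0" by blast
      define k where "k = K $ u $ v"
      have uu: "K $ u $ u = 0" "K $ v $ v = 0" using skew[of u u] skew[of v v] u v by auto
      then have uv: "u \<noteq> v" using v(2) by auto
      have vu: "K $ v $ u = - k" using skew[of v u] u v k_def by simp
      have k: "k \<noteq> 0" using v k_def by simp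
      define S' where "S' = S - {u, v}"
      \<comment> \<open>Chosen so that the congruence clears columns \<open>u\<close> and
        \<open>v\<close> in the rows of \<open>S'\<close>, using the pivots \<open>k\<close> and
        \<open>- k\<close>.\<close>
      define \<alpha> \<beta> where "\<alpha> i = (if i \<in> S' then - K $ i $ v / k else 0)"
        and "\<beta> i = (if i \<in> S' then K $ i $ u / k else 0)" for i
      define P where "P = shear u v \<alpha> \<beta>"
      define M where "M = P ** K ** transpose P"
      have uvS': "u \<notin> S'" "v \<notin> S'" unfolding S'_def by auto
      have P: "det P \<noteq> 0" unfolding P_def by (rule det_shear_nonzero) (auto simp: \<alpha>_def \<beta>_def uvS')
      have M: "M $ i $ j = (K $ i $ j + \<alpha> i * K $ u $ j + \<beta> i * K $ v $ j)
          + \<alpha> j * (K $ i $ u + \<alpha> i * K $ u $ u + \<beta> i * K $ v $ u)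
          + \<beta> j * (K $ i $ v + \<alpha> i * K $ u $ v + \<beta> i * K $ v $ v)" for i j
        unfolding M_def P_def by (simp only: mult_transpose_shear shear_mult)
      have M': "M $ i $ j = K $ i $ j + \<alpha> i * K $ u $ j + \<beta> i * K $ v $ j" if "i \<in> S'" for i j
        using that k uu vu unfolding M by (simp add: \<alpha>_def \<beta>_def k_def[symmetric])
      define N :: "'a^'n^'n" where
        "N = (\<chi> i j. if i \<in> S' \<and> j \<in> S' then M $ i $ j else if i = j then 1 else 0)"
      \<comment> \<open>The cleared matrix is the product of the hyperbolic block on
        \<open>u\<close>, \<open>v\<close> and the smaller block \<open>N\<close>, both padded with
        the identity.\<close>
      define R :: "'a^'n^'n" where
        "R = (\<chi> i j. if i = u then (if j = v then k else 0) else if i = v then (if j = u then - k else 0)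
           else if i = j then 1 else 0)"
      have RN: "(R ** N) $ i $ j = (if i = u then k * N $ v $ j else if i = v then - k * N $ u $ j else N $ i $ j)" for i j
        by (simp add: matrix_matrix_mult_def R_def if_distrib[of "\<lambda>y. y * _"] cong: if_cong)
      have Mu: "M $ u $ j = K $ u $ j + \<beta> j * k" "M $ v $ j = K $ v $ j - \<alpha> j * k" for j
        using uvS' uu vu unfolding M by (simp_all add: \<alpha>_def \<beta>_def k_def[symmetric])
      have "M $ i $ j = (R ** N) $ i $ j" for i j
      proof (cases "i \<in> S'")
        case True
        then show ?thesis
        proof (cases "j \<in> S'")
          case True
          then show ?thesis unfolding RN using \<open>i \<in> S'\<close> uvS' by (auto simp: N_def)
        next
          case False
          then consider "j = u" | "j = v" | "j \<notin> S" unfolding S'_def by blast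
          then have "M $ i $ j = 0"
          proof cases
            case 1
            then show ?thesis using True k uu vu unfolding M'[OF True] by (simp add: \<beta>_def)
          next
            case 2
            then show ?thesis using True k uu vu unfolding M'[OF True] by (simp add: \<alpha>_def k_def[symmetric])
          next
            case 3
            then show ?thesis using True u v outside[of _ j] unfolding M'[OF True] by (auto simp: S'_def)
          qed
          then show ?thesis unfolding RN using True False uvS' by (auto simp: N_def)
        qed
      next
        case False
        then consider "i = u" | "i = v" | "i \<notin> S" unfolding S'_def by blast
        then show ?thesis
        proof cases
          case 1
          have "M $ u $ j = (if j = v then k else 0)"
            using Mu(1)[of j] uu k_def skew[of j u] u outside[of u j] k
            by (cases "j \<in> S'") (auto simp: \<beta>_def S'_def)
          then show ?thesis unfolding RN using 1 uvS' by (auto simp: N_def)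
        next
          case 2
          have "M $ v $ j = (if j = u then - k else 0)"
            using Mu(2)[of j] uu vu skew[of j v] v outside[of v j] k
            by (cases "j \<in> S'") (auto simp: \<alpha>_def S'_def)
          then show ?thesis unfolding RN using 2 uv uvS' by (auto simp: N_def)
        next
          case 3
          then have "i \<noteq> u" "i \<noteq> v" "i \<notin> S'" using u v unfolding S'_def by auto
          then show ?thesis unfolding RN M using 3 outside[of i] by (auto simp: N_def \<alpha>_def \<beta>_def)
        qed
      qed
      then have "M = R ** N" by (simp add: vec_eq_iff)
      moreover have "det R = k\<^sup>2"
      proof -
        \<comment> \<open>\<open>R\<close> is this diagonal matrix with two rows exchanged; the sign
          of the transposition and the product of \<open>k\<close> and \<open>- k\<close> combine to
          \<open>k\<^sup>2\<close>.\<close>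
        define D :: "'a^'n^'n" where "D = (\<chi> i j. if i = j then (if i = v then k else if i = u then - k else 1) else 0)"
        have "R = (\<chi> i. D $ Transposition.transpose u v i)"
          using uv by (auto simp: R_def D_def vec_eq_iff Transposition.transpose_def)
        then have "det R = of_int (sign (Transposition.transpose u v)) * det D"
          using det_permute_rows[of "Transposition.transpose u v" D] by (simp add: permutes_swap_id)
        also have "det D = (\<Prod>i\<in>UNIV. if i = v then k else if i = u then - k else 1)"
          unfolding D_def by (subst det_diagonal) auto
        also have "\<dots> = (\<Prod>i\<in>{u, v}. if i = v then k else if i = u then - k else 1)"
          by (rule prod.mono_neutral_right) auto
        finally show ?thesis using uv by (simp add: sign_swap_id power2_eq_square)
      qed
      moreover have "\<exists>q. det N = q\<^sup>2"
      proof (rule less.hyps[of S'])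
        have "finite S" by simp
        then show "card S' < card S" unfolding S'_def using u by (intro psubset_card_mono) auto
        show "N $ i $ j = - N $ j $ i" if "i \<in> S'" "j \<in> S'" for i j
        proof -
          have "i \<in> S" "j \<in> S" using that unfolding S'_def by auto
          then show ?thesis
            using that skew[of j i] skew[of j u] skew[of j v] skew[of u i] skew[of v i] u v
            by (simp add: N_def M' \<alpha>_def \<beta>_def mult.commute)
        qed
        show "N $ i $ j = (if i = j then 1 else 0)" if "i \<notin> S' \<or> j \<notin> S'" for i j
          using that by (auto simp: N_def)
      qed
      then obtain q where "det N = q\<^sup>2" by blast
      ultimately have "(det P)\<^sup>2 * det K = (k * q)\<^sup>2"
        using det_congruence[of P K] by (simp add: M_def[symmetric] det_mul power_mult_distrib)
      then have "det K = (k * q / det P)\<^sup>2" using P by (simp add: power_divide eq_divide_eq mult.commute[of "det K"])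
      then show ?thesis by blast
    qed
  qed
qed

text \<open>Up to sign the root is the Pfaffian. Elimination divides by pivots and so works over the
  rationals; an integer that is a rational square is the square of an integer.\<close>

lemma det_skew_int_square:
  fixes K :: "int^'n^'n"
  assumes "\<And>i j. K $ i $ j = - K $ j $ i"
  shows "\<exists>z. det K = z\<^sup>2"
proof -
  have skew: "rat_of_int (K $ i $ j) = - rat_of_int (K $ j $ i)" for i j
    by (subst assms) simp
  have "\<exists>q. det (\<chi> i j. rat_of_int (K $ i $ j)) = q\<^sup>2"
  proof (rule det_skew_block_square[of UNIV])
    show "(\<chi> i j. rat_of_int (K $ i $ j)) $ i $ j = - (\<chi> i j. rat_of_int (K $ i $ j)) $ j $ i" for i j
      unfolding vec_lambda_beta by (rule skew)
  qed simp
  then show ?thesis using rat_square_int[of "det K"] by (auto simp: det_of_int)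
qed


section \<open>Palindromic determinant polynomials\<close>

lemma det_scale:
  fixes M :: "'a::comm_ring_1^'n^'n"
  shows "det (\<chi> i j. x * M $ i $ j) = x ^ CARD('n) * det M"
  unfolding det_def by (simp add: prod.distrib sum_distrib_left mult.left_commute)

lemma coeff_prod_linear_Ints:
  "coeff (\<Prod>i\<in>I. [:real_of_int (a i), real_of_int (b i):]) k \<in> \<int>"
proof (induction I arbitrary: k rule: infinite_finite_induct)
  case (insert x I)
  then show ?case by (cases k) (auto simp: coeff_pCons)
qed (auto simp: coeff_1)

text \<open>If \<open>B = U + U\<^sup>T\<close>, then \<open>det (U + x U\<^sup>T)\<close> is a palindromic integer polynomial in \<open>x\<close>
  with value \<open>det B\<close> at \<open>1\<close> and the determinant of the skew matrix \<open>U - U\<^sup>T\<close> at \<open>-1\<close>.\<close>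

lemma det_symmetric_palindromic:
  fixes B :: "int^'n^'n"
  assumes sym: "\<And>i j. B $ i $ j = B $ j $ i" and diag: "\<And>i. B $ i $ i = 0"
  obtains c :: "nat \<Rightarrow> int" and z where
    "\<And>k. k \<le> CARD('n) \<Longrightarrow> c k = c (CARD('n) - k)"
    "det B = (\<Sum>k\<le>CARD('n). c k)" "z\<^sup>2 = (\<Sum>k\<le>CARD('n). c k * (-1) ^ k)"
proof -
  define n where "n = CARD('n)"
  \<comment> \<open>An injection into the naturals serves as an arbitrary linear order of the
    indices, making \<open>U\<close> the strictly upper triangular part.\<close>
  obtain r :: "'n \<Rightarrow> nat" where r: "inj r" using finite_imp_inj_to_nat_seg[of "UNIV :: 'n set"] by auto
  define U where "U i j = (if r i < r j then B $ i $ j else 0)" for i j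
  have BU: "B $ i $ j = U i j + U j i" for i j
    using sym[of i j] diag[of i] r unfolding U_def by (auto simp: not_less dest: injD le_antisym)
  define P where "P = det (\<chi> i j. [:real_of_int (U i j), real_of_int (U j i):])"
  have Pval: "poly P x = det (\<chi> i j. real_of_int (U i j) + x * real_of_int (U j i))" for x
    unfolding P_def det_def by (simp add: poly_sum poly_prod)
  have Pint: "coeff P k \<in> \<int>" for k
    unfolding P_def det_def coeff_sum
    by (intro Ints_sum) (auto simp: of_int_poly intro!: Ints_mult coeff_prod_linear_Ints)
  have deg: "degree P \<le> n"
  proof -
    have "degree (of_int (sign p) * (\<Prod>i\<in>UNIV. [:real_of_int (U i (p i)), real_of_int (U (p i) i):])) \<le> n" for p
    proof -
      have "degree (\<Prod>i\<in>UNIV. [:real_of_int (U i (p i)), real_of_int (U (p i) i):])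
          \<le> (\<Sum>i\<in>(UNIV::'n set). degree [:real_of_int (U i (p i)), real_of_int (U (p i) i):])"
        using degree_prod_sum_le[of UNIV "\<lambda>i. [:real_of_int (U i (p i)), real_of_int (U (p i) i):]"]
        by (simp add: o_def)
      also have "\<dots> \<le> (\<Sum>i\<in>(UNIV::'n set). 1)" by (intro sum_mono) simp
      finally have "degree (\<Prod>i\<in>UNIV. [:real_of_int (U i (p i)), real_of_int (U (p i) i):]) \<le> n"
        by (simp add: n_def)
      then show ?thesis by (simp add: of_int_poly)
    qed
    then show ?thesis unfolding P_def det_def by (auto intro!: degree_sum_le simp: finite_permutations)
  qed
  have Psum: "poly P x = (\<Sum>k\<le>n. coeff P k * x ^ k)" for x
    unfolding poly_altdef using deg
    by (intro sum.mono_neutral_left) (auto simp: coeff_eq_0)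
  \<comment> \<open>Transposition swaps \<open>U\<close> with its transpose, and extracting
    \<open>x\<close> from every row reverses the polynomial.\<close>
  have pal: "poly P x = x ^ n * poly P (1 / x)" if "x \<noteq> 0" for x
  proof -
    have "det (\<chi> i j. real_of_int (U i j) + x * real_of_int (U j i))
        = det (transpose (\<chi> i j. x * (real_of_int (U i j) + 1 / x * real_of_int (U j i))))"
      using that by (intro arg_cong[of _ _ det]) (simp add: transpose_def vec_eq_iff distrib_left)
    also have "\<dots> = x ^ n * det (\<chi> i j. real_of_int (U i j) + 1 / x * real_of_int (U j i))"
      unfolding det_transpose n_def
      using det_scale[of x "\<chi> i j. real_of_int (U i j) + 1 / x * real_of_int (U j i)"] by simp
    finally show ?thesis unfolding Pval .
  qed
  define Q where "Q = (\<Sum>k\<le>n. monom (coeff P (n - k)) k)"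
  have "poly P x = poly Q x" if "x \<noteq> 0" for x
  proof -
    have "poly P x = (\<Sum>k\<le>n. coeff P k * (x ^ n * (1 / x) ^ k))"
      using pal[OF that] by (simp add: Psum sum_distrib_left mult.left_commute)
    also have "\<dots> = (\<Sum>k\<le>n. coeff P k * x ^ (n - k))"
      using that by (intro sum.cong) (auto simp: power_diff power_divide)
    also have "\<dots> = (\<Sum>k\<le>n. coeff P (n - k) * x ^ k)"
      by (rule sum.reindex_bij_witness[of _ "\<lambda>k. n - k" "\<lambda>k. n - k"]) auto
    finally show ?thesis by (simp add: Q_def poly_sum poly_monom)
  qed
  \<comment> \<open>The identity is known only for \<open>x \<noteq> 0\<close>; a factor of the
    variable makes it hold at 0 too and is cancelled afterwards.\<close>
  then have "poly (P * [:0, 1:]) x = poly (Q * [:0, 1:]) x" for x by (cases "x = 0") simp_all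
  then have "P * [:0, 1:] = Q * [:0, 1:]" by (simp only: poly_eq_poly_eq_iff[symmetric] fun_eq_iff) simp
  then have "P = Q" by (metis mult_right_cancel pCons_eq_0_iff zero_neq_one)
  then have coeffQ: "coeff P k = coeff P (n - k)" if "k \<le> n" for k
  proof -
    have "coeff Q k = (\<Sum>j\<le>n. if j = k then coeff P (n - j) else 0)"
      by (simp add: Q_def coeff_sum)
    also have "\<dots> = coeff P (n - k)" using that by simp
    finally show ?thesis unfolding \<open>P = Q\<close>[symmetric] .
  qed
  define c where "c k = \<lfloor>coeff P k\<rfloor>" for k
  have c: "real_of_int (c k) = coeff P k" for k using Pint[of k] by (simp add: c_def)
  have "real_of_int (det B) = poly P 1"
    unfolding Pval det_of_int[symmetric] by (simp add: BU)
  then have "det B = (\<Sum>k\<le>n. c k)"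
    unfolding Psum c[symmetric] by (simp only: power_one mult_1_right of_int_sum[symmetric] of_int_eq_iff)
  note detB = this
  define K :: "int^'n^'n" where "K = (\<chi> i j. U i j - U j i)"
  obtain z where z: "det K = z\<^sup>2" using det_skew_int_square[of K] by (auto simp: K_def)
  have "real_of_int (det K) = poly P (-1)"
    unfolding Pval det_of_int[symmetric] by (simp add: K_def)
  also have "\<dots> = real_of_int (\<Sum>k\<le>n. c k * (-1) ^ k)"
    unfolding Psum c[symmetric] by simp
  finally have detK: "z\<^sup>2 = (\<Sum>k\<le>n. c k * (-1) ^ k)" unfolding z by (simp only: of_int_eq_iff)
  have "c k = c (n - k)" if "k \<le> n" for k using coeffQ[OF that] by (simp add: c_def)
  then show thesis using that[of c z] detB detK unfolding n_def by blast
qed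

section \<open>Lower bounds for sums with given product and sum of squares\<close>

text \<open>The degree is odd so that the Taylor polynomial is below \<open>exp\<close> also at negative arguments.\<close>

definition expl :: "real \<Rightarrow> real" where
  "expl x = 1 + x * (1 + x/2 * (1 + x/3 * (1 + x/4 * (1 + x/5 * (1 + x/6 * (1 + x/7 * (1 + x/8 * (1 + x/9))))))))"

lemma expl_le_exp: "expl x \<le> exp x"
proof -
  obtain t where "exp x = (\<Sum>m<10. x ^ m / fact m) + exp t / fact 10 * x ^ 10"
    using Maclaurin_exp_le[of x 10] by blast
  moreover have "exp t / fact 10 * x ^ 10 \<ge> 0"
    by (intro mult_nonneg_nonneg divide_nonneg_nonneg zero_le_even_power) auto
  moreover have "(\<Sum>m<10. x ^ m / fact m) = expl x"
    by (simp add: expl_def eval_nat_numeral lessThan_Suc fact_numeral) (simp add: field_simps)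
  ultimately show ?thesis by linarith
qed

lemma ln_le_expl: "0 < x \<Longrightarrow> x \<le> expl y \<Longrightarrow> ln x \<le> y"
  using expl_le_exp[of y] by (metis exp_gt_zero ln_exp ln_le_cancel_iff order_trans)

text \<open>Surplus in the basic inequality, normalised to tangent point 1: the coefficient
  \<open>1 - 2 * c\<close> makes 1 a double zero. Other tangent points enter by scaling.\<close>

definition gap :: "real \<Rightarrow> real \<Rightarrow> real" where
  "gap c t = t - 1 - c * (t\<^sup>2 - 1) - (1 - 2 * c) * ln t"

lemma gap_derivative:
  "0 < t \<Longrightarrow> (gap c has_real_derivative (t - 1) * (1 - 2 * c * (t + 1)) / t) (at t)"
  unfolding gap_def
  by (auto intro!: derivative_eq_intros simp: field_simps power2_eq_square)

text \<open>With \<open>c \<le> 1/4\<close> the function decreases to its zero \<open>1\<close>, then increases and finally decreases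
  again, so its sign on an initial interval is decided at the right end.\<close>

lemma gap_nonneg:
  assumes c: "0 \<le> c" "c \<le> 1/4" and t: "0 < t" "t \<le> T" and T: "0 \<le> gap c T"
  shows "0 \<le> gap c t"
proof (cases "t \<le> 1")
  case True
  have "gap c 1 \<le> gap c t"
  proof (rule DERIV_nonpos_imp_nonincreasing[OF True, of "gap c"])
    fix x assume x: "t \<le> x" "x \<le> 1"
    then have "c * (x + 1) \<le> 1/4 * 2" using c t by (intro mult_mono) auto
    then have "(x - 1) * (1 - 2 * c * (x + 1)) \<le> 0" using x by (intro mult_nonpos_nonneg) auto
    then show "\<exists>y. (gap c has_real_derivative y) (at x) \<and> y \<le> 0"
      using gap_derivative[of x c] x t
        by (intro exI[of _ "(x - 1) * (1 - 2 * c * (x + 1)) / x"]) (auto intro!: divide_nonpos_pos)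
  qed
  then show ?thesis by (simp add: gap_def)
next
  case False
  show ?thesis
  proof (cases "2 * c * (t + 1) \<le> 1")
    case True
    have "gap c 1 \<le> gap c t"
    proof (rule DERIV_nonneg_imp_nondecreasing[where f = "gap c"])
      show "1 \<le> t" using False by simp
      fix x assume x: "1 \<le> x" "x \<le> t"
      then have "2 * c * (x + 1) \<le> 2 * c * (t + 1)" using c by (intro mult_left_mono) auto
      then have "(x - 1) * (1 - 2 * c * (x + 1)) \<ge> 0" using x True by (intro mult_nonneg_nonneg) auto
      then show "\<exists>y. (gap c has_real_derivative y) (at x) \<and> 0 \<le> y"
        using gap_derivative[of x c] x
        by (intro exI[of _ "(x - 1) * (1 - 2 * c * (x + 1)) / x"]) (auto intro!: divide_nonneg_pos)
    qed
    then show ?thesis by (simp add: gap_def)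
  next
    case less: False
    have "gap c T \<le> gap c t"
    proof (rule DERIV_nonpos_imp_nonincreasing[OF t(2), of "gap c"])
      fix x assume x: "t \<le> x" "x \<le> T"
      then have "2 * c * (t + 1) \<le> 2 * c * (x + 1)" using c by (intro mult_left_mono) auto
      then have "(x - 1) * (1 - 2 * c * (x + 1)) \<le> 0" using x less False
        by (intro mult_nonneg_nonpos) auto
      then show "\<exists>y. (gap c has_real_derivative y) (at x) \<and> y \<le> 0"
        using gap_derivative[of x c] x t
        by (intro exI[of _ "(x - 1) * (1 - 2 * c * (x + 1)) / x"]) (auto intro!: divide_nonpos_pos)
    qed
    then show ?thesis using T by simp
  qed
qed

text \<open>Adds up \<open>gap c (\<mu> i / s) \<ge> 0\<close>, multiplied by \<open>s\<close>. The
  scale \<open>s\<close> is the value at which the estimate of a single term is sharp, and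
  \<open>c / s\<close> is the weight given to the sum of squares.\<close>

lemma sum_lower_bound:
  fixes \<mu> :: "'i \<Rightarrow> real"
  assumes I: "finite I" "\<And>i. i \<in> I \<Longrightarrow> 0 < \<mu> i" "\<And>i. i \<in> I \<Longrightarrow> \<mu> i \<le> T"
    and c: "0 \<le> c" "c \<le> 1/4" and s: "0 < s" and T: "0 \<le> gap c (T / s)"
  shows "s * (real (card I) * (1 - c) + c * (\<Sum>i\<in>I. (\<mu> i)\<^sup>2) / s\<^sup>2
      + (1 - 2 * c) * ((\<Sum>i\<in>I. ln (\<mu> i)) - real (card I) * ln s)) \<le> (\<Sum>i\<in>I. \<mu> i)"
proof -
  have "s * ((1 - c) + c * (\<mu> i)\<^sup>2 / s\<^sup>2 + (1 - 2 * c) * (ln (\<mu> i) - ln s)) \<le> \<mu> i" if "i \<in> I" for i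
  proof -
    have "0 \<le> gap c (\<mu> i / s)"
      using I(2,3)[OF that] s by (intro gap_nonneg[OF c _ _ T]) (auto simp: divide_right_mono)
    then have "(1 - c) + c * (\<mu> i)\<^sup>2 / s\<^sup>2 + (1 - 2 * c) * (ln (\<mu> i) - ln s) \<le> \<mu> i / s"
      using I(2)[OF that] s by (simp add: gap_def ln_div power_divide algebra_simps)
    from mult_left_mono[OF this, of s] show ?thesis using s by simp
  qed
  from sum_mono[of I, OF this] show ?thesis
    by (simp add: sum_distrib_left[symmetric] sum.distrib sum_subtractf sum_divide_distrib[symmetric]
        right_diff_distrib algebra_simps)
qed

text \<open>The case without a quadratic term. It holds for terms of any size and so can exclude
  large ones before the sharper estimate is applied.\<close>

lemma sum_ge_tangent:
  fixes \<mu> :: "'i \<Rightarrow> real"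
  assumes "finite I" "\<And>i. i \<in> I \<Longrightarrow> 0 < \<mu> i" and s: "0 < s"
  shows "s * (real (card I) * (1 - ln s) + (\<Sum>i\<in>I. ln (\<mu> i))) \<le> (\<Sum>i\<in>I. \<mu> i)"
proof -
  have "s * ((1 - ln s) + ln (\<mu> i)) \<le> \<mu> i" if "i \<in> I" for i
  proof -
    have "ln (\<mu> i / s) \<le> \<mu> i / s - 1" using assms(2)[OF that] s by (intro ln_le_minus_one) simp
    then have "(1 - ln s) + ln (\<mu> i) \<le> \<mu> i / s" using assms(2)[OF that] s by (simp add: ln_div)
    from mult_left_mono[OF this, of s] show ?thesis using s by simp
  qed
  from sum_mono[of I, OF this] show ?thesis
    by (simp add: sum_distrib_left[symmetric] sum.distrib)
qed

lemma id_minus_ln_mono: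
  fixes s x y :: real
  assumes "0 < s" "s \<le> x" "x \<le> y"
  shows "x - s * ln x \<le> y - s * ln y"
proof -
  have "ln y - ln x \<le> (y - x) / x" 
    using assms ln_diff_le[of y x] by simp
  then have "s * (ln y - ln x) \<le> s * ((y - x) / x)" using assms by (intro mult_left_mono) auto
  also have "\<dots> \<le> y - x"
  proof -
    have "s * (y - x) \<le> x * (y - x)" using assms by (intro mult_right_mono) auto
    then show ?thesis using assms by (simp add: divide_le_eq mult.commute)
  qed
  finally show ?thesis by (simp add: algebra_simps)
qed

text \<open>The sign of the derivative of \<open>G\<close> is that of the concave quadratic
  \<open>q\<close>. The hypothesis \<open>shape\<close> says that \<open>q\<close> is nonnegative at
  \<open>l\<close>, or that its vertex lies at or before \<open>l\<close>; either way
  \<open>q\<close> cannot pass from negative to positive on the interval, so \<open>G\<close> never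
  falls and then rises.\<close>

lemma quasi_concave_endpoints:
  fixes b \<delta> :: real
  assumes lx: "0 < l" "l \<le> x" "x \<le> u" and b: "0 \<le> b"
    and shape: "0 \<le> l - 2 * b * l\<^sup>2 - \<delta> \<or> 1 \<le> 4 * b * l"
  defines "G \<equiv> \<lambda>t. t - b * t\<^sup>2 - \<delta> * ln t"
  shows "G l \<le> G x \<or> G u \<le> G x"
proof -
  define q where "q t = t - 2 * b * t\<^sup>2 - \<delta>" for t
  have der: "(G has_real_derivative q t / t) (at t)" if "0 < t" for t
    unfolding G_def q_def using that
    by (auto intro!: derivative_eq_intros simp: field_simps power2_eq_square)
  have chord: "q z = q y + (z - y) * (1 - 2 * b * (y + z))" for y z
    unfolding q_def by (simp add: algebra_simps power2_eq_square)
  show ?thesis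
  proof (cases "0 \<le> q x \<and> 0 \<le> q l")
    case True
    have "G l \<le> G x"
    proof (rule DERIV_nonneg_imp_nondecreasing[OF lx(2), of G])
      fix t assume t: "l \<le> t" "t \<le> x"
      have "0 \<le> q t"
      proof (cases "0 \<le> 1 - 2 * b * (l + t)")
        case True
        then have "0 \<le> (t - l) * (1 - 2 * b * (l + t))" using t by simp
        then show ?thesis using chord[of t l] \<open>0 \<le> q x \<and> 0 \<le> q l\<close> by linarith
      next
        case False
        moreover have "2 * b * (l + t) \<le> 2 * b * (t + x)" using b t lx by (intro mult_left_mono) auto
        ultimately have "(x - t) * (1 - 2 * b * (t + x)) \<le> 0" using t by (intro mult_nonneg_nonpos) auto
        then show ?thesis using chord[of x t] \<open>0 \<le> q x \<and> 0 \<le> q l\<close> by linarith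
      qed
      then show "\<exists>y. (G has_real_derivative y) (at t) \<and> 0 \<le> y"
        using der[of t] t lx by (intro exI[of _ "q t / t"]) (auto intro!: divide_nonneg_pos)
    qed
    then show ?thesis by simp
  next
    case False
    have neg: "q t \<le> q x \<and> q x \<le> 0 \<or> q t \<le> q l \<and> q l \<le> 0" if t: "x \<le> t" for t
    proof (cases "0 \<le> q l")
      case True
      then have "q x < 0" using False by simp
      then have "(x - l) * (1 - 2 * b * (l + x)) < 0" using chord[of x l] True by linarith
      then have "1 - 2 * b * (l + x) < 0" using lx(2) by (simp add: mult_less_0_iff)
      moreover have "2 * b * (l + x) \<le> 2 * b * (x + t)" using b t lx by (intro mult_left_mono) auto
      ultimately have "(t - x) * (1 - 2 * b * (x + t)) \<le> 0" using t by (intro mult_nonneg_nonpos) auto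
      then show ?thesis using chord[of t x] \<open>q x < 0\<close> by linarith
    next
      case False
      then have "1 \<le> 4 * b * l" using shape unfolding q_def by auto
      moreover have "2 * b * (l + l) \<le> 2 * b * (l + t)" using b t lx by (intro mult_left_mono) auto
      ultimately have "(t - l) * (1 - 2 * b * (l + t)) \<le> 0" using t lx by (intro mult_nonneg_nonpos) auto
      then show ?thesis using chord[of t l] False by linarith
    qed
    have "G u \<le> G x"
    proof (rule DERIV_nonpos_imp_nonincreasing[OF lx(3), of G])
      fix t assume t: "x \<le> t" "t \<le> u"
      then show "\<exists>y. (G has_real_derivative y) (at t) \<and> y \<le> 0"
        using der[of t] neg[of t] t lx by (intro exI[of _ "q t / t"]) (auto intro!: divide_nonpos_pos)
    qed
    then show ?thesis by simp
  qed
qed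


section \<open>Rational certificates for ranges of the edge number and the largest
  eigenvalue\<close>

lemma affine_nonneg_between:
  fixes \<alpha> \<beta> m :: real
  assumes "m1 \<le> m" "m \<le> m2" "0 \<le> \<alpha> * m1 + \<beta>" "0 \<le> \<alpha> * m2 + \<beta>"
  shows "0 \<le> \<alpha> * m + \<beta>"
proof (cases "0 \<le> \<alpha>")
  case True
  then have "\<alpha> * m1 \<le> \<alpha> * m" using assms(1) by (rule mult_left_mono[rotated])
  then show ?thesis using assms(3) by linarith
next
  case False
  then have "\<alpha> * m2 \<le> \<alpha> * m" using assms(2) by (intro mult_left_mono_neg) auto
  then show ?thesis using assms(4) by linarith
qed

text \<open>The surplus of the energy estimate over the target if the largest eigenvalue is
  \<open>x\<close>, where \<open>K\<close>, \<open>L\<close> and \<open>Ls\<close> stand for upper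
  bounds of the logarithms of \<open>1 / D\<close>, \<open>x\<close> and \<open>s\<close>. It is
  affine in \<open>m\<close>.\<close>

definition certificate_value ::
    "real \<Rightarrow> real \<Rightarrow> real \<Rightarrow> real \<Rightarrow> real \<Rightarrow> real \<Rightarrow> real \<Rightarrow> real \<Rightarrow> real" where
  "certificate_value n s c K Ls m x L =
     x + s * (n - 1) * (1 - c) + c * (2 * m - x\<^sup>2) / s + s * (1 - 2 * c) * (- K - L - (n - 1) * Ls)
     - (n - 1 + 2 * m / n)"

text \<open>The numbers \<open>L\<^sub>l, L\<^sub>u, \<dots>\<close> are upper bounds of the logarithms of \<open>l, u, s, T / s, T, s\<^sub>0\<close> and
  \<open>1 / D\<close>. The last disjunction bounds all eigenvalues but the first by \<open>T\<close>: an eigenvalue above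
  \<open>T\<close> would already make the sum large, by the tangent bound at \<open>s\<^sub>0\<close>.\<close>

definition certificate ::
    "real \<Rightarrow> real \<Rightarrow> real \<Rightarrow> real \<Rightarrow> real \<times> real \<Rightarrow> real \<times> real \<Rightarrow> real \<times> real \<Rightarrow> real \<Rightarrow> real \<times> real \<Rightarrow>
     real \<times> real \<Rightarrow> real \<times> real \<Rightarrow> bool" where
  "certificate n K m1 m2 = (\<lambda>(l, Ll) (u, Lu) (s, Ls) c (T, LT) (s0, Ls0) (Lt, D).
     0 < s0 \<and> s0 \<le> l \<and> s0 \<le> T \<and> 0 < s \<and> 0 \<le> c \<and> c \<le> 1/4 \<and>
     l \<le> expl Ll \<and> u \<le> expl Lu \<and> s \<le> expl Ls \<and> T / s \<le> expl Lt \<and> T \<le> expl LT \<and>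
     s0 \<le> expl Ls0 \<and> 0 < D \<and> 1 / D \<le> expl K \<and>
     (1 - 2 * c) * Lt \<le> T / s - 1 - c * ((T / s)\<^sup>2 - 1) \<and>
     (0 \<le> l - 2 * (c / s) * l\<^sup>2 - s * (1 - 2 * c) \<or> 1 \<le> 4 * (c / s) * l) \<and>
     (u \<le> T \<or> n - 1 + 2 * m2 / n - s0 * ((n - 2) * (1 - Ls0) - K) \<le> T - s0 * LT + l - s0 * Ll) \<and>
     0 \<le> certificate_value n s c K Ls m1 l Ll \<and> 0 \<le> certificate_value n s c K Ls m2 l Ll \<and>
     0 \<le> certificate_value n s c K Ls m1 u Lu \<and> 0 \<le> certificate_value n s c K Ls m2 u Lu)"

text \<open>Once all other eigenvalues are known to be at most \<open>T\<close>, the estimate with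
  the quadratic term applies. Being affine in \<open>m\<close> and smallest at an end of the range
  of \<open>lam\<close>, it needs checking at four corners only.\<close>

lemma certificate_sound:
  fixes n m m1 m2 lam l u s c T s0 D K Ll Lu Ls Lt LT Ls0 :: real and \<mu> :: "'i \<Rightarrow> real"
  assumes I: "finite I" "real (card I) = n - 1" "0 < n" "\<And>i. i \<in> I \<Longrightarrow> 0 < \<mu> i" "\<And>i. i \<in> I \<Longrightarrow> \<mu> i \<le> lam"
    and lam: "l \<le> lam" "lam \<le> u"
    and sq: "lam\<^sup>2 + (\<Sum>i\<in>I. (\<mu> i)\<^sup>2) = 2 * m" and prod: "D \<le> lam * (\<Prod>i\<in>I. \<mu> i)"
    and m: "m1 \<le> m" "m \<le> m2"
    and cert: "certificate n K m1 m2 (l, Ll) (u, Lu) (s, Ls) c (T, LT) (s0, Ls0) (Lt, D)"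
  shows "n - 1 + 2 * m / n \<le> lam + (\<Sum>i\<in>I. \<mu> i)"
proof (rule ccontr)
  assume small: "\<not> ?thesis"
  have s0: "0 < s0" "s0 \<le> l" "s0 \<le> T" and s: "0 < s" and c: "0 \<le> c" "c \<le> 1/4"
    and L: "l \<le> expl Ll" "u \<le> expl Lu" "s \<le> expl Ls" "T / s \<le> expl Lt" "T \<le> expl LT" "s0 \<le> expl Ls0"
    and D: "0 < D" "1 / D \<le> expl K"
    and gapT: "(1 - 2 * c) * Lt \<le> T / s - 1 - c * ((T / s)\<^sup>2 - 1)"
    and shape: "0 \<le> l - 2 * (c / s) * l\<^sup>2 - s * (1 - 2 * c) \<or> 1 \<le> 4 * (c / s) * l"
    and Tbound: "u \<le> T \<or> n - 1 + 2 * m2 / n - s0 * ((n - 2) * (1 - Ls0) - K) \<le> T - s0 * LT + l - s0 * Ll"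
    and vals: "0 \<le> certificate_value n s c K Ls m1 l Ll" "0 \<le> certificate_value n s c K Ls m2 l Ll"
      "0 \<le> certificate_value n s c K Ls m1 u Lu" "0 \<le> certificate_value n s c K Ls m2 u Lu"
    using cert unfolding certificate_def by auto
  have pos: "0 < l" "0 < T" "0 < lam" "0 < u" using s0 lam by auto
  have Lbounds: "ln l \<le> Ll" "ln u \<le> Lu" "ln s \<le> Ls" "ln (T / s) \<le> Lt" "ln T \<le> LT" "ln s0 \<le> Ls0"
    using L pos s s0(1) by (auto intro: ln_le_expl)
  have "ln (1 / D) \<le> K" using D by (intro ln_le_expl) auto
  then have lnD: "- K \<le> ln D" using D(1) by (simp add: ln_div)
  have Ppos: "0 < (\<Prod>i\<in>I. \<mu> i)" using I by (intro prod_pos) auto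
  have "ln D \<le> ln (lam * (\<Prod>i\<in>I. \<mu> i))" using prod D pos Ppos by (subst ln_le_cancel_iff) auto
  also have "\<dots> = ln lam + (\<Sum>i\<in>I. ln (\<mu> i))"
    using pos Ppos ln_prod[OF I(1), of \<mu>] I(4) by (simp add: ln_mult less_imp_neq[symmetric])
  finally have lnsum: "- K - ln lam \<le> (\<Sum>i\<in>I. ln (\<mu> i))" using lnD by linarith
  \<comment> \<open>If \<open>\<mu> i\<close> exceeds \<open>T\<close>, the tangent estimate is
    applied to the other \<open>n - 2\<close> terms. Since \<open>t - s0 * ln t\<close> increases
    beyond \<open>s0\<close>, it may be evaluated at \<open>T\<close> and \<open>l\<close> in place
    of \<open>\<mu> i\<close> and \<open>lam\<close>, which already reaches the target.\<close>
  have \<mu>T: "\<mu> i \<le> T" if i: "i \<in> I" for i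
  proof (rule ccontr)
    assume "\<not> \<mu> i \<le> T"
    then have big: "T \<le> \<mu> i" by simp
    then have "\<not> u \<le> T \<or> \<mu> i \<le> T" using I(5)[OF i] lam(2) by linarith
    then have Tb: "n - 1 + 2 * m2 / n - s0 * ((n - 2) * (1 - Ls0) - K) \<le> T - s0 * LT + l - s0 * Ll"
      using Tbound \<open>\<not> \<mu> i \<le> T\<close> by blast
    have "s0 * (real (card (I - {i})) * (1 - ln s0) + (\<Sum>i\<in>I - {i}. ln (\<mu> i))) \<le> (\<Sum>i\<in>I - {i}. \<mu> i)"
      using I s0 by (intro sum_ge_tangent) auto
    moreover have card: "real (card (I - {i})) = n - 2" 
    proof -
      have "card I = Suc (card (I - {i}))" using I(1) i by (rule card.remove)
      then show ?thesis using I(2) by simp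
    qed
    moreover have "(\<Sum>i\<in>I. ln (\<mu> i)) = ln (\<mu> i) + (\<Sum>i\<in>I - {i}. ln (\<mu> i))"
      "(\<Sum>i\<in>I. \<mu> i) = \<mu> i + (\<Sum>i\<in>I - {i}. \<mu> i)"
      using I(1) i by (auto intro: sum.remove)
    ultimately have *: "\<mu> i + s0 * ((n - 2) * (1 - ln s0) + ((\<Sum>i\<in>I. ln (\<mu> i)) - ln (\<mu> i))) \<le> (\<Sum>i\<in>I. \<mu> i)"
      by simp
    have "(n - 2) * (1 - Ls0) + (- K - ln lam - ln (\<mu> i))
        \<le> (n - 2) * (1 - ln s0) + ((\<Sum>i\<in>I. ln (\<mu> i)) - ln (\<mu> i))"
    proof -
      have "0 \<le> n - 2" using card of_nat_0_le_iff[of "card (I - {i})"] by linarith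
      then have "(n - 2) * (1 - Ls0) \<le> (n - 2) * (1 - ln s0)" using Lbounds(6) by (intro mult_left_mono) auto
      then show ?thesis using lnsum by linarith
    qed
    then have "s0 * ((n - 2) * (1 - Ls0) + (- K - ln lam - ln (\<mu> i)))
        \<le> s0 * ((n - 2) * (1 - ln s0) + ((\<Sum>i\<in>I. ln (\<mu> i)) - ln (\<mu> i)))"
      using s0 by (intro mult_left_mono) auto
    then have "(\<mu> i - s0 * ln (\<mu> i)) + (lam - s0 * ln lam) + s0 * ((n - 2) * (1 - Ls0) - K) \<le> lam + (\<Sum>i\<in>I. \<mu> i)"
      using * by (simp add: algebra_simps)
    moreover have "T - s0 * ln T \<le> \<mu> i - s0 * ln (\<mu> i)" using s0 big by (intro id_minus_ln_mono)
    moreover have "l - s0 * ln l \<le> lam - s0 * ln lam" using s0 lam by (intro id_minus_ln_mono)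
    moreover have "s0 * ln T \<le> s0 * LT" "s0 * ln l \<le> s0 * Ll" using s0 Lbounds by (auto intro: mult_left_mono)
    moreover have "2 * m / n \<le> 2 * m2 / n" using m I(3) by (simp add: divide_right_mono)
    ultimately show False using small Tb by linarith
  qed
  define b \<delta> where "b = c / s" and "\<delta> = s * (1 - 2 * c)"
  have "0 \<le> gap c (T / s)"
  proof -
    have "(1 - 2 * c) * ln (T / s) \<le> (1 - 2 * c) * Lt" using c Lbounds(4) by (intro mult_left_mono) auto
    then show ?thesis using gapT unfolding gap_def by linarith
  qed
  from sum_lower_bound[OF I(1,4) \<mu>T c s this]
  have "s * ((n - 1) * (1 - c) + c * (2 * m - lam\<^sup>2) / s\<^sup>2
      + (1 - 2 * c) * ((\<Sum>i\<in>I. ln (\<mu> i)) - (n - 1) * ln s)) \<le> (\<Sum>i\<in>I. \<mu> i)"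
    using sq I(2) by (simp add: eq_diff_eq[symmetric] add.commute)
  moreover have "s * ((n - 1) * (1 - c) + c * (2 * m - lam\<^sup>2) / s\<^sup>2
      + (1 - 2 * c) * ((\<Sum>i\<in>I. ln (\<mu> i)) - (n - 1) * ln s))
      = s * (n - 1) * (1 - c) + b * (2 * m - lam\<^sup>2) + \<delta> * ((\<Sum>i\<in>I. ln (\<mu> i)) - (n - 1) * ln s)"
    using s by (simp add: b_def \<delta>_def field_simps power2_eq_square)
  moreover have "\<delta> * (- K - ln lam - (n - 1) * Ls) \<le> \<delta> * ((\<Sum>i\<in>I. ln (\<mu> i)) - (n - 1) * ln s)"
  proof (rule mult_left_mono)
    have "(n - 1) * ln s \<le> (n - 1) * Ls" using Lbounds(3) I(2) by (metis mult_left_mono of_nat_0_le_iff)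
    then show "- K - ln lam - (n - 1) * Ls \<le> (\<Sum>i\<in>I. ln (\<mu> i)) - (n - 1) * ln s" using lnsum by linarith
    show "0 \<le> \<delta>" using s c by (simp add: \<delta>_def)
  qed
  ultimately have lower: "lam - b * lam\<^sup>2 - \<delta> * ln lam + (s * (n - 1) * (1 - c) + 2 * b * m + \<delta> * (- K - (n - 1) * Ls))
      \<le> lam + (\<Sum>i\<in>I. \<mu> i)"
    by (simp add: algebra_simps)
  have final: False if x: "0 < x" "ln x \<le> L" "x - b * x\<^sup>2 - \<delta> * ln x \<le> lam - b * lam\<^sup>2 - \<delta> * ln lam"
    and v: "0 \<le> certificate_value n s c K Ls m1 x L" "0 \<le> certificate_value n s c K Ls m2 x L" for x L
  proof -
    \<comment> \<open>The target contains \<open>2 * m / n\<close>, so its slope in \<open>m\<close>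
      is subtracted from that of the estimate.\<close>
    define \<alpha> \<beta> where "\<alpha> = 2 * b - 2 / n"
      and "\<beta> = x - b * x\<^sup>2 - \<delta> * L + s * (n - 1) * (1 - c) + \<delta> * (- K - (n - 1) * Ls) - (n - 1)"
    have cv: "certificate_value n s c K Ls m x L = \<alpha> * m + \<beta>" for m
      unfolding certificate_value_def \<alpha>_def \<beta>_def b_def \<delta>_def
      by (simp add: algebra_simps diff_divide_distrib add_divide_distrib)
    have "0 \<le> \<alpha> * m + \<beta>" using affine_nonneg_between[OF m] v unfolding cv by blast
    moreover have "\<delta> * ln x \<le> \<delta> * L" using x(2) s c by (intro mult_left_mono) (auto simp: \<delta>_def)
    ultimately show False using lower small x(3) unfolding \<alpha>_def \<beta>_def by (simp add: algebra_simps)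
  qed
  have "l - b * l\<^sup>2 - \<delta> * ln l \<le> lam - b * lam\<^sup>2 - \<delta> * ln lam \<or> u - b * u\<^sup>2 - \<delta> * ln u \<le> lam - b * lam\<^sup>2 - \<delta> * ln lam"
    using quasi_concave_endpoints[OF pos(1) lam, of b \<delta>] shape s c by (auto simp: b_def \<delta>_def)
  then show False using final[OF pos(1) Lbounds(1)] final[OF pos(4) Lbounds(2)] vals by blast
qed

section \<open>Edge bounds for graphs without \<open>K\<^bsub>3,3\<^esub>\<close>\<close>

definition K33_free :: "('n \<Rightarrow> 'n \<Rightarrow> bool) \<Rightarrow> bool" where
  "K33_free E \<longleftrightarrow> (\<forall>A B. card A = 3 \<longrightarrow> card B = 3 \<longrightarrow> A \<inter> B = {} \<longrightarrow> (\<exists>a\<in>A. \<exists>b\<in>B. \<not> E a b))"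

text \<open>The subgraph keeps the vertex type and isolates the vertices outside \<open>S\<close>,
  so deleting vertices needs no new type.\<close>

definition induced :: "('n \<Rightarrow> 'n \<Rightarrow> bool) \<Rightarrow> 'n set \<Rightarrow> 'n \<Rightarrow> 'n \<Rightarrow> bool" where
  "induced E S u v \<longleftrightarrow> E u v \<and> u \<in> S \<and> v \<in> S"

definition edge_count :: "('n::finite \<Rightarrow> 'n \<Rightarrow> bool) \<Rightarrow> 'n set \<Rightarrow> nat" where
  "edge_count E S = card (edges (induced E S))"

lemma simple_graph_induced: "simple_graph E \<Longrightarrow> simple_graph (induced E S)"
  by (auto simp: simple_graph_def induced_def)

lemma edge_count_UNIV: "edge_count E UNIV = card (edges E)"
  by (simp add: edge_count_def induced_def[abs_def])

lemma sum_deg_induced: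
  assumes "simple_graph E"
  shows "(\<Sum>v\<in>S. deg (induced E S) v) = 2 * edge_count E S"
proof -
  have "(\<Sum>v\<in>S. deg (induced E S) v) = (\<Sum>v\<in>UNIV. deg (induced E S) v)"
    by (rule sum.mono_neutral_left) (auto simp: deg_def induced_def)
  then show ?thesis
    using handshake[OF simple_graph_induced[OF assms]] by (simp add: edge_count_def)
qed

lemma edge_count_remove:
  assumes E: "simple_graph E" and v: "v \<in> S"
  shows "edge_count E S = edge_count E (S - {v}) + deg (induced E S) v"
proof -
  have sym: "E a b \<Longrightarrow> E b a" and irr: "\<not> E a a" for a b
    using E by (auto simp: simple_graph_def)
  have "edges (induced E S) = edges (induced E (S - {v})) \<union> (\<lambda>u. {v, u}) ` {u. induced E S v u}"
  proof (intro equalityI subsetI)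
    fix e assume "e \<in> edges (induced E S)"
    then obtain x y where e: "e = {x, y}" "E x y" "x \<in> S" "y \<in> S"
      unfolding edges_def induced_def by blast
    consider "x = v" | "y = v" | "x \<noteq> v" "y \<noteq> v" by blast
    then show "e \<in> edges (induced E (S - {v})) \<union> (\<lambda>u. {v, u}) ` {u. induced E S v u}"
    proof cases
      case 2
      then have "e = {v, x}" "induced E S v x" using e sym by (auto simp: induced_def)
      then show ?thesis by blast
    qed (use e in \<open>auto simp: edges_def induced_def\<close>)
  next
    fix e assume "e \<in> edges (induced E (S - {v})) \<union> (\<lambda>u. {v, u}) ` {u. induced E S v u}"
    then show "e \<in> edges (induced E S)" unfolding edges_def induced_def by blast
  qed
  moreover have "v \<notin> e" if "e \<in> edges (induced E (S - {v}))" for e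
    using that unfolding edges_def induced_def by blast
  then have "edges (induced E (S - {v})) \<inter> (\<lambda>u. {v, u}) ` {u. induced E S v u} = {}" by blast
  moreover have "inj_on (\<lambda>u. {v, u}) {u. induced E S v u}"
    by (auto simp: inj_on_def doubleton_eq_iff)
  ultimately show ?thesis unfolding edge_count_def deg_def
    by (simp add: card_Un_disjoint card_image)
qed

lemma real_choose_3: "real (d choose 3) = real d * (real d - 1) * (real d - 2) / 6"
proof (induction d)
  case (Suc d)
  have "real (d choose 2) = real d * (real d - 1) / 2"
    by (induction d) (auto simp: numeral_2_eq_2 field_simps)
  with Suc show ?case by (simp add: numeral_3_eq_3 numeral_2_eq_2 field_simps)
qed simp

text \<open>Double counting as in the Kovari-Sos-Turan theorem: pairs of a vertex and a triple in
  its neighbourhood. A triple has at most two common neighbours.\<close>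

lemma K33_free_count:
  fixes E :: "'n::finite \<Rightarrow> 'n \<Rightarrow> bool"
  assumes "K33_free E" "simple_graph E"
  shows "(\<Sum>v\<in>S. deg (induced E S) v choose 3) \<le> 2 * (card S choose 3)"
proof -
  define \<T> where "\<T> = {T. T \<subseteq> S \<and> card T = 3}"
  have fin: "finite \<T>" by simp
  have "deg (induced E S) v choose 3 = card {T \<in> \<T>. \<forall>t\<in>T. E v t}" if "v \<in> S" for v
  proof -
    have "{T \<in> \<T>. \<forall>t\<in>T. E v t} = {T. T \<subseteq> {u. induced E S v u} \<and> card T = 3}"
      using that by (auto simp: \<T>_def induced_def)
    then show ?thesis by (simp add: n_subsets deg_def)
  qed
  then have "(\<Sum>v\<in>S. deg (induced E S) v choose 3) = (\<Sum>v\<in>S. card {T \<in> \<T>. \<forall>t\<in>T. E v t})" by simp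
  also have "\<dots> = (\<Sum>v\<in>S. \<Sum>T\<in>\<T>. if \<forall>t\<in>T. E v t then 1 else 0)"
    using fin by (simp add: sum.If_cases Int_def)
  also have "\<dots> = (\<Sum>T\<in>\<T>. \<Sum>v\<in>S. if \<forall>t\<in>T. E v t then 1 else 0)" by (rule sum.swap)
  also have "\<dots> = (\<Sum>T\<in>\<T>. card {v \<in> S. \<forall>t\<in>T. E v t})"
    by (simp add: sum.If_cases Int_def)
  also have "\<dots> \<le> (\<Sum>T\<in>\<T>. 2)"
  proof (rule sum_mono)
    fix T assume T: "T \<in> \<T>"
    show "card {v \<in> S. \<forall>t\<in>T. E v t} \<le> 2"
    proof (rule ccontr)
      assume "\<not> ?thesis"
      then have "3 \<le> card {v \<in> S. \<forall>t\<in>T. E v t}" by simp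
      then obtain A where A: "A \<subseteq> {v \<in> S. \<forall>t\<in>T. E v t}" "card A = 3"
        by (meson obtain_subset_with_card_n)
      have "A \<inter> T = {}" using A(1) assms(2) unfolding simple_graph_def by blast
      then obtain a b where "a \<in> A" "b \<in> T" "\<not> E a b"
        using assms(1) A(2) T unfolding K33_free_def \<T>_def by blast
      then show False using A(1) by blast
    qed
  qed
  also have "\<dots> = 2 * (card S choose 3)" by (simp add: \<T>_def n_subsets)
  finally show ?thesis .
qed

text \<open>Turns the count into a bound on the average degree. Since
  \<open>x * (x - 1) * (x - 2)\<close> is not convex near 0, the tangent line at
  \<open>t \<ge> 2\<close> takes the place of Jensen's inequality.\<close>

lemma K33_free_edge_bound:
  fixes E :: "'n::finite \<Rightarrow> 'n \<Rightarrow> bool"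
  assumes E: "K33_free E" "simple_graph E" and t: "2 \<le> t" "real (card S) * t \<le> 2 * real (edge_count E S)"
    and S: "S \<noteq> {}"
  shows "t * (t - 1) * (t - 2) \<le> 2 * (real (card S) - 1) * (real (card S) - 2)"
proof -
  define k where "k = real (card S)"
  define f where "f x = x * (x - 1) * (x - 2)" for x :: real
  define d where "d v = real (deg (induced E S) v)" for v
  have k: "k > 0" using S by (simp add: k_def card_gt_0_iff)
  have sd: "(\<Sum>v\<in>S. d v) = 2 * real (edge_count E S)"
    using arg_cong[OF sum_deg_induced[OF E(2), of S], of real] by (simp add: d_def)
  have tangent: "f t + (3 * t\<^sup>2 - 6 * t + 2) * (x - t) \<le> f x" if "0 \<le> x" for x
  proof -
    have "f x - (f t + (3 * t\<^sup>2 - 6 * t + 2) * (x - t)) = (x - t)\<^sup>2 * (x + 2 * t - 3)"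
      unfolding f_def by (simp add: algebra_simps power2_eq_square)
    moreover have "0 \<le> (x - t)\<^sup>2 * (x + 2 * t - 3)" using that t(1) by (intro mult_nonneg_nonneg) auto
    ultimately show ?thesis by linarith
  qed
  have "0 \<le> (3 * t\<^sup>2 - 6 * t + 2) * (2 * real (edge_count E S) - k * t)"
  proof (rule mult_nonneg_nonneg)
    have "0 \<le> 3 * t * (t - 2)" using t(1) by simp
    then show "0 \<le> 3 * t\<^sup>2 - 6 * t + 2" by (simp add: algebra_simps power2_eq_square)
  qed (use t(2) k_def in simp)
  then have "k * f t \<le> (\<Sum>v\<in>S. f t + (3 * t\<^sup>2 - 6 * t + 2) * (d v - t))"
    by (simp add: sum.distrib sum_distrib_left[symmetric] sum_subtractf sd k_def)
  also have "\<dots> \<le> (\<Sum>v\<in>S. f (d v))" by (intro sum_mono tangent) (simp add: d_def)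
  also have "\<dots> = 6 * real (\<Sum>v\<in>S. deg (induced E S) v choose 3)"
    by (simp add: real_choose_3 f_def d_def sum_distrib_left)
  also have "\<dots> \<le> 6 * real (2 * (card S choose 3))"
    using K33_free_count[OF E, of S] by linarith
  also have "\<dots> = k * (2 * (k - 1) * (k - 2))" by (simp add: real_choose_3 k_def)
  finally show ?thesis using k by (simp add: f_def k_def)
qed

lemma edges_induced_subset:
  assumes "simple_graph E"
  shows "edges (induced E S) \<subseteq> {T. T \<subseteq> S \<and> card T = 2}"
proof
  fix e assume "e \<in> edges (induced E S)"
  then obtain u v where e: "e = {u, v}" "E u v" "u \<in> S" "v \<in> S"
    unfolding edges_def induced_def by blast
  moreover have "u \<noteq> v" using e(2) assms unfolding simple_graph_def by blast
  ultimately show "e \<in> {T. T \<subseteq> S \<and> card T = 2}" by simp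
qed

lemma edge_count_le_choose:
  fixes E :: "'n::finite \<Rightarrow> 'n \<Rightarrow> bool"
  assumes "simple_graph E"
  shows "edge_count E S \<le> card S choose 2"
proof -
  have "card (edges (induced E S)) \<le> card {T. T \<subseteq> S \<and> card T = 2}"
    using edges_induced_subset[OF assms] by (intro card_mono) auto
  then show ?thesis by (simp add: edge_count_def n_subsets)
qed

text \<open>A graph on six vertices with two missing edges contains a \<open>K\<^bsub>3,3\<^esub>\<close>: split the vertices
  so that each missing edge stays within one half.\<close>

lemma K33_free_edges_6:
  fixes E :: "'n::finite \<Rightarrow> 'n \<Rightarrow> bool"
  assumes E: "K33_free E" "simple_graph E" and S: "card S = 6"
  shows "edge_count E S \<le> 12"
proof (rule ccontr)
  assume "\<not> ?thesis"
  then consider "14 \<le> edge_count E S" | "edge_count E S = 13" by linarith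
  then show False
  proof cases
    case 1
    \<comment> \<open>14 edges force average degree 14/3, and \<open>14/3 * 11/3 * 8/3\<close>
      exceeds 40. At 13 edges the count is not decisive, whence the structural argument in the other
      case.\<close>
    then have "(14/3 :: real) * (14/3 - 1) * (14/3 - 2) \<le> 2 * (real (card S) - 1) * (real (card S) - 2)"
      using S by (intro K33_free_edge_bound[OF E]) auto
    then show False using S by simp
  next
    case 2
    define X where "X = {T. T \<subseteq> S \<and> card T = 2} - edges (induced E S)"
    note sub = edges_induced_subset[OF E(2), of S]
    have "card {T. T \<subseteq> S \<and> card T = 2} = 15" using S by (simp add: n_subsets choose_two)
    then have "card X = 2" unfolding X_def using 2 sub
      by (subst card_Diff_subset) (auto simp: edge_count_def)
    then obtain p q where X: "X = {p, q}" "p \<noteq> q" by (auto simp: card_2_iff)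
    have pq: "p \<subseteq> S" "card p = 2" "q \<subseteq> S" "card q = 2" using X unfolding X_def by auto
    have fin: "finite p" "finite q" "finite S" by auto
    obtain A where A: "A \<subseteq> S" "card A = 3" "p \<subseteq> A \<or> p \<inter> A = {}" "q \<subseteq> A \<or> q \<inter> A = {}"
    proof (cases "p \<inter> q = {}")
      case True
      have "card (S - (p \<union> q)) = 2" using True pq S by (simp add: card_Diff_subset card_Un_disjoint)
      then obtain x where x: "x \<in> S - (p \<union> q)" by (metis card.empty ex_in_conv zero_neq_numeral)
      then have "card (insert x p) = 3" using pq by (auto simp: card_insert_if)
      then show thesis using that[of "insert x p"] x pq True by auto
    next
      case False
      then have "card (p \<inter> q) \<ge> 1" by (simp add: Suc_leI card_gt_0_iff)
      moreover have "card (p \<inter> q) \<noteq> 2"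
      proof
        assume "card (p \<inter> q) = 2"
        then have "p \<inter> q = p" using pq card_subset_eq[of p "p \<inter> q"] by simp
        moreover have "p \<inter> q = q" using pq \<open>card (p \<inter> q) = 2\<close> by (intro card_subset_eq) auto
        ultimately show False using X(2) by blast
      qed
      moreover have "card (p \<inter> q) \<le> 2" using pq card_mono[of p "p \<inter> q"] by simp
      ultimately have "card (p \<inter> q) = 1" by linarith
      moreover have "card p + card q = card (p \<union> q) + card (p \<inter> q)" by (rule card_Un_Int) auto
      ultimately have "card (p \<union> q) = 3" using pq by simp
      then show thesis using that[of "p \<union> q"] pq by auto
    qed
    have "card (S - A) = 3" using A S by (simp add: card_Diff_subset)
    then obtain a b where ab: "a \<in> A" "b \<in> S - A" "\<not> E a b"
      using E(1) A(2) unfolding K33_free_def by (metis Diff_disjoint)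
    have "{a, b} \<notin> edges (induced E S)"
    proof
      assume "{a, b} \<in> edges (induced E S)"
      then have "E a b \<or> E b a" unfolding edges_def induced_def by (auto simp: doubleton_eq_iff)
      then show False using ab(3) E(2) unfolding simple_graph_def by blast
    qed
    moreover have "a \<noteq> b" using ab by blast
    ultimately have "{a, b} \<in> X" unfolding X_def using A(1) ab by auto
    then show False using X(1) A(3,4) ab by auto
  qed
qed

text \<open>Averaging over vertex deletions: seven times the edge number is at most
  \<open>7 * 12\<close> plus twice the edge number.\<close>

lemma K33_free_edges_7:
  fixes E :: "'n::finite \<Rightarrow> 'n \<Rightarrow> bool"
  assumes E: "K33_free E" "simple_graph E" and S: "card S = 7"
  shows "edge_count E S \<le> 16"
proof -
  have "edge_count E S \<le> 12 + deg (induced E S) v" if "v \<in> S" for v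
    using K33_free_edges_6[OF E, of "S - {v}"] edge_count_remove[OF E(2) that] that S by simp
  then have "(\<Sum>v\<in>S. edge_count E S) \<le> (\<Sum>v\<in>S. 12 + deg (induced E S) v)" by (rule sum_mono)
  then show ?thesis using S by (simp add: sum.distrib sum_deg_induced[OF E(2)])
qed

text \<open>Here \<open>m\<close> is the first edge number to be excluded and \<open>t\<close> the
  average degree it would force.\<close>

lemma K33_free_edges_less:
  fixes E :: "'n::finite \<Rightarrow> 'n \<Rightarrow> bool"
  assumes E: "K33_free E" "simple_graph E" and S: "card S = k" "0 < k" and t: "t = 2 * real m / real k" "2 \<le> t"
    and m: "2 * (real k - 1) * (real k - 2) < t * (t - 1) * (t - 2)"
  shows "edge_count E S < m"
proof (rule ccontr)
  assume "\<not> ?thesis"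
  then have "real (card S) * t \<le> 2 * real (edge_count E S)" using S t(1) by simp
  moreover have "S \<noteq> {}" using S by auto
  ultimately show False using K33_free_edge_bound[OF E t(2)] S m by fastforce
qed

section \<open>Energy of nonsingular graphs\<close>

lemma det_adj_matrix_expansion:
  fixes E :: "'n::finite \<Rightarrow> 'n \<Rightarrow> bool"
  assumes "simple_graph E"
  obtains c :: "nat \<Rightarrow> int" and z where
    "\<forall>k\<le>CARD('n). c k = c (CARD('n) - k)"
    "det (adj_matrix E) = real_of_int (\<Sum>k\<le>CARD('n). c k)"
    "z\<^sup>2 = (\<Sum>k\<le>CARD('n). c k * (-1) ^ k)"
proof -
  define B :: "int^'n^'n" where "B = (\<chi> i j. if E i j then 1 else 0)"
  have "adj_matrix E = (\<chi> i j. real_of_int (B $ i $ j))"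
    by (simp add: adj_matrix_def B_def vec_eq_iff)
  then have det: "det (adj_matrix E) = real_of_int (det B)" by (simp add: det_of_int)
  have sym: "B $ i $ j = B $ j $ i" for i j
  proof -
    have "E i j = E j i" using assms unfolding simple_graph_def by blast
    then show ?thesis unfolding B_def vec_lambda_beta by (rule arg_cong)
  qed
  have diag: "B $ i $ i = 0" for i
  proof -
    have "\<not> E i i" using assms unfolding simple_graph_def by blast
    then show ?thesis by (simp add: B_def)
  qed
  show thesis
  proof (rule det_symmetric_palindromic[of B, OF sym diag])
    fix c :: "nat \<Rightarrow> int" and z
    assume c: "\<And>k. k \<le> CARD('n) \<Longrightarrow> c k = c (CARD('n) - k)" "det B = (\<Sum>k\<le>CARD('n). c k)"
      "z\<^sup>2 = (\<Sum>k\<le>CARD('n). c k * (-1) ^ k)"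
    have "\<forall>k\<le>CARD('n). c k = c (CARD('n) - k)" using c(1) by blast
    then show thesis by (rule that[OF _ _ c(3)]) (simp only: det c(2))
  qed
qed

lemma abs_det_adj_matrix_ge_1:
  assumes "simple_graph E" "det (adj_matrix E) \<noteq> 0"
  shows "1 \<le> \<bar>det (adj_matrix E)\<bar>"
proof -
  obtain k :: int where "det (adj_matrix E) = real_of_int k"
    by (rule det_adj_matrix_expansion[OF assms(1)])
  then show ?thesis using assms(2) by simp
qed

text \<open>In odd order the palindromic coefficients pair off without a middle term, so their sum
  is even.\<close>

lemma abs_det_adj_matrix_ge_2:
  fixes E :: "'n::finite \<Rightarrow> 'n \<Rightarrow> bool"
  assumes "simple_graph E" "det (adj_matrix E) \<noteq> 0" "odd CARD('n)"
  shows "2 \<le> \<bar>det (adj_matrix E)\<bar>"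
proof -
  obtain c :: "nat \<Rightarrow> int" and z where c: "\<forall>k\<le>CARD('n). c k = c (CARD('n) - k)"
    "det (adj_matrix E) = real_of_int (\<Sum>k\<le>CARD('n). c k)" "z\<^sup>2 = (\<Sum>k\<le>CARD('n). c k * (-1) ^ k)"
    by (rule det_adj_matrix_expansion[OF assms(1)])
  obtain h where h: "CARD('n) = 2 * h + 1" using assms(3) by (auto elim: oddE)
  have "{..CARD('n)} = {..h} \<union> {h+1..2*h+1}" using h by auto
  then have "(\<Sum>k\<le>CARD('n). c k) = (\<Sum>k\<le>h. c k) + (\<Sum>k\<in>{h+1..2*h+1}. c k)"
    by (simp add: sum.union_disjoint)
  also have "(\<Sum>k\<in>{h+1..2*h+1}. c k) = (\<Sum>k\<in>{h+1..2*h+1}. c (2*h+1-k))"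
  proof (rule sum.cong[OF refl])
    fix k assume "k \<in> {h+1..2*h+1}"
    then show "c k = c (2*h+1-k)" using c(1)[rule_format, of k] unfolding h by simp
  qed
  also have "\<dots> = (\<Sum>k\<le>h. c k)"
    by (rule sum.reindex_bij_witness[of _ "\<lambda>k. 2*h+1-k" "\<lambda>k. 2*h+1-k"]) auto
  finally have "det (adj_matrix E) = real_of_int (2 * (\<Sum>k\<le>h. c k))"
    unfolding c(2) by (simp only: of_int_eq_iff)
  moreover have "2 \<le> \<bar>2 * (\<Sum>k\<le>h. c k)\<bar>" if "(\<Sum>k\<le>h. c k) \<noteq> 0" using that by linarith
  ultimately show ?thesis using assms(2) by (metis of_int_0 of_int_abs of_int_le_iff of_int_numeral mult_zero_right)
qed

lemma square_mod_4: "(z::int)\<^sup>2 mod 4 = 0 \<or> z\<^sup>2 mod 4 = 1"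
proof (cases "even z")
  case True
  then show ?thesis by (auto elim!: evenE simp: power2_eq_square)
next
  case False
  then obtain k where "z = 2 * k + 1" by (rule oddE)
  then have "z\<^sup>2 = 4 * (k\<^sup>2 + k) + 1" by (simp add: power2_eq_square algebra_simps)
  then show ?thesis by presburger
qed

text \<open>Adding the values of the palindromic polynomial at 1 and -1 gives
  \<open>d + z\<^sup>2 = 4 * (c 0 + c 2)\<close>, so \<open>d\<close> is minus a square modulo
  4.\<close>

lemma det_adj_matrix_order_6:
  fixes E :: "'n::finite \<Rightarrow> 'n \<Rightarrow> bool"
  assumes "simple_graph E" "det (adj_matrix E) \<noteq> 0" "CARD('n) = 6"
  shows "det (adj_matrix E) = -1 \<or> 3 \<le> \<bar>det (adj_matrix E)\<bar>"
proof -
  obtain c :: "nat \<Rightarrow> int" and z where c: "\<forall>k\<le>6. c k = c (6 - k)"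
    "det (adj_matrix E) = real_of_int (\<Sum>k\<le>6. c k)" "z\<^sup>2 = (\<Sum>k\<le>6. c k * (-1) ^ k)"
    by (rule det_adj_matrix_expansion[OF assms(1), unfolded assms(3)])
  define d where "d = (\<Sum>k\<le>6. c k)"
  have "c 4 = c 2" "c 5 = c 1" "c 6 = c 0" using c(1)[rule_format, of 4] c(1)[rule_format, of 5] c(1)[rule_format, of 6] by auto
  then have "d = 2 * (c 0 + c 1 + c 2) + c 3" "z\<^sup>2 = 2 * (c 0 - c 1 + c 2) - c 3"
    using c(3) by (simp_all add: d_def eval_nat_numeral atMost_Suc)
  then have "d + z\<^sup>2 = 4 * (c 0 + c 2)" by simp
  then have "d = -1 \<or> d = 0 \<or> 3 \<le> \<bar>d\<bar>" using square_mod_4[of z] by presburger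
  moreover have "det (adj_matrix E) = real_of_int d" unfolding c(2) d_def ..
  ultimately show ?thesis using assms(2) by auto
qed

lemma twins_singular:
  assumes "u \<noteq> v" "\<And>w. E u w \<longleftrightarrow> E v w"
  shows "det (adj_matrix E) = 0"
  by (rule det_identical_rows[OF assms(1)]) (simp add: row_def adj_matrix_def assms(2))

lemma deg_pos:
  assumes "det (adj_matrix E) \<noteq> 0"
  shows "1 \<le> real (deg E v)"
proof -
  have "row v (adj_matrix E) \<noteq> 0" using assms det_zero_row by blast
  then have "{u. E v u} \<noteq> {}" by (auto simp: row_def adj_matrix_def vec_eq_iff split: if_splits)
  then show ?thesis by (simp add: deg_def Suc_le_eq card_gt_0_iff)
qed

text \<open>A single nonadjacent pair would be a pair of twins, so at least two pairs are nonadjacent.\<close>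

lemma nonsingular_noncomplete_edges:
  fixes E :: "'n::finite \<Rightarrow> 'n \<Rightarrow> bool"
  assumes simple: "simple_graph E" and det: "det (adj_matrix E) \<noteq> 0" and uv: "u \<noteq> v" "\<not> E u v"
  shows "card (edges E) + 2 \<le> CARD('n) choose 2"
proof -
  have sym: "E a b \<longleftrightarrow> E b a" and irr: "\<not> E a a" for a b
    using simple by (auto simp: simple_graph_def)
  obtain w where w: "E u w \<noteq> E v w" using det twins_singular[OF uv(1)] by blast
  \<comment> \<open>\<open>w\<close> is adjacent to exactly one of \<open>u\<close> and
    \<open>v\<close>; with the other it forms the second nonadjacent pair.\<close>
  define x where "x = (if E u w then v else u)"
  have x: "\<not> E x w" "x \<in> {u, v}" using w by (auto simp: x_def)
  have wuv: "w \<noteq> u" "w \<noteq> v" using w uv sym irr by metis+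
  have sub: "edges E \<subseteq> {T. card T = 2}"
    using edges_induced_subset[OF simple, of UNIV] by (simp add: induced_def[abs_def])
  moreover have "{u, v} \<notin> edges E" "{x, w} \<notin> edges E"
    using uv x(1) sym unfolding edges_def by (auto simp: doubleton_eq_iff)
  moreover have "card {x, w} = 2" "card {u, v} = 2" using x wuv uv by auto
  ultimately have "edges E \<union> {{u, v}, {x, w}} \<subseteq> {T. card T = 2}" by auto
  then have "card (edges E \<union> {{u, v}, {x, w}}) \<le> card {T::'n set. card T = 2}" by (intro card_mono) auto
  moreover have "{u, v} \<noteq> {x, w}" using wuv by (auto simp: doubleton_eq_iff)
  moreover have "card (edges E \<union> {{u, v}, {x, w}}) = card (edges E) + card {{u, v}, {x, w}}"
    using \<open>{u, v} \<notin> edges E\<close> \<open>{x, w} \<notin> edges E\<close> by (intro card_Un_disjoint) auto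
  moreover have "card {T::'n set. card T = 2} = CARD('n) choose 2"
    using n_subsets[of "UNIV :: 'n set" 2] by simp
  ultimately show ?thesis by simp
qed

text \<open>Deleting \<open>v\<close> leaves at most \<open>M\<close> edges, so \<open>v\<close>
  carries the rest.\<close>

lemma min_degree_bound:
  fixes E :: "'n::finite \<Rightarrow> 'n \<Rightarrow> bool"
  assumes "simple_graph E" "\<And>S. card S = CARD('n) - 1 \<Longrightarrow> edge_count E S \<le> M"
    and "M + \<delta> \<le> card (edges E)"
  shows "real \<delta> \<le> real (deg E v)"
  using edge_count_remove[OF assms(1), of v UNIV] assms(2)[of "UNIV - {v}"] assms(3)
  by (simp add: edge_count_UNIV induced_def[abs_def] card_Diff_singleton)

section \<open>Energy estimates from the spectrum\<close>

locale nonsingular_graph_spectrum = graph_spectrum E ev top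
  for E :: "'n::finite \<Rightarrow> 'n \<Rightarrow> bool" and ev top +
  assumes det_nonzero: "det (adj_matrix E) \<noteq> 0"
begin

lemma abs_ev_pos: "0 < \<bar>ev i\<bar>"
  using det_nonzero unfolding prod_ev[symmetric] by simp

lemma prod_abs_ev: "(\<Prod>i\<in>UNIV. \<bar>ev i\<bar>) = \<bar>det (adj_matrix E)\<bar>"
  unfolding prod_ev[symmetric] by (simp add: abs_prod)

lemma sum_ln_abs_ev: "0 \<le> (\<Sum>i\<in>UNIV. ln \<bar>ev i\<bar>)"
proof -
  have "(\<Sum>i\<in>UNIV. ln \<bar>ev i\<bar>) = ln \<bar>det (adj_matrix E)\<bar>"
    unfolding prod_abs_ev[symmetric] using abs_ev_pos by (subst ln_prod) (auto simp: less_imp_neq[symmetric])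
  then show ?thesis using abs_det_adj_matrix_ge_1[OF simple det_nonzero] by simp
qed

text \<open>The arithmetic-geometric mean inequality in tangent form; it settles average degree at
  most 1.\<close>

lemma energy_ge_order: "real CARD('n) \<le> graph_energy E"
  using sum_ge_tangent[of UNIV "\<lambda>i. \<bar>ev i\<bar>" 1] abs_ev_pos sum_ln_abs_ev by (simp add: energy)

text \<open>With \<open>c = 1 / n\<close> the constant part of the estimate is exactly
  \<open>n - 1\<close> and the quadratic part exactly the average degree, while the logarithms
  contribute a nonnegative amount. The largest eigenvalue is treated like all others, so it must not
  exceed the point up to which \<open>gap\<close> is nonnegative.\<close>

lemma energy_if_spectral_radius_small:
  assumes "4 \<le> CARD('n)" "ev top \<le> T" "0 \<le> gap (1 / real CARD('n)) T"
  shows "real CARD('n) - 1 + avg_degree E \<le> graph_energy E"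
proof -
  define c where "c = 1 / real CARD('n)"
  have c: "0 \<le> c" "c \<le> 1/4" "real CARD('n) * c = 1" using assms(1) by (auto simp: c_def field_simps)
  have "\<bar>ev i\<bar> \<le> T" for i using ev_top[of i] assms(2) by linarith
  from sum_lower_bound[of UNIV "\<lambda>i. \<bar>ev i\<bar>" T c 1, OF _ abs_ev_pos this c(1,2)]
  have "real CARD('n) * (1 - c) + c * (2 * real (card (edges E))) + (1 - 2 * c) * (\<Sum>i\<in>UNIV. ln \<bar>ev i\<bar>)
      \<le> graph_energy E"
    using assms(3) by (simp add: c_def[symmetric] sum_ev_squares energy)
  moreover have "0 \<le> (1 - 2 * c) * (\<Sum>i\<in>UNIV. ln \<bar>ev i\<bar>)"
    using c sum_ln_abs_ev by (intro mult_nonneg_nonneg) auto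
  moreover have "c * (2 * real (card (edges E))) = avg_degree E" by (simp add: avg_degree_def c_def)
  ultimately show ?thesis using c(3) by (simp add: right_diff_distrib)
qed

text \<open>The map \<open>t * (t - (\<delta> - 1))\<close> increases beyond
  \<open>(\<delta> - 1) / 2\<close>, so the quadratic inequality for the largest eigenvalue becomes
  a test at one rational \<open>u\<close>.\<close>

lemma ev_top_le:
  assumes "real (card (edges E)) \<le> m2" "\<And>v. \<delta> \<le> real (deg E v)" "\<delta> - 1 \<le> 2 * u"
    and "2 * m2 - \<delta> * (real CARD('n) - 1) \<le> u * (u - (\<delta> - 1))"
  shows "ev top \<le> u"
proof (rule ccontr)
  assume "\<not> ev top \<le> u"
  then have "0 < (ev top - u) * (ev top + u - (\<delta> - 1))" using assms(3) by (intro mult_pos_pos) auto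
  then have "u * (u - (\<delta> - 1)) < (ev top)\<^sup>2 - (\<delta> - 1) * ev top" by (simp add: algebra_simps power2_eq_square)
  then show False using ev_top_quadratic[OF assms(2)] assms(1,4) by linarith
qed

text \<open>Separates the largest eigenvalue from the other moduli. Its lower bound \<open>l\<close>
  comes from the average degree or from a case distinction on \<open>ev top\<close>.\<close>

lemma energy_if_certificate:
  fixes n m1 m2 l u s c T s0 D K Ll Lu Ls Lt LT Ls0 :: real
  assumes n: "real CARD('n) = n" and D: "D \<le> \<bar>det (adj_matrix E)\<bar>"
    and m: "m1 \<le> real (card (edges E))" "real (card (edges E)) \<le> m2"
    and lam: "l \<le> 2 * m1 / n \<or> l \<le> ev top" "ev top \<le> u"
    and cert: "certificate n K m1 m2 (l, Ll) (u, Lu) (s, Ls) c (T, LT) (s0, Ls0) (Lt, D)"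
  shows "real CARD('n) - 1 + avg_degree E \<le> graph_energy E"
proof -
  define I where "I = UNIV - {top}"
  have U: "UNIV = insert top I" "top \<notin> I" "finite I" by (auto simp: I_def)
  have n0: "0 < n" using n by (metis of_nat_0_less_iff zero_less_card_finite)
  have topab: "\<bar>ev top\<bar> = ev top" using ev_top[of top] by simp
  have "2 * m1 / n \<le> avg_degree E" using m(1) n n0 by (simp add: avg_degree_def divide_right_mono)
  then have l: "l \<le> ev top" using lam(1) avg_degree_le by linarith
  have "CARD('n) = Suc (card I)" by (metis U card_insert_disjoint)
  then have card: "real (card I) = n - 1" using n by simp
  have sq: "(ev top)\<^sup>2 + (\<Sum>i\<in>I. \<bar>ev i\<bar>\<^sup>2) = 2 * real (card (edges E))"
    using sum_ev_squares sum.remove[of UNIV top "\<lambda>i. (ev i)\<^sup>2"] by (simp add: I_def)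
  have prod: "D \<le> ev top * (\<Prod>i\<in>I. \<bar>ev i\<bar>)"
    using D prod_abs_ev topab prod.remove[of UNIV top "\<lambda>i. \<bar>ev i\<bar>"] by (simp add: I_def)
  have "n - 1 + 2 * real (card (edges E)) / n \<le> ev top + (\<Sum>i\<in>I. \<bar>ev i\<bar>)"
    by (rule certificate_sound[OF U(3) card n0 abs_ev_pos ev_top l lam(2) sq prod m cert])
  then show ?thesis
    using topab n sum.remove[of UNIV top "\<lambda>i. \<bar>ev i\<bar>"] by (simp add: energy avg_degree_def I_def)
qed

end

section \<open>Orders 5 to 13\<close>

lemmas certificate_simps = certificate_def certificate_value_def expl_def power2_eq_square

text \<open>The rational data of the certificates were found by a numerical search over \<open>s\<close>, \<open>T\<close> and
  \<open>s\<^sub>0\<close>, with \<open>c\<close> the largest admissible value and the logarithms rounded up.\<close>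

context nonsingular_graph_spectrum
begin

lemma energy_order_5:
  assumes n: "CARD('n) = 5" and K33: "K33_free E" and m: "5 < 2 * card (edges E)" and le: "card (edges E) \<le> 8"
  shows "real CARD('n) - 1 + avg_degree E \<le> graph_energy E"
proof -
  have N: "real CARD('n) = 5" using n by simp
  have D: "2 \<le> \<bar>det (adj_matrix E)\<bar>"
    using n by (intro abs_det_adj_matrix_ge_2[OF simple det_nonzero]) simp
  note deg1 = deg_pos[OF det_nonzero]
  have sub: "edge_count E S \<le> 6" if "card S = CARD('n) - 1" for S
    using edge_count_le_choose[OF simple, of S] that n by (simp add: choose_two)
  consider "3 \<le> card (edges E)" "card (edges E) \<le> 7" | "card (edges E) = 8"
    using m le by linarith
  then show ?thesis
  proof cases
    case 1
    note m' = this
    note deg = deg1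
    have u: "ev top \<le> 16/5"
      by (rule ev_top_le[OF _ deg, of "7"]) (use m' N in simp_all)
    \<comment> \<open>The value -0.6931 lies just above \<open>ln (1/2)\<close>, as the determinant
      is even. With \<open>T = u\<close> the bound on the spectral radius covers all
      eigenvalues.\<close>
    have c0: "certificate 5 (-(6931/10000)) 3 7 (6/5, 183/1000) (16/5, 291/250) (1, 0) (149/1000) (16/5, 291/250) (1/2, -(693/1000)) (291/250, 2)"
      by (simp add: certificate_simps)
    show ?thesis by (rule energy_if_certificate[OF N D _ _ _ u c0]) (use m' in simp_all)
  next
    case 2
    note m' = this
    \<comment> \<open>Eight edges less at most six among the remaining four vertices.\<close>
    have "2 \<le> real (deg E v)" for v using min_degree_bound[OF simple sub, of 2 v] m' by simp
    note deg = this
    have u: "ev top \<le> 169/50"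
      by (rule ev_top_le[OF _ deg, of "8"]) (use m' N in simp_all)
    have c0: "certificate 5 (-(6931/10000)) 8 8 (16/5, 291/250) (13/4, 1179/1000) (1, 0) (24/125) (39/20, 167/250) (7/10, -(89/250)) (167/250, 2)"
      by (simp add: certificate_simps)
    have c1: "certificate 5 (-(6931/10000)) 8 8 (13/4, 1179/1000) (169/50, 609/500) (3/4, -(287/1000)) (169/1000) (19/10, 321/500) (13/20, -(43/100)) (93/100, 2)"
      by (simp add: certificate_simps)
    \<comment> \<open>Each range of the largest eigenvalue has its own scale and quadratic
      weight.\<close>
    consider "ev top \<le> 13/4" | "13/4 \<le> ev top" by linarith
    then show ?thesis
    proof cases
      case 1
      show ?thesis by (rule energy_if_certificate[OF N D _ _ _ _ c0]) (use m' 1 in simp_all)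
    next
      case 2
      show ?thesis by (rule energy_if_certificate[OF N D _ _ _ u c1]) (use m' 2 in simp_all)
    qed
  qed
qed

text \<open>Up to eight edges \<open>D \<ge> 1\<close> is enough in order 6, although eight edges
  take four ranges of the largest eigenvalue.\<close>

lemma energy_order_6_sparse:
  assumes n: "CARD('n) = 6" and m: "6 < 2 * card (edges E)" and le: "card (edges E) \<le> 8"
  shows "real CARD('n) - 1 + avg_degree E \<le> graph_energy E"
proof -
  have N: "real CARD('n) = 6" using n by simp
  note D = abs_det_adj_matrix_ge_1[OF simple det_nonzero]
  note deg1 = deg_pos[OF det_nonzero]
  consider "4 \<le> card (edges E)" "card (edges E) \<le> 6" | "card (edges E) = 7" | "card (edges E) = 8"
    using m le by linarith
  then show ?thesis
  proof cases
    case 1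
    note m' = this
    note deg = deg1
    have u: "ev top \<le> 53/20"
      by (rule ev_top_le[OF _ deg, of "6"]) (use m' N in simp_all)
    have c0: "certificate 6 0 4 6 (4/3, 36/125) (53/20, 39/40) (7/8, -(133/1000)) (77/500) (53/20, 39/40) (1/2, -(693/1000)) (1109/1000, 1)"
      by (simp add: certificate_simps)
    show ?thesis by (rule energy_if_certificate[OF N D _ _ _ u c0]) (use m' in simp_all)
  next
    case 2
    note m' = this
    note deg = deg1
    have u: "ev top \<le> 3"
      by (rule ev_top_le[OF _ deg, of "7"]) (use m' N in simp_all)
    have c0: "certificate 6 0 7 7 (7/3, 106/125) (3, 1099/1000) (3/4, -(287/1000)) (37/250) (49/20, 897/1000) (11/20, -(597/1000)) (148/125, 1)"
      by (simp add: certificate_simps)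
    show ?thesis by (rule energy_if_certificate[OF N D _ _ _ u c0]) (use m' in simp_all)
  next
    case 3
    note m' = this
    note deg = deg1
    have u: "ev top \<le> 83/25"
      by (rule ev_top_le[OF _ deg, of "8"]) (use m' N in simp_all)
    have c0: "certificate 6 0 8 8 (8/3, 981/1000) (14/5, 103/100) (3/4, -(287/1000)) (18/125) (51/20, 937/1000) (11/20, -(597/1000)) (153/125, 1)"
      by (simp add: certificate_simps)
    have c1: "certificate 6 0 8 8 (14/5, 103/100) (59/20, 541/500) (3/4, -(287/1000)) (149/1000) (12/5, 219/250) (3/5, -(51/100)) (291/250, 1)"
      by (simp add: certificate_simps)
    have c2: "certificate 6 0 8 8 (59/20, 541/500) (63/20, 287/250) (3/4, -(287/1000)) (31/200) (9/4, 811/1000) (11/20, -(597/1000)) (1099/1000, 1)"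
      by (simp add: certificate_simps)
    have c3: "certificate 6 0 8 8 (63/20, 287/250) (83/25, 6/5) (3/5, -(51/100)) (73/500) (2, 347/500) (3/5, -(51/100)) (301/250, 1)"
      by (simp add: certificate_simps)
    consider "ev top \<le> 14/5" | "14/5 \<le> ev top" "ev top \<le> 59/20" | "59/20 \<le> ev top" "ev top \<le> 63/20" | "63/20 \<le> ev top" by linarith
    then show ?thesis
    proof cases
      case 1
      show ?thesis by (rule energy_if_certificate[OF N D _ _ _ _ c0]) (use m' 1 in simp_all)
    next
      case 2
      show ?thesis by (rule energy_if_certificate[OF N D _ _ _ _ c1]) (use m' 2 in simp_all)
    next
      case 3
      show ?thesis by (rule energy_if_certificate[OF N D _ _ _ _ c2]) (use m' 3 in simp_all)
    next
      case 4
      show ?thesis by (rule energy_if_certificate[OF N D _ _ _ u c3]) (use m' 4 in simp_all)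
    qed
  qed
qed

text \<open>The value -5493/5000 lies just above \<open>ln (1/3)\<close>; with this gain from the
  determinant one certificate covers 9 to 12 edges.\<close>

lemma energy_order_6_dense:
  assumes n: "CARD('n) = 6" and K33: "K33_free E" and m: "9 \<le> card (edges E)" and D: "3 \<le> \<bar>det (adj_matrix E)\<bar>"
  shows "real CARD('n) - 1 + avg_degree E \<le> graph_energy E"
proof -
  have N: "real CARD('n) = 6" using n by simp
  have le: "card (edges E) \<le> 12" using K33_free_edges_6[OF K33 simple] n by (metis edge_count_UNIV)
  note deg1 = deg_pos[OF det_nonzero]
  have m': "9 \<le> card (edges E)" "card (edges E) \<le> 12" using m le by simp_all
  note deg = deg1
  have u: "ev top \<le> 22/5"
    by (rule ev_top_le[OF _ deg, of "12"]) (use m' N in simp_all)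
  have c0: "certificate 6 (-(5493/5000)) 9 12 (3, 1099/1000) (22/5, 741/500) (1, 0) (31/200) (3, 1099/1000) (13/20, -(43/100)) (1099/1000, 3)"
    by (simp add: certificate_simps)
  show ?thesis by (rule energy_if_certificate[OF N D _ _ _ u c0]) (use m' in simp_all)
qed

lemma energy_order_7:
  assumes n: "CARD('n) = 7" and K33: "K33_free E" and m: "7 < 2 * card (edges E)"
  shows "real CARD('n) - 1 + avg_degree E \<le> graph_energy E"
proof -
  have N: "real CARD('n) = 7" using n by simp
  have D: "2 \<le> \<bar>det (adj_matrix E)\<bar>"
    using n by (intro abs_det_adj_matrix_ge_2[OF simple det_nonzero]) simp
  have le: "card (edges E) \<le> 16" using K33_free_edges_7[OF K33 simple] n by (metis edge_count_UNIV)
  note deg1 = deg_pos[OF det_nonzero]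
  have sub: "edge_count E S \<le> 12" if "card S = CARD('n) - 1" for S
    using K33_free_edges_6[OF K33 simple] that n by simp
  consider "4 \<le> card (edges E)" "card (edges E) \<le> 14" | "15 \<le> card (edges E)" "card (edges E) \<le> 16"
    using m le by linarith
  then show ?thesis
  proof cases
    case 1
    note m' = this
    note deg = deg1
    have u: "ev top \<le> 47/10"
      by (rule ev_top_le[OF _ deg, of "14"]) (use m' N in simp_all)
    have c0: "certificate 7 (-(6931/10000)) 4 14 (8/7, 67/500) (47/10, 387/250) (1, 0) (119/1000) (47/10, 387/250) (1/2, -(693/1000)) (387/250, 2)"
      by (simp add: certificate_simps)
    show ?thesis by (rule energy_if_certificate[OF N D _ _ _ u c0]) (use m' in simp_all)
  next
    case 2
    note m' = this
    have "3 \<le> real (deg E v)" for v using min_degree_bound[OF simple sub, of 3 v] m' by simp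
    note deg = this
    have u: "ev top \<le> 49/10"
      by (rule ev_top_le[OF _ deg, of "16"]) (use m' N in simp_all)
    have c0: "certificate 7 (-(6931/10000)) 15 16 (30/7, 182/125) (49/10, 159/100) (1, 0) (161/1000) (14/5, 103/100) (7/10, -(89/250)) (103/100, 2)"
      by (simp add: certificate_simps)
    show ?thesis by (rule energy_if_certificate[OF N D _ _ _ u c0]) (use m' in simp_all)
  qed
qed

text \<open>Even order gives only \<open>D \<ge> 1\<close>, so from 14 edges on every edge number
  has its own certificates. Deleting a vertex leaves at most 16 edges; hence from 18 edges on the
  minimum degree rises with the edge number and keeps the largest eigenvalue down.\<close>

lemma energy_order_8:
  assumes n: "CARD('n) = 8" and K33: "K33_free E" and m: "8 < 2 * card (edges E)"
  shows "real CARD('n) - 1 + avg_degree E \<le> graph_energy E"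
proof -
  have N: "real CARD('n) = 8" using n by simp
  note D = abs_det_adj_matrix_ge_1[OF simple det_nonzero]
  have le: "card (edges E) \<le> 21"
    using K33_free_edges_less[OF K33 simple, of UNIV 8 "11/2" 22] n by (simp add: edge_count_UNIV)
  note deg1 = deg_pos[OF det_nonzero]
  have sub: "edge_count E S \<le> 16" if "card S = CARD('n) - 1" for S
    using K33_free_edges_7[OF K33 simple] that n by simp
  consider "5 \<le> card (edges E)" "card (edges E) \<le> 13" | "card (edges E) = 14" | "card (edges E) = 15" | "card (edges E) = 16" | "card (edges E) = 17" | "card (edges E) = 18" | "card (edges E) = 19" | "card (edges E) = 20" | "card (edges E) = 21"
    using m le by linarith
  then show ?thesis
  proof cases
    case 1
    note m' = this
    note deg = deg1
    have u: "ev top \<le> 22/5"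
      by (rule ev_top_le[OF _ deg, of "13"]) (use m' N in simp_all)
    have c0: "certificate 8 0 5 13 (5/4, 28/125) (22/5, 741/500) (19/20, -(51/1000)) (3/25) (22/5, 741/500) (1/2, -(693/1000)) (1533/1000, 1)"
      by (simp add: certificate_simps)
    show ?thesis by (rule energy_if_certificate[OF N D _ _ _ u c0]) (use m' in simp_all)
  next
    case 2
    note m' = this
    note deg = deg1
    have u: "ev top \<le> 23/5"
      by (rule ev_top_le[OF _ deg, of "14"]) (use m' N in simp_all)
    have c0: "certificate 8 0 14 14 (7/2, 1253/1000) (23/5, 1527/1000) (1, 0) (39/250) (59/20, 541/500) (13/20, -(43/100)) (541/500, 1)"
      by (simp add: certificate_simps)
    show ?thesis by (rule energy_if_certificate[OF N D _ _ _ u c0]) (use m' in simp_all)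
  next
    case 3
    note m' = this
    note deg = deg1
    have u: "ev top \<le> 24/5"
      by (rule ev_top_le[OF _ deg, of "15"]) (use m' N in simp_all)
    have c0: "certificate 8 0 15 15 (15/4, 661/500) (24/5, 1569/1000) (3/4, -(287/1000)) (131/1000) (3, 1099/1000) (13/20, -(43/100)) (1387/1000, 1)"
      by (simp add: certificate_simps)
    show ?thesis by (rule energy_if_certificate[OF N D _ _ _ u c0]) (use m' in simp_all)
  next
    case 4
    note m' = this
    note deg = deg1
    have u: "ev top \<le> 5"
      by (rule ev_top_le[OF _ deg, of "16"]) (use m' N in simp_all)
    have c0: "certificate 8 0 16 16 (4, 1387/1000) (5, 161/100) (3/4, -(287/1000)) (13/100) (61/20, 279/250) (13/20, -(43/100)) (1403/1000, 1)"
      by (simp add: certificate_simps)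
    show ?thesis by (rule energy_if_certificate[OF N D _ _ _ u c0]) (use m' in simp_all)
  next
    case 5
    note m' = this
    note deg = deg1
    have u: "ev top \<le> 26/5"
      by (rule ev_top_le[OF _ deg, of "17"]) (use m' N in simp_all)
    have c0: "certificate 8 0 17 17 (17/4, 1447/1000) (89/20, 1493/1000) (1, 0) (19/125) (31/10, 283/250) (13/20, -(43/100)) (283/250, 1)"
      by (simp add: certificate_simps)
    have c1: "certificate 8 0 17 17 (89/20, 1493/1000) (47/10, 387/250) (1, 0) (79/500) (29/10, 213/200) (3/5, -(51/100)) (213/200, 1)"
      by (simp add: certificate_simps)
    have c2: "certificate 8 0 17 17 (47/10, 387/250) (99/20, 8/5) (1, 0) (33/200) (53/20, 39/40) (3/5, -(51/100)) (39/40, 1)"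
      by (simp add: certificate_simps)
    have c3: "certificate 8 0 17 17 (99/20, 8/5) (26/5, 1649/1000) (7/10, -(89/250)) (29/200) (47/20, 171/200) (3/5, -(51/100)) (303/250, 1)"
      by (simp add: certificate_simps)
    \<comment> \<open>At 17 edges the deletion of a vertex guarantees no more than degree 1; the
      range of the largest eigenvalue is cut into four.\<close>
    consider "ev top \<le> 89/20" | "89/20 \<le> ev top" "ev top \<le> 47/10" | "47/10 \<le> ev top" "ev top \<le> 99/20" | "99/20 \<le> ev top" by linarith
    then show ?thesis
    proof cases
      case 1
      show ?thesis by (rule energy_if_certificate[OF N D _ _ _ _ c0]) (use m' 1 in simp_all)
    next
      case 2
      show ?thesis by (rule energy_if_certificate[OF N D _ _ _ _ c1]) (use m' 2 in simp_all)
    next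
      case 3
      show ?thesis by (rule energy_if_certificate[OF N D _ _ _ _ c2]) (use m' 3 in simp_all)
    next
      case 4
      show ?thesis by (rule energy_if_certificate[OF N D _ _ _ u c3]) (use m' 4 in simp_all)
    qed
  next
    case 6
    note m' = this
    have "2 \<le> real (deg E v)" for v using min_degree_bound[OF simple sub, of 2 v] m' by simp
    note deg = this
    have u: "ev top \<le> 261/50"
      by (rule ev_top_le[OF _ deg, of "18"]) (use m' N in simp_all)
    have c0: "certificate 8 0 18 18 (9/2, 301/200) (97/20, 1579/1000) (1, 0) (151/1000) (63/20, 287/250) (13/20, -(43/100)) (287/250, 1)"
      by (simp add: certificate_simps)
    have c1: "certificate 8 0 18 18 (97/20, 1579/1000) (261/50, 1653/1000) (3/4, -(287/1000)) (137/1000) (14/5, 103/100) (3/5, -(51/100)) (659/500, 1)"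
      by (simp add: certificate_simps)
    consider "ev top \<le> 97/20" | "97/20 \<le> ev top" by linarith
    then show ?thesis
    proof cases
      case 1
      show ?thesis by (rule energy_if_certificate[OF N D _ _ _ _ c0]) (use m' 1 in simp_all)
    next
      case 2
      show ?thesis by (rule energy_if_certificate[OF N D _ _ _ u c1]) (use m' 2 in simp_all)
    qed
  next
    case 7
    note m' = this
    have "3 \<le> real (deg E v)" for v using min_degree_bound[OF simple sub, of 3 v] m' by simp
    note deg = this
    have u: "ev top \<le> 21/4"
      by (rule ev_top_le[OF _ deg, of "19"]) (use m' N in simp_all)
    have c0: "certificate 8 0 19 19 (19/4, 1559/1000) (21/4, 1659/1000) (3/4, -(287/1000)) (63/500) (16/5, 291/250) (3/5, -(51/100)) (1451/1000, 1)"
      by (simp add: certificate_simps)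
    show ?thesis by (rule energy_if_certificate[OF N D _ _ _ u c0]) (use m' in simp_all)
  next
    case 8
    note m' = this
    have "4 \<le> real (deg E v)" for v using min_degree_bound[OF simple sub, of 4 v] m' by simp
    note deg = this
    have u: "ev top \<le> 53/10"
      by (rule ev_top_le[OF _ deg, of "20"]) (use m' N in simp_all)
    have c0: "certificate 8 0 20 20 (5, 161/100) (53/10, 417/250) (3/4, -(287/1000)) (1/8) (13/4, 1179/1000) (3/5, -(51/100)) (1467/1000, 1)"
      by (simp add: certificate_simps)
    show ?thesis by (rule energy_if_certificate[OF N D _ _ _ u c0]) (use m' in simp_all)
  next
    case 9
    note m' = this
    have "5 \<le> real (deg E v)" for v using min_degree_bound[OF simple sub, of 5 v] m' by simp
    note deg = this
    have u: "ev top \<le> 107/20"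
      by (rule ev_top_le[OF _ deg, of "21"]) (use m' N in simp_all)
    have c0: "certificate 8 0 21 21 (21/4, 1659/1000) (107/20, 839/500) (3/4, -(287/1000)) (31/250) (33/10, 597/500) (11/20, -(597/1000)) (741/500, 1)"
      by (simp add: certificate_simps)
    show ?thesis by (rule energy_if_certificate[OF N D _ _ _ u c0]) (use m' in simp_all)
  qed
qed

lemma energy_order_9:
  assumes n: "CARD('n) = 9" and K33: "K33_free E" and m: "9 < 2 * card (edges E)"
  shows "real CARD('n) - 1 + avg_degree E \<le> graph_energy E"
proof -
  have N: "real CARD('n) = 9" using n by simp
  have D: "2 \<le> \<bar>det (adj_matrix E)\<bar>"
    using n by (intro abs_det_adj_matrix_ge_2[OF simple det_nonzero]) simp
  have le: "card (edges E) \<le> 26"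
    using K33_free_edges_less[OF K33 simple, of UNIV 9 "6" 27] n by (simp add: edge_count_UNIV)
  note deg1 = deg_pos[OF det_nonzero]
  have sub: "edge_count E S \<le> 21" if "card S = CARD('n) - 1" for S
    using K33_free_edges_less[OF K33 simple, of S 8 "11/2" 22] that n by simp
  consider "5 \<le> card (edges E)" "card (edges E) \<le> 25" | "card (edges E) = 26"
    using m le by linarith
  then show ?thesis
  proof cases
    case 1
    note m' = this
    note deg = deg1
    have u: "ev top \<le> 13/2"
      by (rule ev_top_le[OF _ deg, of "25"]) (use m' N in simp_all)
    have c0: "certificate 9 (-(6931/10000)) 5 25 (10/9, 53/500) (13/2, 234/125) (4/5, -(223/1000)) (41/500) (13/2, 234/125) (1/2, -(693/1000)) (262/125, 2)"
      by (simp add: certificate_simps)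
    show ?thesis by (rule energy_if_certificate[OF N D _ _ _ u c0]) (use m' in simp_all)
  next
    case 2
    note m' = this
    have "5 \<le> real (deg E v)" for v using min_degree_bound[OF simple sub, of 5 v] m' by simp
    note deg = this
    have u: "ev top \<le> 6"
      by (rule ev_top_le[OF _ deg, of "26"]) (use m' N in simp_all)
    have c0: "certificate 9 (-(6931/10000)) 26 26 (52/9, 351/200) (6, 224/125) (1, 0) (159/1000) (57/20, 131/125) (7/10, -(89/250)) (131/125, 2)"
      by (simp add: certificate_simps)
    show ?thesis by (rule energy_if_certificate[OF N D _ _ _ u c0]) (use m' in simp_all)
  qed
qed

text \<open>Nine vertices carry at most 26 edges, so the minimum degree is at least 2, 3 and 5 for
  28, 29 and 31 edges. This holds the largest eigenvalue at or below 137/20 throughout.\<close>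

lemma energy_order_10:
  assumes n: "CARD('n) = 10" and K33: "K33_free E" and m: "10 < 2 * card (edges E)"
  shows "real CARD('n) - 1 + avg_degree E \<le> graph_energy E"
proof -
  have N: "real CARD('n) = 10" using n by simp
  note D = abs_det_adj_matrix_ge_1[OF simple det_nonzero]
  have le: "card (edges E) \<le> 31"
    using K33_free_edges_less[OF K33 simple, of UNIV 10 "32/5" 32] n by (simp add: edge_count_UNIV)
  note deg1 = deg_pos[OF det_nonzero]
  have sub: "edge_count E S \<le> 26" if "card S = CARD('n) - 1" for S
    using K33_free_edges_less[OF K33 simple, of S 9 "6" 27] that n by simp
  consider "6 \<le> card (edges E)" "card (edges E) \<le> 24" | "card (edges E) = 25" | "card (edges E) = 26" | "card (edges E) = 27" | "card (edges E) = 28" | "29 \<le> card (edges E)" "card (edges E) \<le> 30" | "card (edges E) = 31"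
    using m le by linarith
  then show ?thesis
  proof cases
    case 1
    note m' = this
    note deg = deg1
    have u: "ev top \<le> 25/4"
      by (rule ev_top_le[OF _ deg, of "24"]) (use m' N in simp_all)
    have c0: "certificate 10 0 6 24 (6/5, 183/1000) (25/4, 1833/1000) (19/20, -(51/1000)) (19/200) (25/4, 1833/1000) (1/2, -(693/1000)) (471/250, 1)"
      by (simp add: certificate_simps)
    show ?thesis by (rule energy_if_certificate[OF N D _ _ _ u c0]) (use m' in simp_all)
  next
    case 2
    note m' = this
    note deg = deg1
    have u: "ev top \<le> 129/20"
      by (rule ev_top_le[OF _ deg, of "25"]) (use m' N in simp_all)
    have c0: "certificate 10 0 25 25 (5, 161/100) (129/20, 373/200) (1, 0) (18/125) (17/5, 153/125) (7/10, -(89/250)) (153/125, 1)"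
      by (simp add: certificate_simps)
    show ?thesis by (rule energy_if_certificate[OF N D _ _ _ u c0]) (use m' in simp_all)
  next
    case 3
    note m' = this
    note deg = deg1
    have u: "ev top \<le> 33/5"
      by (rule ev_top_le[OF _ deg, of "26"]) (use m' N in simp_all)
    have c0: "certificate 10 0 26 26 (26/5, 1649/1000) (33/5, 236/125) (3/4, -(287/1000)) (121/1000) (69/20, 1239/1000) (13/20, -(43/100)) (1527/1000, 1)"
      by (simp add: certificate_simps)
    show ?thesis by (rule energy_if_certificate[OF N D _ _ _ u c0]) (use m' in simp_all)
  next
    case 4
    note m' = this
    note deg = deg1
    have u: "ev top \<le> 27/4"
      by (rule ev_top_le[OF _ deg, of "27"]) (use m' N in simp_all)
    have c0: "certificate 10 0 27 27 (27/5, 1687/1000) (27/4, 191/100) (3/4, -(287/1000)) (3/25) (7/2, 1253/1000) (13/20, -(43/100)) (1541/1000, 1)"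
      by (simp add: certificate_simps)
    show ?thesis by (rule energy_if_certificate[OF N D _ _ _ u c0]) (use m' in simp_all)
  next
    case 5
    note m' = this
    have "2 \<le> real (deg E v)" for v using min_degree_bound[OF simple sub, of 2 v] m' by simp
    note deg = this
    have u: "ev top \<le> 67/10"
      by (rule ev_top_le[OF _ deg, of "28"]) (use m' N in simp_all)
    have c0: "certificate 10 0 28 28 (28/5, 1723/1000) (67/10, 1903/1000) (1, 0) (71/500) (7/2, 1253/1000) (13/20, -(43/100)) (1253/1000, 1)"
      by (simp add: certificate_simps)
    show ?thesis by (rule energy_if_certificate[OF N D _ _ _ u c0]) (use m' in simp_all)
  next
    case 6
    note m' = this
    have "3 \<le> real (deg E v)" for v using min_degree_bound[OF simple sub, of 3 v] m' by simp
    note deg = this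
    have u: "ev top \<le> 137/20"
      by (rule ev_top_le[OF _ deg, of "30"]) (use m' N in simp_all)
    have c0: "certificate 10 0 29 30 (29/5, 879/500) (137/20, 77/40) (3/4, -(287/1000)) (57/500) (19/5, 167/125) (13/20, -(43/100)) (1623/1000, 1)"
      by (simp add: certificate_simps)
    show ?thesis by (rule energy_if_certificate[OF N D _ _ _ u c0]) (use m' in simp_all)
  next
    case 7
    note m' = this
    have "5 \<le> real (deg E v)" for v using min_degree_bound[OF simple sub, of 5 v] m' by simp
    note deg = this
    have u: "ev top \<le> 33/5"
      by (rule ev_top_le[OF _ deg, of "31"]) (use m' N in simp_all)
    have c0: "certificate 10 0 31 31 (31/5, 73/40) (33/5, 236/125) (1, 0) (7/50) (18/5, 1281/1000) (13/20, -(43/100)) (1281/1000, 1)"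
      by (simp add: certificate_simps)
    show ?thesis by (rule energy_if_certificate[OF N D _ _ _ u c0]) (use m' in simp_all)
  qed
qed

text \<open>With \<open>D \<ge> 2\<close> one certificate covers all edge numbers.\<close>

lemma energy_order_11:
  assumes n: "CARD('n) = 11" and K33: "K33_free E" and m: "11 < 2 * card (edges E)"
  shows "real CARD('n) - 1 + avg_degree E \<le> graph_energy E"
proof -
  have N: "real CARD('n) = 11" using n by simp
  have D: "2 \<le> \<bar>det (adj_matrix E)\<bar>"
    using n by (intro abs_det_adj_matrix_ge_2[OF simple det_nonzero]) simp
  have le: "card (edges E) \<le> 36"
    using K33_free_edges_less[OF K33 simple, of UNIV 11 "74/11" 37] n by (simp add: edge_count_UNIV)
  note deg1 = deg_pos[OF det_nonzero]
  have m': "6 \<le> card (edges E)" "card (edges E) \<le> 36" using m le by simp_all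
  note deg = deg1
  have u: "ev top \<le> 79/10"
    by (rule ev_top_le[OF _ deg, of "36"]) (use m' N in simp_all)
  have c0: "certificate 11 (-(6931/10000)) 6 36 (12/11, 11/125) (79/10, 2067/1000) (1, 0) (17/200) (39/5, 411/200) (17/20, -(81/500)) (411/200, 2)"
    by (simp add: certificate_simps)
  show ?thesis by (rule energy_if_certificate[OF N D _ _ _ u c0]) (use m' in simp_all)
qed

lemma energy_order_12:
  assumes n: "CARD('n) = 12" and K33: "K33_free E" and m: "12 < 2 * card (edges E)"
  shows "real CARD('n) - 1 + avg_degree E \<le> graph_energy E"
proof -
  have N: "real CARD('n) = 12" using n by simp
  note D = abs_det_adj_matrix_ge_1[OF simple det_nonzero]
  have le: "card (edges E) \<le> 42"
    using K33_free_edges_less[OF K33 simple, of UNIV 12 "43/6" 43] n by (simp add: edge_count_UNIV)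
  note deg1 = deg_pos[OF det_nonzero]
  have sub: "edge_count E S \<le> 36" if "card S = CARD('n) - 1" for S
    using K33_free_edges_less[OF K33 simple, of S 11 "74/11" 37] that n by simp
  consider "7 \<le> card (edges E)" "card (edges E) \<le> 37" | "38 \<le> card (edges E)" "card (edges E) \<le> 40" | "41 \<le> card (edges E)" "card (edges E) \<le> 42"
    using m le by linarith
  then show ?thesis
  proof cases
    case 1
    note m' = this
    note deg = deg1
    have u: "ev top \<le> 159/20"
      by (rule ev_top_le[OF _ deg, of "37"]) (use m' N in simp_all)
    have c0: "certificate 12 0 7 37 (7/6, 31/200) (159/20, 1037/500) (19/20, -(51/1000)) (2/25) (159/20, 1037/500) (1/2, -(693/1000)) (17/8, 1)"
      by (simp add: certificate_simps)
    show ?thesis by (rule energy_if_certificate[OF N D _ _ _ u c0]) (use m' in simp_all)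
  next
    case 2
    note m' = this
    have "2 \<le> real (deg E v)" for v using min_degree_bound[OF simple sub, of 2 v] m' by simp
    note deg = this
    have u: "ev top \<le> 163/20"
      by (rule ev_top_le[OF _ deg, of "40"]) (use m' N in simp_all)
    have c0: "certificate 12 0 38 40 (19/3, 923/500) (163/20, 2099/1000) (1, 0) (129/1000) (83/20, 178/125) (7/10, -(89/250)) (178/125, 1)"
      by (simp add: certificate_simps)
    show ?thesis by (rule energy_if_certificate[OF N D _ _ _ u c0]) (use m' in simp_all)
  next
    case 3
    note m' = this
    have "5 \<le> real (deg E v)" for v using min_degree_bound[OF simple sub, of 5 v] m' by simp
    note deg = this
    have u: "ev top \<le> 31/4"
      by (rule ev_top_le[OF _ deg, of "42"]) (use m' N in simp_all)
    have c0: "certificate 12 0 41 42 (41/6, 961/500) (31/4, 256/125) (1, 0) (131/1000) (4, 1387/1000) (7/10, -(89/250)) (1387/1000, 1)"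
      by (simp add: certificate_simps)
    show ?thesis by (rule energy_if_certificate[OF N D _ _ _ u c0]) (use m' in simp_all)
  qed
qed

lemma energy_order_13:
  assumes n: "CARD('n) = 13" and K33: "K33_free E" and m: "13 < 2 * card (edges E)"
  shows "real CARD('n) - 1 + avg_degree E \<le> graph_energy E"
proof -
  have N: "real CARD('n) = 13" using n by simp
  have D: "2 \<le> \<bar>det (adj_matrix E)\<bar>"
    using n by (intro abs_det_adj_matrix_ge_2[OF simple det_nonzero]) simp
  have le: "card (edges E) \<le> 48"
    using K33_free_edges_less[OF K33 simple, of UNIV 13 "98/13" 49] n by (simp add: edge_count_UNIV)
  note deg1 = deg_pos[OF det_nonzero]
  have m': "7 \<le> card (edges E)" "card (edges E) \<le> 48" using m le by simp_all
  note deg = deg1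
  have u: "ev top \<le> 46/5"
    by (rule ev_top_le[OF _ deg, of "48"]) (use m' N in simp_all)
  have c0: "certificate 13 (-(6931/10000)) 7 48 (14/13, 3/40) (46/5, 111/50) (1, 0) (39/500) (44/5, 87/40) (4/5, -(223/1000)) (87/40, 2)"
    by (simp add: certificate_simps)
  show ?thesis by (rule energy_if_certificate[OF N D _ _ _ u c0]) (use m' in simp_all)
qed

end

section \<open>Large orders\<close>

text \<open>Settles order 6 with determinant -1 and three eigenvalues of each sign; \<open>d\<close>
  is the average degree for 9 to 12 edges. Trace and sum of squares determine the second symmetric
  function \<open>e\<close> of the negative part from the positive part, and Newton's inequality
  then bounds the product. If the energy were too small, the product could not reach 1.\<close>

lemma three_three_energy:
  fixes lam x y p q r d :: real
  assumes d: "d = 3 \<or> d = 10/3 \<or> d = 11/3 \<or> d = 4" and lam: "d \<le> lam"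
    and pos: "0 < x" "0 < y" "0 < p" "0 < q" "0 < r"
    and sum: "lam + x + y = p + q + r"
    and sq: "lam\<^sup>2 + x\<^sup>2 + y\<^sup>2 + p\<^sup>2 + q\<^sup>2 + r\<^sup>2 = 6 * d"
    and prod: "1 \<le> lam * (x * y) * (p * q * r)"
  shows "5 + d \<le> 2 * (lam + x + y)"
proof (rule ccontr)
  assume "\<not> ?thesis"
  then have small: "2 * (lam + x + y) < 5 + d" by simp
  define \<sigma> w e where "\<sigma> = (x + y) / 2" and "w = x * y" and "e = p * q + q * r + r * p"
  define C where "C = lam\<^sup>2 + 2 * lam * \<sigma> + 4 * \<sigma>\<^sup>2 - 3 * d"
  have d3: "3 \<le> d" using d by auto
  have \<sigma>: "0 < \<sigma>" and w: "0 < w" using pos by (simp_all add: \<sigma>_def w_def)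
  have w\<sigma>: "w \<le> \<sigma>\<^sup>2"
    using zero_le_power2[of "x - y"] unfolding \<sigma>_def w_def by (simp add: power2_eq_square algebra_simps)
  have e: "e = C - w"
  proof -
    have "(p + q + r)\<^sup>2 = p\<^sup>2 + q\<^sup>2 + r\<^sup>2 + 2 * e" by (simp add: e_def power2_eq_square algebra_simps)
    then have "(lam + x + y)\<^sup>2 = 6 * d - lam\<^sup>2 - x\<^sup>2 - y\<^sup>2 + 2 * e" using sum sq by simp
    then show ?thesis unfolding C_def \<sigma>_def w_def
      by (simp add: power2_eq_square algebra_simps add_divide_distrib)
  qed
  \<comment> \<open>Newton's inequality for three numbers, written as a sum of squares.\<close>
  have newton: "3 * (p + q + r) * (p * q * r) \<le> e\<^sup>2"
  proof -
    have "2 * (e\<^sup>2 - 3 * (p + q + r) * (p * q * r)) = (p * q - q * r)\<^sup>2 + (q * r - r * p)\<^sup>2 + (r * p - p * q)\<^sup>2"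
      by (simp add: e_def power2_eq_square algebra_simps)
    then have "0 \<le> 2 * (e\<^sup>2 - 3 * (p + q + r) * (p * q * r))" by simp
    then show ?thesis by simp
  qed
  have S: "lam + x + y = lam + 2 * \<sigma>" by (simp add: \<sigma>_def)
  have key1: "3 * (lam + 2 * \<sigma>) \<le> lam * (w * (C - w)\<^sup>2)"
  proof -
    have "0 < lam + 2 * \<sigma>" using lam d3 \<sigma> by simp
    then have "3 * (lam + 2 * \<sigma>) * 1 \<le> 3 * (lam + 2 * \<sigma>) * (lam * w * (p * q * r))"
      using prod by (intro mult_left_mono) (auto simp: w_def)
    also have "\<dots> = lam * w * (3 * (p + q + r) * (p * q * r))" using sum S by (simp add: algebra_simps)
    also have "\<dots> \<le> lam * w * e\<^sup>2" using newton lam d3 w by (intro mult_left_mono) auto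
    finally show ?thesis using e by (simp add: mult.assoc)
  qed
  have lam2: "3 * d \<le> lam\<^sup>2"
  proof -
    have "d * d \<le> lam * lam" using lam d3 by (intro mult_mono) auto
    moreover have "3 * d \<le> d * d" using d3 by (intro mult_right_mono) auto
    ultimately show ?thesis by (simp add: power2_eq_square)
  qed
  define f where "f = (lam\<^sup>2 - 3 * d) + 2 * lam * \<sigma> + 3 * \<sigma>\<^sup>2"
  \<comment> \<open>The left side grows with \<open>w\<close> on the interval up to
    \<open>\<sigma>\<^sup>2\<close>, so the worst case is \<open>x = y\<close>, where
    \<open>C - w\<close> equals \<open>f\<close>.\<close>
  have key2: "w * (C - w)\<^sup>2 \<le> \<sigma>\<^sup>2 * f\<^sup>2"
  proof -
    define v k where "v = \<sigma>\<^sup>2" and "k = (lam\<^sup>2 - 3 * d) + 2 * lam * \<sigma> + \<sigma>\<^sup>2"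
    have C: "C = 3 * v + k" "f = 2 * v + k" by (simp_all add: C_def f_def v_def k_def)
    have k: "0 \<le> k" using lam2 lam d3 \<sigma> by (simp add: k_def)
    have "0 \<le> (4 * v - w) * (v - w)" "0 \<le> k * (4 * v - 2 * w)"
      using w\<sigma> w k unfolding v_def by (auto intro!: mult_nonneg_nonneg)
    then have "0 \<le> (v - w) * ((4 * v - w) * (v - w) + k * (4 * v - 2 * w) + k\<^sup>2)"
      using w\<sigma> by (intro mult_nonneg_nonneg) (auto simp: v_def)
    also have "\<dots> = v * f\<^sup>2 - w * (C - w)\<^sup>2" unfolding C by (simp add: power2_eq_square algebra_simps)
    finally show ?thesis by (simp add: v_def)
  qed
  have key3: "3 * (lam + 2 * \<sigma>) \<le> lam * (\<sigma>\<^sup>2 * f\<^sup>2)"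
    using key1 mult_left_mono[OF key2, of lam] lam d3 by linarith
  \<comment> \<open>Expansion in the excess \<open>\<tau>\<close> of \<open>lam\<close> over
    \<open>d\<close>: at \<open>\<tau> = 0\<close> the values of \<open>\<sigma>m\<close>,
    \<open>fm\<close> and \<open>\<sigma>m * fm\<close> are \<open>\<sigma>0\<close>,
    \<open>R\<close> and \<open>G0\<close>, and the slopes of the last two are \<open>k\<close> and
    \<open>- \<epsilon>\<close>.\<close>
  define \<sigma>0 \<tau> R k G0 \<epsilon> where "\<sigma>0 = (5 - d) / 4" and "\<tau> = (lam - d) / 2"
    and "R = (d + \<sigma>0)\<^sup>2 + 2 * \<sigma>0\<^sup>2 - 3 * d" and "k = 2 * d - 2 * \<sigma>0" and "G0 = \<sigma>0 * R" and "\<epsilon> = R - \<sigma>0 * k"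
  \<comment> \<open>\<open>\<sigma>m\<close> is the mean of \<open>x\<close> and \<open>y\<close> at
    which the energy would equal the target, hence an upper bound for
    \<open>\<sigma>\<close>.\<close>
  define \<sigma>m fm where "\<sigma>m = \<sigma>0 - \<tau>" and "fm = (lam\<^sup>2 - 3 * d) + 2 * lam * \<sigma>m + 3 * \<sigma>m\<^sup>2"
  have \<sigma>m: "\<sigma> \<le> \<sigma>m" using small S unfolding \<sigma>m_def \<sigma>0_def \<tau>_def by (simp add: field_simps)
  have fpos: "0 \<le> f" and ff: "f \<le> fm"
    using lam2 lam d3 \<sigma> \<sigma>m unfolding f_def fm_def
    by (auto intro!: add_nonneg_nonneg add_mono mult_left_mono power_mono)
  \<comment> \<open>With \<open>3 * lam\<close> isolated, the other side is a product of factors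
    increasing in \<open>\<sigma>\<close>, so \<open>\<sigma>\<close> may be raised to
    \<open>\<sigma>m\<close>.\<close>
  have key4: "3 * (lam + 2 * \<sigma>m) \<le> lam * (\<sigma>m * fm)\<^sup>2"
  proof -
    have "3 * lam \<le> \<sigma> * (lam * \<sigma> * f\<^sup>2 - 6)" using key3 by (simp add: power2_eq_square algebra_simps)
    moreover from this have "0 \<le> lam * \<sigma> * f\<^sup>2 - 6" using \<sigma> lam d3 by (smt (verit) mult_pos_neg)
    moreover have "\<sigma> * f\<^sup>2 \<le> \<sigma>m * fm\<^sup>2" using \<sigma> \<sigma>m fpos ff by (intro mult_mono power_mono) auto
    then have "lam * (\<sigma> * f\<^sup>2) \<le> lam * (\<sigma>m * fm\<^sup>2)" using lam d3 by (intro mult_left_mono) auto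
    ultimately have "3 * lam \<le> \<sigma>m * (lam * (\<sigma>m * fm\<^sup>2) - 6)"
      using \<sigma>m \<sigma> by (smt (verit) mult.assoc mult_mono)
    then show ?thesis by (simp add: power2_eq_square algebra_simps)
  qed
  have \<tau>: "0 \<le> \<tau>" using lam by (simp add: \<tau>_def)
  have lam_eq: "lam = d + 2 * \<tau>" by (simp add: \<tau>_def diff_divide_distrib)
  \<comment> \<open>Exact rational checks for the four values of \<open>d\<close>; they make the
    bound largest at \<open>lam = d\<close> and too small even there.\<close>
  have "3 * \<sigma>0 \<le> k \<and> 2 * G0 \<le> d * \<epsilon> \<and> d * G0\<^sup>2 < 3 * (5 + d) / 2 \<and> 0 \<le> \<epsilon>"
    using d
  proof (elim disjE)
    assume d: "d = 3"
    show ?thesis unfolding G0_def \<epsilon>_def k_def R_def \<sigma>0_def d by (simp add: power2_eq_square)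
  next
    assume d: "d = 10/3"
    show ?thesis unfolding G0_def \<epsilon>_def k_def R_def \<sigma>0_def d by (simp add: power2_eq_square)
  next
    assume d: "d = 11/3"
    show ?thesis unfolding G0_def \<epsilon>_def k_def R_def \<sigma>0_def d by (simp add: power2_eq_square)
  next
    assume d: "d = 4"
    show ?thesis unfolding G0_def \<epsilon>_def k_def R_def \<sigma>0_def d by (simp add: power2_eq_square)
  qed
  then have num: "3 * \<sigma>0 \<le> k" "2 * G0 \<le> d * \<epsilon>" "d * G0\<^sup>2 < 3 * (5 + d) / 2" "0 \<le> \<epsilon>"
    by blast+
  have G: "\<sigma>m * fm \<le> G0 - \<epsilon> * \<tau>"
  proof -
    have "G0 - \<epsilon> * \<tau> - \<sigma>m * fm = \<tau>\<^sup>2 * (k - 3 * \<sigma>0) + 3 * \<tau> ^ 3"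
      unfolding fm_def lam_eq \<sigma>m_def G0_def \<epsilon>_def R_def k_def
      by (simp add: power2_eq_square power3_eq_cube algebra_simps)
    moreover have "0 \<le> \<tau>\<^sup>2 * (k - 3 * \<sigma>0) + 3 * \<tau> ^ 3" using \<tau> num(1) by simp
    ultimately show ?thesis by linarith
  qed
  have "0 \<le> \<sigma>m * fm" using \<sigma> \<sigma>m fpos ff by simp
  then have "lam * (\<sigma>m * fm)\<^sup>2 \<le> lam * (G0 - \<epsilon> * \<tau>)\<^sup>2" using G lam d3 by (intro mult_left_mono power_mono) auto
  also have "\<dots> = (lam * (G0 - \<epsilon> * \<tau>)) * (G0 - \<epsilon> * \<tau>)" by (simp add: power2_eq_square)
  also have "\<dots> \<le> (d * G0) * G0"
  proof (rule mult_mono)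
    have "lam * (G0 - \<epsilon> * \<tau>) = d * G0 - \<tau> * (d * \<epsilon> - 2 * G0) - 2 * \<epsilon> * \<tau>\<^sup>2"
      unfolding lam_eq by (simp add: power2_eq_square algebra_simps)
    moreover have "0 \<le> \<tau> * (d * \<epsilon> - 2 * G0)" "0 \<le> 2 * \<epsilon> * \<tau>\<^sup>2" using \<tau> num by simp_all
    ultimately show "lam * (G0 - \<epsilon> * \<tau>) \<le> d * G0" by linarith
    show "G0 - \<epsilon> * \<tau> \<le> G0" using \<tau> num by simp
    show "0 \<le> G0 - \<epsilon> * \<tau>" using \<open>0 \<le> \<sigma>m * fm\<close> G by linarith
    have "0 \<le> G0" using \<open>0 \<le> \<sigma>m * fm\<close> G \<tau> num(4) by (smt (verit) mult_nonneg_nonneg)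
    then show "0 \<le> d * G0" using d3 by simp
  qed
  finally have "3 * (lam + 2 * \<sigma>m) \<le> d * G0\<^sup>2" using key4 by (simp add: power2_eq_square)
  moreover have "lam + 2 * \<sigma>m = (5 + d) / 2" unfolding lam_eq \<sigma>m_def \<sigma>0_def by (simp add: field_simps)
  ultimately show False using num(3) by simp
qed

section \<open>Orders from 14 on, with one threshold for all eigenvalues\<close>

context nonsingular_graph_spectrum
begin

text \<open>The uniform edge bound for larger orders rests on
  \<open>n\<^sup>2 - 18 * n + 29 > 0\<close>, which fails up to 16, so these orders use their own
  edge counts.\<close>

lemma energy_order_14_15_16:
  assumes n: "CARD('n) = 14 \<or> CARD('n) = 15 \<or> CARD('n) = 16" and K33: "K33_free E"
  shows "real CARD('n) - 1 + avg_degree E \<le> graph_energy E"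
  using n
proof (elim disjE)
  assume n: "CARD('n) = 14"
  have "card (edges E) \<le> 54"
    using K33_free_edges_less[OF K33 simple, of UNIV 14 "55/7" 55] n by (simp add: edge_count_UNIV)
  then have "ev top \<le> 39/4"
    by (intro ev_top_le[OF _ deg_pos[OF det_nonzero], of 54]) (use n in simp_all)
  moreover have "ln (39/4) \<le> (23/10 :: real)" by (rule ln_le_expl) (simp_all add: expl_def)
  then have "0 \<le> gap (1 / real CARD('n)) (39/4)" unfolding gap_def n by (simp add: power2_eq_square)
  ultimately show ?thesis using n by (intro energy_if_spectral_radius_small) auto
next
  assume n: "CARD('n) = 15"
  have "card (edges E) \<le> 61"
    using K33_free_edges_less[OF K33 simple, of UNIV 15 "124/15" 62] n by (simp add: edge_count_UNIV)
  then have "ev top \<le> 52/5"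
    by (intro ev_top_le[OF _ deg_pos[OF det_nonzero], of 61]) (use n in simp_all)
  moreover have "ln (52/5) \<le> (12/5 :: real)" by (rule ln_le_expl) (simp_all add: expl_def)
  then have "0 \<le> gap (1 / real CARD('n)) (52/5)" unfolding gap_def n by (simp add: power2_eq_square)
  ultimately show ?thesis using n by (intro energy_if_spectral_radius_small) auto
next
  assume n: "CARD('n) = 16"
  have "card (edges E) \<le> 68"
    using K33_free_edges_less[OF K33 simple, of UNIV 16 "69/8" 69] n by (simp add: edge_count_UNIV)
  then have "ev top \<le> 11"
    by (intro ev_top_le[OF _ deg_pos[OF det_nonzero], of 68]) (use n in simp_all)
  moreover have "ln 11 \<le> (12/5 :: real)" by (rule ln_le_expl) (simp_all add: expl_def)
  then have "0 \<le> gap (1 / real CARD('n)) 11" unfolding gap_def n by (simp add: power2_eq_square)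
  ultimately show ?thesis using n by (intro energy_if_spectral_radius_small) auto
qed

text \<open>Average degree at most \<open>(n + 1) / 2\<close> and minimum degree at least 1 bound
  the largest eigenvalue by \<open>n / sqrt 2\<close>. In \<open>gap\<close> the quadratic term is
  then about \<open>n / 2\<close>, which stays below \<open>n / sqrt 2\<close> by a linear amount
  that absorbs the logarithm.\<close>

lemma energy_order_ge_17:
  assumes n17: "17 \<le> CARD('n)" and K33: "K33_free E"
  shows "real CARD('n) - 1 + avg_degree E \<le> graph_energy E"
proof -
  define n where "n = real CARD('n)"
  define m where "m = real (card (edges E))"
  have n: "17 \<le> n" using n17 by (simp add: n_def)
  have m: "2 * m \<le> n * ((n + 1) / 2)"
  proof (rule ccontr)
    assume "\<not> ?thesis"
    then have "(n + 1) / 2 * ((n + 1) / 2 - 1) * ((n + 1) / 2 - 2) \<le> 2 * (n - 1) * (n - 2)"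
      using K33_free_edge_bound[OF K33 simple, of "(n + 1) / 2" UNIV] n
      by (simp add: edge_count_UNIV n_def m_def)
    then have "(n - 1) * (n\<^sup>2 - 18 * n + 29) \<le> 0" by (simp add: field_simps power2_eq_square)
    moreover have "(n - 17) * (n - 1) \<ge> 0" using n by simp
    then have "n\<^sup>2 - 18 * n + 29 > 0" by (simp add: power2_eq_square algebra_simps)
    ultimately show False using n by (simp add: mult_le_0_iff)
  qed
  define T where "T = n / sqrt 2"
  have T2: "T\<^sup>2 = n\<^sup>2 / 2" by (simp add: T_def power_divide)
  have T0: "0 < T" using n by (simp add: T_def)
  have T7: "7/10 * n \<le> T \<and> T \<le> 71/100 * n"
  proof -
    have "(7/10 * n)\<^sup>2 \<le> T\<^sup>2" "T\<^sup>2 \<le> (71/100 * n)\<^sup>2" unfolding T2 by (simp_all add: power_mult_distrib power2_eq_square)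
    then show ?thesis using T0 n by (auto dest: power2_le_imp_le)
  qed
  have "ev top \<le> T"
  proof (rule ev_top_le[of m])
    show "real (card (edges E)) \<le> m" by (simp add: m_def)
    show "1 \<le> real (deg E v)" for v by (rule deg_pos[OF det_nonzero])
    show "1 - 1 \<le> 2 * T" using T0 by simp
    have "2 * m - (n - 1) \<le> n\<^sup>2 / 2" using m n by (simp add: power2_eq_square field_simps)
    then show "2 * m - 1 * (real CARD('n) - 1) \<le> T * (T - (1 - 1))"
      using T2 by (simp add: n_def power2_eq_square)
  qed
  moreover have "0 \<le> gap (1 / real CARD('n)) T"
  proof -
    \<comment> \<open>The logarithm is bounded by its tangent at 12, close to
      \<open>17 / sqrt 2\<close>, the smallest threshold that occurs.\<close>
    have "ln 12 \<le> (5/2 :: real)" by (rule ln_le_expl) (simp_all add: expl_def)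
    moreover have "ln (T / 12) \<le> T / 12 - 1" using T0 by (intro ln_le_minus_one) simp
    ultimately have lnT: "ln T \<le> T / 12 + 3/2" using T0 by (simp add: ln_div)
    have "(n - 2) * ln T \<le> (n - 2) * (T / 12 + 3/2)" using lnT n by (intro mult_left_mono) auto
    also have "\<dots> \<le> (n - 2) * (71/1200 * n + 3/2)" using T7 n by (intro mult_left_mono) auto
    finally have 1: "(n - 2) * ln T \<le> (n - 2) * (71/1200 * n + 3/2)" .
    have "n * (7/10 * n) \<le> n * T" using T7 n by (intro mult_left_mono) auto
    moreover have "17 * n \<le> n * n" using n by (intro mult_right_mono) auto
    moreover have "(n - 2) * (71/1200 * n + 3/2) = 71/1200 * (n * n) + 829/600 * n - 3"
      by (simp add: field_simps)
    ultimately have "0 \<le> n * T - n - (n * n / 2 - 1) - (n - 2) * ln T" using 1 n by linarith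
    then have "0 \<le> n * T - n - (n\<^sup>2 / 2 - 1) - (n - 2) * ln T" by (simp add: power2_eq_square)
    also have "\<dots> = n * gap (1 / n) T"
      unfolding gap_def T2 using n by (simp add: field_simps)
    finally show ?thesis using n by (simp add: n_def zero_le_mult_iff)
  qed
  ultimately show ?thesis using n17 by (intro energy_if_spectral_radius_small) auto
qed

end

section \<open>Complete graphs and order 6\<close>

context graph_spectrum
begin

text \<open>The only eigenvalues are -1 and \<open>n - 1\<close>, and the trace fixes the energy
  without a count of multiplicities.\<close>

lemma energy_complete:
  assumes complete: "\<And>u v. u \<noteq> v \<Longrightarrow> E u v"
  shows "real CARD('n) - 1 + avg_degree E \<le> graph_energy E"
proof -
  define n where "n = real CARD('n)"
  have n: "1 \<le> n" by (simp add: n_def Suc_le_eq)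
  have irr: "\<not> E u u" for u using simple unfolding simple_graph_def by blast
  obtain v where v: "\<And>i. adj_matrix E *v v i = ev i *\<^sub>R v i"
    "\<And>i j. v i \<bullet> v j = (if i = j then 1 else 0)"
    using eigenbasis by blast
  have cases: "ev i = -1 \<or> ev i = n - 1" for i
  proof (rule disjCI)
    assume ne: "ev i \<noteq> n - 1"
    define X where "X = (\<Sum>j\<in>UNIV. v i $ j)"
    have ev: "X = (ev i + 1) * v i $ k" for k
    proof -
      have "{j. E k j} = UNIV - {k}" using complete irr by auto
      then have "(\<Sum>j\<in>UNIV - {k}. v i $ j) = ev i * v i $ k"
        using arg_cong[OF v(1)[of i], of "\<lambda>y. y $ k"] by (simp add: adj_matrix_mult)
      then show ?thesis
        unfolding X_def using sum.remove[of UNIV k "\<lambda>j. v i $ j"] by (simp add: algebra_simps)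
    qed
    have "(\<Sum>k\<in>(UNIV::'n set). X) = (\<Sum>k\<in>UNIV. (ev i + 1) * v i $ k)"
      by (rule sum.cong[OF refl]) (rule ev)
    then have "n * X = (ev i + 1) * X" by (simp add: n_def X_def sum_distrib_left[symmetric])
    then have "X = 0" using ne by auto
    have "v i \<noteq> 0" using v(2)[of i i] by auto
    then obtain k where "v i $ k \<noteq> 0" by (auto simp: vec_eq_iff)
    then show "ev i = -1" using ev[of k] \<open>X = 0\<close> by simp
  qed
  \<comment> \<open>The affine function through the two possible pairs of an eigenvalue and its
    modulus, so the sum of moduli follows from the trace.\<close>
  have abs: "\<bar>ev i\<bar> = 1 + (n - 2) / n * (ev i + 1)" for i
    using cases[of i] n by (auto simp: field_simps)
  have "graph_energy E = n + (n - 2) / n * n"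
  proof -
    have "(\<Sum>i\<in>UNIV. (n - 2) / n * (ev i + 1)) = (n - 2) / n * (\<Sum>i\<in>UNIV. ev i + 1)"
      by (rule sum_distrib_left[symmetric])
    also have "(\<Sum>i\<in>UNIV. ev i + 1) = n" by (simp add: sum.distrib sum_ev n_def)
    finally show ?thesis unfolding energy abs sum.distrib by (simp add: n_def)
  qed
  then have "graph_energy E = n - 1 + (n - 1)" using n by simp
  moreover have "avg_degree E \<le> n - 1"
  proof -
    have "avg_degree E \<le> ev top" by (rule avg_degree_le)
    then show ?thesis using cases[of top] n by auto
  qed
  ultimately show ?thesis by (simp add: n_def)
qed

lemma quadratic_form_eigenbasis:
  assumes v: "\<And>i. adj_matrix E *v v i = ev i *\<^sub>R v i"
    "\<And>i j. v i \<bullet> v j = (if i = j then 1 else 0)"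
  shows "x \<bullet> (adj_matrix E *v x) = (\<Sum>i\<in>UNIV. ev i * (v i \<bullet> x)\<^sup>2)" "x \<noteq> 0 \<Longrightarrow> \<exists>i. v i \<bullet> x \<noteq> 0"
proof -
  define V :: "real^'n^'n" where "V = (\<chi> i j. v i $ j)"
  have "V ** transpose V = mat 1"
    using v(2) by (simp add: vec_eq_iff matrix_matrix_mult_def transpose_def V_def mat_def inner_vec_def)
  then have VV: "transpose V ** V = mat 1" by (simp add: matrix_left_right_inverse)
  have Vx: "V *v x = (\<chi> i. v i \<bullet> x)" for x
    by (simp add: vec_eq_iff matrix_vector_mult_def V_def inner_vec_def)
  have x: "x = transpose V *v (V *v x)" for x
    by (simp add: matrix_vector_mul_assoc VV)
  have expand: "x = (\<Sum>i\<in>UNIV. (v i \<bullet> x) *\<^sub>R v i)" for x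
    by (rule trans[OF x[of x, unfolded Vx]])
      (simp add: vec_eq_iff matrix_vector_mult_def transpose_def V_def mult.commute)
  show "x \<bullet> (adj_matrix E *v x) = (\<Sum>i\<in>UNIV. ev i * (v i \<bullet> x)\<^sup>2)"
  proof -
    have "adj_matrix E *v x = adj_matrix E *v (\<Sum>i\<in>UNIV. (v i \<bullet> x) *\<^sub>R v i)"
      by (rule arg_cong[OF expand])
    also have "\<dots> = (\<Sum>i\<in>UNIV. adj_matrix E *v ((v i \<bullet> x) *\<^sub>R v i))"
      by (rule linear_sum[OF matrix_vector_mul_linear])
    also have "\<dots> = (\<Sum>i\<in>UNIV. (ev i * (v i \<bullet> x)) *\<^sub>R v i)"
      by (simp add: matrix_vector_mult_scaleR v(1) mult.commute)
    finally show ?thesis by (simp add: inner_sum_right power2_eq_square inner_commute mult.assoc)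
  qed
  show "\<exists>i. v i \<bullet> x \<noteq> 0" if "x \<noteq> 0" 
  proof (rule ccontr)
    assume "\<nexists>i. v i \<bullet> x \<noteq> 0"
    then have "(\<Sum>i\<in>UNIV. (v i \<bullet> x) *\<^sub>R v i) = 0" by simp
    then show False using expand[of x] that by simp
  qed
qed

end

section \<open>Order 6 by the signs of the eigenvalues\<close>

context nonsingular_graph_spectrum
begin

text \<open>The quadratic form is negative definite on the complement of the top eigenvector, but an edge
  together with a vertex adjacent to neither end spans a plane on which it is nonnegative.\<close>

lemma one_positive_eigenvalue_edge:
  assumes neg: "\<And>i. i \<noteq> top \<Longrightarrow> ev i < 0" and E: "E a b" and c: "c \<noteq> a" "c \<noteq> b"
  shows "E c a \<or> E c b"
proof (rule ccontr)
  assume "\<not> ?thesis"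
  then have non: "\<not> E c a" "\<not> E c b" by auto
  have sym: "E u v \<longleftrightarrow> E v u" and irr: "\<not> E u u" for u v using simple by (auto simp: simple_graph_def)
  obtain v where v: "\<And>i. adj_matrix E *v v i = ev i *\<^sub>R v i"
    "\<And>i j. v i \<bullet> v j = (if i = j then 1 else 0)"
    using eigenbasis by blast
  define y z :: "real^'n" where "y = axis a 1 + axis b 1" and "z = axis c 1"
  \<comment> \<open>Coefficients of a nonzero vector of the plane orthogonal to the top eigenvector;
    the default \<open>0, 1\<close> serves when the whole plane is orthogonal to it.\<close>
  define \<alpha> \<beta> where "\<alpha> = (if v top \<bullet> y = 0 \<and> v top \<bullet> z = 0 then 0 else v top \<bullet> z)"
    and "\<beta> = (if v top \<bullet> y = 0 \<and> v top \<bullet> z = 0 then 1 else - (v top \<bullet> y))"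
  define x where "x = \<alpha> *\<^sub>R y + \<beta> *\<^sub>R z"
  have orth: "v top \<bullet> x = 0" by (simp add: x_def \<alpha>_def \<beta>_def inner_add_right)
  have ab: "a \<noteq> b" using E irr by blast
  have "x \<noteq> 0"
  proof
    assume "x = 0"
    then have "x $ a = 0" "x $ c = 0" by simp_all
    then have "\<alpha> = 0" "\<beta> = 0" using ab c by (auto simp: x_def y_def z_def axis_def)
    then show False by (auto simp: \<alpha>_def \<beta>_def split: if_splits)
  qed
  have A: "axis i 1 \<bullet> (adj_matrix E *v axis j 1) = (if E i j then 1 else 0)" for i j
    by (simp add: inner_axis' matrix_vector_mult_basis column_def adj_matrix_def)
  \<comment> \<open>Only the edge \<open>a b\<close> contributes, since \<open>c\<close> has no edge
    to \<open>a\<close> or \<open>b\<close> and there are no loops.\<close>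
  have "x \<bullet> (adj_matrix E *v x) = 2 * \<alpha>\<^sup>2"
    unfolding x_def y_def z_def using E non sym[of b a] sym[of a c] sym[of b c] irr
    by (simp add: matrix_vector_right_distrib matrix_vector_mult_scaleR inner_add_left inner_add_right A
        power2_eq_square)
  moreover have "x \<bullet> (adj_matrix E *v x) < 0"
  proof -
    obtain i where i: "v i \<bullet> x \<noteq> 0" using quadratic_form_eigenbasis(2)[OF v \<open>x \<noteq> 0\<close>] by blast
    have "(\<Sum>i\<in>UNIV. ev i * (v i \<bullet> x)\<^sup>2) < (\<Sum>i\<in>(UNIV::'n set). 0)"
    proof (rule sum_strict_mono_ex1)
      have "ev i * (v i \<bullet> x)\<^sup>2 \<le> 0" for i
        using neg[of i] orth by (cases "i = top") (auto simp: mult_nonpos_nonneg)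
      then show "\<forall>i\<in>UNIV. ev i * (v i \<bullet> x)\<^sup>2 \<le> 0" by blast
      have "i \<noteq> top" using i orth by blast
      then have "ev i * (v i \<bullet> x)\<^sup>2 < 0" using neg[of i] i by (simp add: mult_neg_pos)
      then show "\<exists>i\<in>UNIV. ev i * (v i \<bullet> x)\<^sup>2 < 0" by blast
    qed simp
    then show ?thesis using quadratic_form_eigenbasis(1)[OF v] by simp
  qed
  ultimately show False by (smt (verit) zero_le_power2)
qed

text \<open>Nonadjacency becomes transitive, so nonadjacent vertices would be twins, which
  nonsingularity excludes.\<close>

lemma one_positive_eigenvalue_complete:
  assumes neg: "\<And>i. i \<noteq> top \<Longrightarrow> ev i < 0" and "u \<noteq> v"
  shows "E u v"
proof (rule ccontr)
  assume non: "\<not> E u v"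
  have sym: "E u v \<longleftrightarrow> E v u" and irr: "\<not> E u u" for u v using simple by (auto simp: simple_graph_def)
  have "E u w \<longleftrightarrow> E v w" for w
    using one_positive_eigenvalue_edge[OF neg, of u w v] one_positive_eigenvalue_edge[OF neg, of v w u]
      non sym irr assms(2) by metis
  then show False using twins_singular[OF assms(2)] det_nonzero by blast
qed

lemma ev_top_pos: "0 < ev top"
  using abs_ev_pos[of top] ev_top[of top] by linarith

text \<open>A negative determinant means an odd number of negative eigenvalues. Unless
  \<open>top\<close> is the only positive one, there are two positive eigenvalues, so five negative
  ones are too many, and a single one is excluded by the trace.\<close>

lemma energy_order_6_det_minus_one:
  assumes n: "CARD('n) = 6" and K33: "K33_free E" and m: "9 \<le> card (edges E)"
    and det: "det (adj_matrix E) = -1"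
  shows "real CARD('n) - 1 + avg_degree E \<le> graph_energy E"
proof (cases "\<forall>i. i \<noteq> top \<longrightarrow> ev i < 0")
  case True
  then show ?thesis using one_positive_eigenvalue_complete energy_complete by blast
next
  case False
  define P Q where "P = {i. 0 < ev i}" and "Q = {i. ev i < 0}"
  have nz: "ev i \<noteq> 0" for i using abs_ev_pos[of i] by auto
  have PQ: "UNIV = P \<union> Q" "P \<inter> Q = {}" unfolding P_def Q_def using nz by (auto simp: not_less_iff_gr_or_eq)
  have split: "(\<Sum>i\<in>UNIV. f i) = (\<Sum>i\<in>P. f i) + (\<Sum>i\<in>Q. f i)" for f :: "'n \<Rightarrow> real"
    by (subst PQ(1)) (rule sum.union_disjoint, use PQ(2) in auto)
  have "CARD('n) = card P + card Q" by (subst PQ(1)) (rule card_Un_disjoint, use PQ(2) in auto)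
  then have cards: "card P + card Q = 6" using n by simp
  have prodP: "0 < (\<Prod>i\<in>P. ev i)" by (intro prod_pos) (auto simp: P_def)
  have prodQ: "(\<Prod>i\<in>Q. ev i) = (-1) ^ card Q * (\<Prod>i\<in>Q. \<bar>ev i\<bar>)"
  proof -
    have "(\<Prod>i\<in>Q. ev i) = (\<Prod>i\<in>Q. (-1) * \<bar>ev i\<bar>)" by (intro prod.cong) (auto simp: Q_def)
    then show ?thesis by (simp only: prod.distrib prod_constant)
  qed
  have absQ: "0 < (\<Prod>i\<in>Q. \<bar>ev i\<bar>)" by (intro prod_pos) (use abs_ev_pos in auto)
  have prod: "(\<Prod>i\<in>P. ev i) * (\<Prod>i\<in>Q. ev i) = -1"
  proof -
    have "(\<Prod>i\<in>UNIV. ev i) = (\<Prod>i\<in>P. ev i) * (\<Prod>i\<in>Q. ev i)"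
      by (subst PQ(1)) (rule prod.union_disjoint, use PQ(2) in auto)
    then show ?thesis using prod_ev det by simp
  qed
  have odd: "odd (card Q)"
  proof
    assume "even (card Q)"
    then have "0 < (\<Prod>i\<in>P. ev i) * (\<Prod>i\<in>Q. ev i)" using prodQ prodP absQ by simp
    then show False using prod by simp
  qed
  have topP: "top \<in> P" using ev_top_pos by (simp add: P_def)
  obtain j where j: "j \<noteq> top" "j \<in> P" using False nz by (auto simp: P_def not_less order_less_le)
  have balance: "(\<Sum>i\<in>P. ev i) = (\<Sum>i\<in>Q. \<bar>ev i\<bar>)"
  proof -
    have "(\<Sum>i\<in>Q. \<bar>ev i\<bar>) = (\<Sum>i\<in>Q. - ev i)" by (intro sum.cong) (auto simp: Q_def)
    then show ?thesis using sum_ev split[of ev] by (simp add: sum_negf)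
  qed
  \<comment> \<open>By trace zero a lone negative eigenvalue would exceed the spectral radius in
    modulus.\<close>
  have "card Q \<noteq> 1"
  proof
    assume "card Q = 1"
    then obtain q where Q: "Q = {q}" by (auto simp: card_1_singleton_iff)
    have "(\<Sum>i\<in>{top, j}. ev i) \<le> (\<Sum>i\<in>P. ev i)" using topP j by (intro sum_mono2) (auto simp: P_def)
    then have "ev top + ev j \<le> \<bar>ev q\<bar>" using balance Q j(1) by simp
    moreover have "0 < ev j" using j by (simp add: P_def)
    ultimately show False using ev_top[of q] by linarith
  qed
  moreover have "2 \<le> card P"
  proof -
    have "card {top, j} \<le> card P" using topP j by (intro card_mono) auto
    then show ?thesis using j(1) by simp
  qed
  moreover have "card Q = 1 \<or> card Q = 3 \<or> 5 \<le> card Q" using odd by presburger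
  ultimately have card: "card P = 3" "card Q = 3" using cards by auto
  have "card (P - {top}) = 2" using card(1) topP by simp
  then obtain a b where ab: "P - {top} = {a, b}" "a \<noteq> b" by (auto simp: card_2_iff)
  then have P: "P = {top, a, b}" "a \<noteq> top" "b \<noteq> top" using topP by auto
  obtain x y z where Q: "Q = {x, y, z}" "x \<noteq> y" "x \<noteq> z" "y \<noteq> z" using card(2) by (auto simp: card_3_iff)
  have m12: "card (edges E) \<le> 12" using K33_free_edges_6[OF K33 simple] n by (metis edge_count_UNIV)
  define d where "d = avg_degree E"
  have d: "d = real (card (edges E)) / 3" using n by (simp add: d_def avg_degree_def)
  have "card (edges E) = 9 \<or> card (edges E) = 10 \<or> card (edges E) = 11 \<or> card (edges E) = 12"
    using m m12 by linarith
  then have dcases: "d = 3 \<or> d = 10/3 \<or> d = 11/3 \<or> d = 4" using d by auto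
  have "5 + d \<le> 2 * (ev top + ev a + ev b)"
  proof (rule three_three_energy[OF dcases])
    show "d \<le> ev top" unfolding d_def by (rule avg_degree_le)
    show "0 < ev a" "0 < ev b" using P by (auto simp: P_def)
    show "0 < \<bar>ev x\<bar>" "0 < \<bar>ev y\<bar>" "0 < \<bar>ev z\<bar>" using nz by auto
    show "ev top + ev a + ev b = \<bar>ev x\<bar> + \<bar>ev y\<bar> + \<bar>ev z\<bar>"
      using balance P Q ab(2) by simp
    show "(ev top)\<^sup>2 + (ev a)\<^sup>2 + (ev b)\<^sup>2 + \<bar>ev x\<bar>\<^sup>2 + \<bar>ev y\<bar>\<^sup>2 + \<bar>ev z\<bar>\<^sup>2 = 6 * d"
      using sum_ev_squares split[of "\<lambda>i. (ev i)\<^sup>2"] P Q ab(2) d by simp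
    have "(\<Prod>i\<in>Q. ev i) = - (\<Prod>i\<in>Q. \<bar>ev i\<bar>)" using prodQ odd by simp
    then show "1 \<le> ev top * (ev a * ev b) * (\<bar>ev x\<bar> * \<bar>ev y\<bar> * \<bar>ev z\<bar>)"
      using prod P Q ab(2) by (simp add: mult.assoc)
  qed
  moreover have "graph_energy E = (\<Sum>i\<in>P. ev i) + (\<Sum>i\<in>Q. \<bar>ev i\<bar>)"
    unfolding energy split[of "\<lambda>i. \<bar>ev i\<bar>"] by (intro arg_cong2[of _ _ _ _ "(+)"] sum.cong) (auto simp: P_def)
  ultimately show ?thesis using balance P ab(2) n by (simp add: d_def)
qed

end

section \<open>Order 4 and the main theorem\<close>

lemma P4_iso:
  assumes simple: "simple_graph E" and U: "UNIV = {a, b, c, d}" and dist: "distinct [a, b, c, d]"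
    and adj: "E a b" "E b c" "E c d" "\<not> E a c" "\<not> E a d" "\<not> E b d"
  shows "graph_iso E {0..3::nat} P4_adj"
proof -
  define f where "f v = (if v = a then 0 else if v = b then 1 else if v = c then 2 else 3 :: nat)" for v
  have f: "f a = 0" "f b = 1" "f c = 2" "f d = 3" using dist by (auto simp: f_def)
  have sym: "E u v = E v u" and irr: "\<not> E u u" for u v using simple unfolding simple_graph_def by blast+
  have "bij_betw f UNIV {0..3}"
    unfolding bij_betw_def U inj_on_def using f by auto
  moreover have "E u v \<longleftrightarrow> P4_adj (f u) (f v)" for u v
  proof -
    have "u \<in> {a, b, c, d}" "v \<in> {a, b, c, d}" using U by auto
    then show ?thesis
      using adj irr sym[of b a] sym[of c b] sym[of d c] sym[of c a] sym[of d a] sym[of d b]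
      by (elim insertE emptyE) (simp_all add: f P4_adj_def doubleton_eq_iff)
  qed
  ultimately show ?thesis unfolding graph_iso_def by blast
qed

lemma paw_iso:
  assumes simple: "simple_graph E" and U: "UNIV = {a, b, c, d}" and dist: "distinct [a, b, c, d]"
    and adj: "E a b" "E b c" "E a c" "E a d" "\<not> E b d" "\<not> E c d"
  shows "graph_iso E {0..3::nat} paw_adj"
proof -
  define f where "f v = (if v = a then 0 else if v = b then 1 else if v = c then 2 else 3 :: nat)" for v
  have f: "f a = 0" "f b = 1" "f c = 2" "f d = 3" using dist by (auto simp: f_def)
  have sym: "E u v = E v u" and irr: "\<not> E u u" for u v using simple unfolding simple_graph_def by blast+
  have "bij_betw f UNIV {0..3}"
    unfolding bij_betw_def U inj_on_def using f by auto
  moreover have "E u v \<longleftrightarrow> paw_adj (f u) (f v)" for u v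
  proof -
    have "u \<in> {a, b, c, d}" "v \<in> {a, b, c, d}" using U by auto
    then show ?thesis
      using adj irr sym[of b a] sym[of c b] sym[of d c] sym[of c a] sym[of d a] sym[of d b]
      by (elim insertE emptyE) (simp_all add: f paw_adj_def doubleton_eq_iff)
  qed
  ultimately show ?thesis unfolding graph_iso_def by blast
qed

text \<open>A propositional problem in six edge variables: twins and isolated vertices are singular,
  and two pairs without edges between them have at most two edges.\<close>

lemma nonsingular_order_4:
  fixes E :: "'n::finite \<Rightarrow> 'n \<Rightarrow> bool"
  assumes simple: "simple_graph E" and det: "det (adj_matrix E) \<noteq> 0" and n: "CARD('n) = 4"
    and P4: "\<not> graph_iso E {0..3::nat} P4_adj" and paw: "\<not> graph_iso E {0..3::nat} paw_adj"
    and m: "2 < card (edges E)"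
  shows "u \<noteq> v \<Longrightarrow> E u v"
proof -
  have sym: "E u v = E v u" and irr: "\<not> E u u" for u v using simple unfolding simple_graph_def by blast+
  obtain a b c d :: 'n where U: "UNIV = {a, b, c, d}" and dist: "distinct [a, b, c, d]"
  proof -
    obtain xs :: "'n list" where xs: "set xs = UNIV" "distinct xs"
      using finite_distinct_list[of "UNIV :: 'n set"] by auto
    then have "length xs = 4" using n distinct_card by metis
    then obtain a b c d where "xs = [a, b, c, d]" by (auto simp: length_Suc_conv numeral_eq_Suc)
    then show thesis using xs that[of a b c d] by auto
  qed
  have UNIV4: "UNIV = {x, y, z, w}" if "distinct [x, y, z, w]" for x y z w :: 'n
    by (rule card_subset_eq[symmetric]) (use that n in simp_all)
  have noP4: "\<not> (E x y \<and> E y z \<and> E z w \<and> \<not> E x z \<and> \<not> E x w \<and> \<not> E y w)"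
    if "distinct [x, y, z, w]" for x y z w
    using P4_iso[OF simple UNIV4[OF that] that] P4 by blast
  have nopaw: "\<not> (E x y \<and> E y z \<and> E x z \<and> E x w \<and> \<not> E y w \<and> \<not> E z w)"
    if "distinct [x, y, z, w]" for x y z w
    using paw_iso[OF simple UNIV4[OF that] that] paw by blast
  have twins: "E x y \<or> E x z \<noteq> E y z \<or> E x w \<noteq> E y w"
    if "distinct [x, y, z, w]" for x y z w
  proof (rule ccontr)
    assume "\<not> ?thesis"
    then have non: "\<not> E x y" "E x z = E y z" "E x w = E y w" by auto
    have "E x t = E y t" for t
    proof -
      have "t \<in> {x, y, z, w}" using UNIV4[OF that] by auto
      then show ?thesis using non irr sym[of y x] by (elim insertE emptyE) simp_all
    qed
    then show False using twins_singular[of x y E] det that by auto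
  qed
  have nonisolated: "E x y \<or> E x z \<or> E x w" if "distinct [x, y, z, w]" for x y z w
  proof (rule ccontr)
    assume non: "\<not> ?thesis"
    have "\<not> E x t" for t
    proof -
      have "t \<in> {x, y, z, w}" using UNIV4[OF that] by auto
      then show ?thesis using non irr by auto
    qed
    then have "deg E x = 0" by (simp add: deg_def)
    then show False using deg_pos[OF det, of x] by simp
  qed
  have two: "\<not> (\<not> E x z \<and> \<not> E x w \<and> \<not> E y z \<and> \<not> E y w)"
    if "distinct [x, y, z, w]" for x y z w
  proof
    assume non: "\<not> E x z \<and> \<not> E x w \<and> \<not> E y z \<and> \<not> E y w"
    have "edges E \<subseteq> {{x, y}, {z, w}}"
    proof
      fix e assume "e \<in> edges E"
      then obtain s t where e: "e = {s, t}" "E s t" unfolding edges_def by blast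
      have "s \<in> {x, y, z, w}" "t \<in> {x, y, z, w}" using UNIV4[OF that] by auto
      then show "e \<in> {{x, y}, {z, w}}"
        using e non irr sym[of z x] sym[of w x] sym[of z y] sym[of w y]
        by (elim insertE emptyE) (simp_all add: insert_commute)
    qed
    then have "card (edges E) \<le> card {{x, y}, {z, w}}" by (intro card_mono) auto
    also have "\<dots> \<le> 2" by (simp add: card_insert_if)
    finally show False using m by simp
  qed
  have comm: "E b a = E a b" "E c a = E a c" "E d a = E a d" "E c b = E b c" "E d b = E b d" "E d c = E c d"
    using sym by blast+
  have ne: "a \<noteq> b" "a \<noteq> c" "a \<noteq> d" "b \<noteq> c" "b \<noteq> d" "c \<noteq> d"
    "b \<noteq> a" "c \<noteq> a" "d \<noteq> a" "c \<noteq> b" "d \<noteq> b" "d \<noteq> c" using dist by auto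
  \<comment> \<open>The instances run through the labellings of each forbidden pattern up to its
    symmetries.\<close>
  have "E a b \<and> E a c \<and> E a d \<and> E b c \<and> E b d \<and> E c d"
    using nonisolated[of a b c d] nonisolated[of b a c d] nonisolated[of c a b d] nonisolated[of d a b c]
      twins[of a b c d] twins[of a c b d] twins[of a d b c] twins[of b c a d] twins[of b d a c] twins[of c d a b]
      two[of a b c d] two[of a c b d] two[of a d b c]
      noP4[of a b c d] noP4[of a b d c] noP4[of a c b d] noP4[of a c d b] noP4[of a d b c] noP4[of a d c b]
      noP4[of b a c d] noP4[of b a d c] noP4[of b c a d] noP4[of b d a c] noP4[of c a b d] noP4[of c b a d]
      nopaw[of a b c d] nopaw[of a b d c] nopaw[of a c d b] nopaw[of b a c d] nopaw[of b a d c] nopaw[of b c d a]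
      nopaw[of c a b d] nopaw[of c a d b] nopaw[of c b d a] nopaw[of d a b c] nopaw[of d a c b] nopaw[of d b c a]
    unfolding comm distinct.simps list.set insert_iff empty_iff by (simp only: ne simp_thms True_implies_equals) sat
  then have all: "E a b" "E a c" "E a d" "E b c" "E b d" "E c d" by blast+
  show "E u v" if "u \<noteq> v"
  proof -
    have "u \<in> {a, b, c, d}" "v \<in> {a, b, c, d}" using U by auto
    then show ?thesis using that all comm by (elim insertE emptyE) simp_all
  qed
qed

theorem theorem3p5:
  fixes E :: "'n::finite \<Rightarrow> 'n \<Rightarrow> bool"
  assumes "simple_graph E"
    and "planar E"
    and "det (adj_matrix E) \<noteq> 0"
    and "\<not> graph_iso E {0..3::nat} P4_adj"
    and "\<not> graph_iso E {0..3::nat} paw_adj"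
  shows "graph_energy E \<ge> real CARD('n) - 1 + avg_degree E"
proof -
  obtain ev top where spectrum: "graph_spectrum E ev top"
    using graph_spectrum_exists[OF assms(1)] by blast
  interpret graph_spectrum E ev top by (rule spectrum)
  interpret nonsingular_graph_spectrum E ev top by unfold_locales (rule assms(3))
  have K33: "K33_free E"
    unfolding K33_free_def using planar_K33_free[OF assms(2)] by blast
  show ?thesis
  proof (cases "\<forall>u v. u \<noteq> v \<longrightarrow> E u v")
    case True
    then show ?thesis using energy_complete by blast
  next
    case False
    then obtain u v where uv: "u \<noteq> v" "\<not> E u v" by blast
    note m2 = nonsingular_noncomplete_edges[OF assms(1,3) uv]
    show ?thesis
    proof (cases "2 * card (edges E) \<le> CARD('n)")
      case True
      have "2 * real (card (edges E)) \<le> real CARD('n)" using True by linarith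
      \<comment> \<open>At average degree at most 1 the target is at most the order, which the
        energy always reaches.\<close>
      then have "avg_degree E \<le> 1" unfolding avg_degree_def by (simp add: divide_le_eq_1)
      then show ?thesis using energy_ge_order by linarith
    next
      case dense: False
      define n where "n = CARD('n)"
      have "n \<noteq> 0" by (simp add: n_def)
      \<comment> \<open>Two missing edges leave at most one edge on three vertices, too few for more
        than \<open>n / 2\<close>; smaller orders do not have two pairs.\<close>
      moreover have "n \<noteq> 1" "n \<noteq> 2" "n \<noteq> 3"
        using m2 dense by (auto simp: n_def[symmetric] choose_two)
      moreover have "n \<noteq> 4"
        using nonsingular_order_4[OF assms(1,3) _ assms(4,5) _ uv(1)] uv(2) dense by (auto simp: n_def)
      ultimately have "n = 5 \<or> n = 6 \<or> n = 7 \<or> n = 8 \<or> n = 9 \<or> n = 10 \<or> n = 11 \<or> n = 12 \<or> n = 13 \<or>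
          (n = 14 \<or> n = 15 \<or> n = 16) \<or> 17 \<le> n"
        by presburger
      then consider "n = 5" | "n = 6" | "n = 7" | "n = 8" | "n = 9" | "n = 10" | "n = 11" | "n = 12"
        | "n = 13" | "n = 14 \<or> n = 15 \<or> n = 16" | "17 \<le> n" by metis
      then show ?thesis
      proof cases
        case 1
        \<comment> \<open>Two of the ten pairs are nonadjacent, hence at most eight edges.\<close>
        then show ?thesis using energy_order_5 K33 dense m2 by (simp add: n_def choose_two)
      next
        case 2
        have "card (edges E) \<le> 8 \<or> 9 \<le> card (edges E)" by linarith
        moreover have "det (adj_matrix E) = -1 \<or> 3 \<le> \<bar>det (adj_matrix E)\<bar>"
          using det_adj_matrix_order_6[OF assms(1,3)] 2 by (simp add: n_def)
        ultimately consider "card (edges E) \<le> 8" | "9 \<le> card (edges E)" "det (adj_matrix E) = -1"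
          | "9 \<le> card (edges E)" "3 \<le> \<bar>det (adj_matrix E)\<bar>"
          by blast
        then show ?thesis
          using energy_order_6_sparse energy_order_6_dense energy_order_6_det_minus_one K33 dense 2
          by cases (simp_all add: n_def)
      qed (use energy_order_7 energy_order_8 energy_order_9 energy_order_10 energy_order_11 energy_order_12
          energy_order_13 energy_order_14_15_16 energy_order_ge_17 K33 dense n_def in simp_all)
    qed
  qed
qed

end
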